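(* Let $\Omega$ be a quiver which is a tree and such that $\mathrm{indec}_{\mathrm{FLEI}}(\Omega)$ is a well-founded partially ordered set, and let $V$ be a representation of $\Omega$. For each $\beta\in\mathrm{indec}_{\mathrm{FLEI}}(\Omega)$ let $G_\beta\subseteq F_\beta$ be a subrepresentation which is a direct sum of elements of $\beta$ and satisfies $F_\beta=F_{<\beta}\oplus G_\beta$. Then $V=\bigoplus_{\alpha\in\mathrm{indec}_{\mathrm{FLEI}}(\Omega)}G_\alpha$. In particular, every such representation $V$ can be written, uniquely up to isomorphism and reordering, as a direct sum of indecomposable FLEI representations, and therefore the category of representations of a quiver with this property is infinite Krull-Schmidt.
   Context: A quiver $\Omega=(\Omega_0,\Omega_1)$ is a (possibly infinite) set of vertices and a set of ordered pairs of vertices (arrows) with source and target maps $s,t$; it is a tree if its underlying undirected graph is a tree. A representation $V$ (over a fixed field) assigns to each vertex $i$ a vector space $V(i)$ (of arbitrary dimension) and to each arrow $a$ a linear map $V(a):V(s(a))\to V(t(a))$. $V$ is FLEI if every $V(i)$ is finite-dimensional and $V(a)$ is an isomorphism for all but finitely many arrows $a$. $\mathrm{indec}_{\mathrm{FLEI}}(\Omega)$ is the set of isomorphism classes of indecomposable FLEI representations; $X\in\alpha$ means $X$ belongs to the class $\alpha$. Relation: $\alpha\ge\beta$ iff there are $\alpha=\gamma_1,\gamma_2,\dots,\gamma_n=\beta$ in $\mathrm{indec}_{\mathrm{FLEI}}(\Omega)$ (with $n\ge1$), representatives $W^{\gamma_i}\in\gamma_i$, and morphisms $W^{\gamma_1}\to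 W^{\gamma_2}\to\cdots\to W^{\gamma_n}$ each of which is nonzero and not an isomorphism. For a fixed representation $V$, define subrepresentations of $V$: $F_\beta=\sum X$, the sum over all subrepresentations $X\subseteq V$ with $X\in\alpha$ for some $\alpha\le\beta$; and $F_{<\beta}=\sum_{\alpha<\beta}F_\alpha$. (A possibly infinite sum of subrepresentations assigns to each vertex all finite linear combinations of vectors of the individual subrepresentations at that vertex.) A category is infinite Krull-Schmidt if every object is a (possibly infinite) direct sum of indecomposable objects and, given two such decompositions of an object, there is a bijection between the two sets of summands taking each indecomposable to an isomorphic one. *)

theory Defs
  imports
    "Graph_Theory.Digraph_Component"
    "HOL-Computational_Algebra.Polynomial"
begin

section \<open>Quivers and trees\<close>

text \<open>
  A quiver is a directed graph satisfying \<^term>\<open>wf_digraph\<close>; the source and target maps are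
  \<^term>\<open>tail\<close> and \<^term>\<open>head\<close>.

  The constant \<^term>\<open>Digraph_Component.tree\<close> is not the right notion here, because it only excludes
  directed cycles. In the following definition the arrows are edges whose direction is forgotten;
  loops are cycles of length 1, and pairs of parallel or antiparallel arrows are cycles of length 2.
\<close>

definition undirected_cycle :: "('v, 'a) pre_digraph \<Rightarrow> 'v list \<Rightarrow> 'a list \<Rightarrow> bool" where
  "undirected_cycle Q vs es \<longleftrightarrow>
     vs \<noteq> [] \<and> length es = length vs \<and> distinct vs \<and> distinct es \<and>
     set vs \<subseteq> verts Q \<and> set es \<subseteq> arcs Q \<and>
     (\<forall>n<length vs. {tail Q (es ! n), head Q (es ! n)} = {vs ! n, vs ! (Suc n mod length vs)})"

definition tree_quiver :: "('v, 'a) pre_digraph \<Rightarrow> bool" where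
  "tree_quiver Q \<longleftrightarrow>
     wf_digraph Q \<and> Digraph_Component.connected Q \<and> (\<nexists>vs es. undirected_cycle Q vs es)"


section \<open>Representations\<close>

text \<open>
  The vector spaces \<open>V(i)\<close> are given as subspaces of one ambient vector space on the type \<^typ>\<open>'b\<close>.
  This is no restriction, since \<^typ>\<open>'b\<close> is arbitrary and any family of vector spaces embeds into its
  direct sum. The values of \<open>spc\<close> outside the vertices, of \<open>mor\<close> outside the arrows, and of
  \<open>mor V a\<close> outside the space at the source of \<open>a\<close> are irrelevant.
\<close>

record ('v, 'a, 'k, 'b) rep =
  scal :: "'k \<Rightarrow> 'b \<Rightarrow> 'b"
  spc :: "'v \<Rightarrow> 'b set"
  mor :: "'a \<Rightarrow> 'b \<Rightarrow> 'b"

definition linear_on ::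
  "('k \<Rightarrow> 'b \<Rightarrow> 'b) \<Rightarrow> ('k \<Rightarrow> 'c \<Rightarrow> 'c) \<Rightarrow> 'b::plus set \<Rightarrow> ('b \<Rightarrow> 'c::plus) \<Rightarrow> bool" where
  "linear_on s s' S f \<longleftrightarrow>
     (\<forall>x\<in>S. \<forall>y\<in>S. f (x + y) = f x + f y) \<and> (\<forall>c. \<forall>x\<in>S. f (s c x) = s' c (f x))"

definition quiver_rep ::
  "('v, 'a) pre_digraph \<Rightarrow> ('v, 'a, 'k::field, 'b::ab_group_add) rep \<Rightarrow> bool" where
  "quiver_rep Q V \<longleftrightarrow>
     vector_space (scal V) \<and>
     (\<forall>i\<in>verts Q. module.subspace (scal V) (spc V i)) \<and>
     (\<forall>a\<in>arcs Q. linear_on (scal V) (scal V) (spc V (tail Q a)) (mor V a) \<and>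
        mor V a ` spc V (tail Q a) \<subseteq> spc V (head Q a))"

definition flei ::
  "('v, 'a) pre_digraph \<Rightarrow> ('v, 'a, 'k::field, 'b::ab_group_add) rep \<Rightarrow> bool" where
  "flei Q V \<longleftrightarrow>
     (\<forall>i\<in>verts Q. \<exists>B. finite B \<and> spc V i = module.span (scal V) B) \<and>
     finite {a\<in>arcs Q. \<not> bij_betw (mor V a) (spc V (tail Q a)) (spc V (head Q a))}"

definition morphism ::
  "('v, 'a) pre_digraph \<Rightarrow> ('v, 'a, 'k::field, 'b::ab_group_add) rep \<Rightarrow>
   ('v, 'a, 'k, 'c::ab_group_add) rep \<Rightarrow> ('v \<Rightarrow> 'b \<Rightarrow> 'c) \<Rightarrow> bool" where
  "morphism Q V W \<phi> \<longleftrightarrow>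
     (\<forall>i\<in>verts Q. linear_on (scal V) (scal W) (spc V i) (\<phi> i) \<and> \<phi> i ` spc V i \<subseteq> spc W i) \<and>
     (\<forall>a\<in>arcs Q. \<forall>x\<in>spc V (tail Q a). \<phi> (head Q a) (mor V a x) = mor W a (\<phi> (tail Q a) x))"

definition isomorphism ::
  "('v, 'a) pre_digraph \<Rightarrow> ('v, 'a, 'k::field, 'b::ab_group_add) rep \<Rightarrow>
   ('v, 'a, 'k, 'c::ab_group_add) rep \<Rightarrow> ('v \<Rightarrow> 'b \<Rightarrow> 'c) \<Rightarrow> bool" where
  "isomorphism Q V W \<phi> \<longleftrightarrow>
     morphism Q V W \<phi> \<and> (\<forall>i\<in>verts Q. bij_betw (\<phi> i) (spc V i) (spc W i))"

definition isomorphic ::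
  "('v, 'a) pre_digraph \<Rightarrow> ('v, 'a, 'k::field, 'b::ab_group_add) rep \<Rightarrow>
   ('v, 'a, 'k, 'c::ab_group_add) rep \<Rightarrow> bool" where
  "isomorphic Q V W \<longleftrightarrow> (\<exists>\<phi>. isomorphism Q V W \<phi>)"

definition nonzero_morphism ::
  "('v, 'a) pre_digraph \<Rightarrow> ('v, 'a, 'k::field, 'b::ab_group_add) rep \<Rightarrow>
   ('v, 'a, 'k, 'c::ab_group_add) rep \<Rightarrow> ('v \<Rightarrow> 'b \<Rightarrow> 'c) \<Rightarrow> bool" where
  "nonzero_morphism Q V W \<phi> \<longleftrightarrow> morphism Q V W \<phi> \<and> (\<exists>i\<in>verts Q. \<exists>x\<in>spc V i. \<phi> i x \<noteq> 0)"


section \<open>Subrepresentations and direct sums\<close>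

text \<open>A subrepresentation of \<open>V\<close> is given by its family of subspaces.\<close>

definition subrep ::
  "('v, 'a) pre_digraph \<Rightarrow> ('v, 'a, 'k::field, 'b::ab_group_add) rep \<Rightarrow> ('v \<Rightarrow> 'b set) \<Rightarrow> bool" where
  "subrep Q V X \<longleftrightarrow>
     (\<forall>i\<in>verts Q. module.subspace (scal V) (X i) \<and> X i \<subseteq> spc V i) \<and>
     (\<forall>a\<in>arcs Q. mor V a ` X (tail Q a) \<subseteq> X (head Q a))"

definition restr ::
  "('v, 'a, 'k, 'b) rep \<Rightarrow> ('v \<Rightarrow> 'b set) \<Rightarrow> ('v, 'a, 'k, 'b) rep" where
  "restr V X = V\<lparr>spc := X\<rparr>"

definition is_direct_sum2 ::
  "('v, 'a) pre_digraph \<Rightarrow> ('v, 'a, 'k::field, 'b::ab_group_add) rep \<Rightarrow>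
   ('v \<Rightarrow> 'b set) \<Rightarrow> ('v \<Rightarrow> 'b set) \<Rightarrow> ('v \<Rightarrow> 'b set) \<Rightarrow> bool" where
  "is_direct_sum2 Q V Z X Y \<longleftrightarrow>
     (\<forall>i\<in>verts Q. Z i = {x + y | x y. x \<in> X i \<and> y \<in> Y i} \<and> X i \<inter> Y i = {0})"

text \<open>\<open>Z\<close> is the internal direct sum of the family \<open>(X j)\<close> indexed by \<open>j \<in> J\<close>.\<close>

definition is_direct_sum ::
  "('v, 'a) pre_digraph \<Rightarrow> ('v, 'a, 'k::field, 'b::ab_group_add) rep \<Rightarrow>
   ('v \<Rightarrow> 'b set) \<Rightarrow> 'j set \<Rightarrow> ('j \<Rightarrow> 'v \<Rightarrow> 'b set) \<Rightarrow> bool" where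
  "is_direct_sum Q V Z J X \<longleftrightarrow>
     (\<forall>i\<in>verts Q.
        Z i = module.span (scal V) (\<Union>j\<in>J. X j i) \<and>
        (\<forall>T f. finite T \<and> T \<subseteq> J \<and> (\<forall>j\<in>T. f j \<in> X j i) \<and> (\<Sum>j\<in>T. f j) = 0 \<longrightarrow>
           (\<forall>j\<in>T. f j = 0)))"

definition zero_family :: "('v, 'a) pre_digraph \<Rightarrow> ('v \<Rightarrow> 'b::zero set) \<Rightarrow> bool" where
  "zero_family Q X \<longleftrightarrow> (\<forall>i\<in>verts Q. X i = {0})"

definition indecomposable ::
  "('v, 'a) pre_digraph \<Rightarrow> ('v, 'a, 'k::field, 'b::ab_group_add) rep \<Rightarrow> bool" where
  "indecomposable Q V \<longleftrightarrow>
     quiver_rep Q V \<and> \<not> zero_family Q (spc V) \<and>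
     (\<forall>X Y. subrep Q V X \<and> subrep Q V Y \<and> is_direct_sum2 Q V (spc V) X Y \<longrightarrow>
        zero_family Q X \<or> zero_family Q Y)"


section \<open>Isomorphism classes of indecomposable FLEI representations\<close>

text \<open>
  The isomorphism classes are formed among the representations whose spaces consist of polynomials.
  The polynomials over \<^typ>\<open>'k\<close> form a vector space of infinite dimension, so that every
  representation with finite-dimensional spaces, over any ambient type, is isomorphic to one of
  these, and no isomorphism class is lost.
\<close>

type_synonym ('v, 'a, 'k) rep_class = "('v, 'a, 'k, 'k poly) rep set"

definition indec_flei :: "('v, 'a) pre_digraph \<Rightarrow> ('v, 'a, 'k::field) rep_class set" where
  "indec_flei Q =
     {V. indecomposable Q V \<and> flei Q V} //
     {(V, W). indecomposable Q V \<and> flei Q V \<and> indecomposable Q W \<and> flei Q W \<and> isomorphic Q V W}"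

definition belongs ::
  "('v, 'a) pre_digraph \<Rightarrow> ('v, 'a, 'k::field, 'b::ab_group_add) rep \<Rightarrow>
   ('v, 'a, 'k) rep_class \<Rightarrow> bool" where
  "belongs Q X \<alpha> \<longleftrightarrow> (\<exists>W\<in>\<alpha>. isomorphic Q X W)"

text \<open>The pair \<open>(\<beta>, \<alpha>)\<close> is in the following relation iff \<open>\<beta> \<le> \<alpha>\<close>.\<close>

definition indec_le ::
  "('v, 'a) pre_digraph \<Rightarrow> (('v, 'a, 'k::field) rep_class \<times> ('v, 'a, 'k) rep_class) set" where
  "indec_le Q = {(\<beta>, \<alpha>). \<exists>\<gamma>s Ws.
     \<gamma>s \<noteq> [] \<and> set \<gamma>s \<subseteq> indec_flei Q \<and> hd \<gamma>s = \<alpha> \<and> last \<gamma>s = \<beta> \<and>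
     length Ws = length \<gamma>s \<and> (\<forall>n<length \<gamma>s. Ws ! n \<in> \<gamma>s ! n) \<and>
     (\<forall>n. Suc n < length \<gamma>s \<longrightarrow>
        (\<exists>\<phi>. nonzero_morphism Q (Ws ! n) (Ws ! Suc n) \<phi> \<and>
             \<not> isomorphism Q (Ws ! n) (Ws ! Suc n) \<phi>))}"

definition F ::
  "('v, 'a) pre_digraph \<Rightarrow> ('v, 'a, 'k::field, 'b::ab_group_add) rep \<Rightarrow>
   ('v, 'a, 'k) rep_class \<Rightarrow> 'v \<Rightarrow> 'b set" where
  "F Q V \<beta> i = module.span (scal V)
     (\<Union>X\<in>{X. subrep Q V X \<and> (\<exists>\<alpha>. (\<alpha>, \<beta>) \<in> indec_le Q \<and> belongs Q (restr V X) \<alpha>)}. X i)"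

definition F_less ::
  "('v, 'a) pre_digraph \<Rightarrow> ('v, 'a, 'k::field, 'b::ab_group_add) rep \<Rightarrow>
   ('v, 'a, 'k) rep_class \<Rightarrow> 'v \<Rightarrow> 'b set" where
  "F_less Q V \<beta> i = module.span (scal V) (\<Union>\<alpha>\<in>{\<alpha>. (\<alpha>, \<beta>) \<in> indec_le Q - Id}. F Q V \<alpha> i)"


section \<open>Decompositions\<close>

text \<open>
  A decomposition into nonzero summands is given by its set of summands: distinct members of
  such a family are distinct as subrepresentations. Any isomorphism of \<open>V\<close> with an external direct
  sum becomes such a decomposition by taking images of the summands.
\<close>

definition sum_of_class ::
  "('v, 'a) pre_digraph \<Rightarrow> ('v, 'a, 'k::field, 'b::ab_group_add) rep \<Rightarrow>
   ('v \<Rightarrow> 'b set) \<Rightarrow> ('v, 'a, 'k) rep_class \<Rightarrow> bool" where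
  "sum_of_class Q V Z \<beta> \<longleftrightarrow>
     (\<exists>D. (\<forall>X\<in>D. subrep Q V X \<and> belongs Q (restr V X) \<beta>) \<and> is_direct_sum Q V Z D (\<lambda>X. X))"

definition indec_decomposition ::
  "('v, 'a) pre_digraph \<Rightarrow> ('v, 'a, 'k::field, 'b::ab_group_add) rep \<Rightarrow>
   ('v \<Rightarrow> 'b set) set \<Rightarrow> bool" where
  "indec_decomposition Q V D \<longleftrightarrow>
     (\<forall>X\<in>D. subrep Q V X \<and> indecomposable Q (restr V X)) \<and>
     is_direct_sum Q V (spc V) D (\<lambda>X. X)"

definition same_summands ::
  "('v, 'a) pre_digraph \<Rightarrow> ('v, 'a, 'k::field, 'b::ab_group_add) rep \<Rightarrow>
   ('v \<Rightarrow> 'b set) set \<Rightarrow> ('v \<Rightarrow> 'b set) set \<Rightarrow> bool" where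
  "same_summands Q V D D' \<longleftrightarrow>
     (\<exists>h. bij_betw h D D' \<and> (\<forall>X\<in>D. isomorphic Q (restr V X) (restr V (h X))))"

definition infinite_krull_schmidt ::
  "('v, 'a) pre_digraph \<Rightarrow> ('v, 'a, 'k::field, 'b::ab_group_add) rep set \<Rightarrow> bool" where
  "infinite_krull_schmidt Q C \<longleftrightarrow>
     (\<forall>V\<in>C. (\<exists>D. indec_decomposition Q V D) \<and>
        (\<forall>D D'. indec_decomposition Q V D \<and> indec_decomposition Q V D' \<longrightarrow>
           same_summands Q V D D'))"

end

theory Submission
  imports Defs "HOL-Library.Function_Algebras" "HOL-Library.Equipollence"
begin

text \<open>
  The order on classes is strict on morphisms: a nonzero morphism between indecomposable FLEI
  representations either is an isomorphism or leads to a strictly smaller class. The point is that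
  the endomorphism rings are division rings (\<open>endomorphism_iso\<close>), since the image of a nonzero
  endomorphism of \<open>X\<close> that is not invertible would have an indecomposable summand \<open>W\<close> smaller than \<open>X\<close>
  with \<open>X \<ge> W \<ge> X\<close>.

  There are enough FLEI representations. For a vertex \<open>i\<close> of the tree, the representation \<open>path_rep i\<close>
  that is freely generated by one vector at \<open>i\<close> has a morphism to \<open>V\<close> hitting any given vector of \<open>V\<close> at
  \<open>i\<close>. It is FLEI unless infinitely many arrows enter the set of vertices reachable from \<open>i\<close>, but
  already four such arrows contain the four subspace problem and contradict antisymmetry
  (\<open>finite_inward\<close>). It follows that kernels, which need not be FLEI, are harmless: if a morphism \<open>S \<rightarrow> V\<close>
  from an FLEI representation kills a vector, then it factors through an FLEI quotient of \<open>S\<close> in which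
  this vector is zero, and this quotient is a finite direct sum of indecomposable FLEI representations
  (\<open>resolution\<close>).

  The resolution of kernel vectors is used twice. By well-founded induction it shows that a
  morphism from an indecomposable FLEI representation \<open>X\<close> to \<open>V\<close> has its image in \<open>F_\<beta>\<close>, where \<open>\<beta>\<close> is the class of \<open>X\<close> (\<open>image_in_F\<close>). It also
  turns a linear relation between vectors of indecomposable FLEI subrepresentations into a relation
  between morphisms, valid modulo \<open>F_{<\<beta>}\<close>, that involves only subrepresentations of one maximal class
  \<open>\<beta>\<close> (\<open>maximal_class_relation\<close>). Consequently subrepresentations that are independent modulo \<open>F_{<\<beta>}\<close>
  within each class \<open>\<beta>\<close> are independent altogether, and a maximal independent family of class \<open>\<beta>\<close>
  generates a complement of \<open>F_{<\<beta>}\<close> in \<open>F_\<beta>\<close>. The complements \<open>G_\<beta>\<close> together span \<open>V\<close>, again by well-founded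
  induction, because each vector of \<open>V\<close> lies in the image of some \<open>path_rep i\<close>.

  For uniqueness, any decomposition into indecomposable FLEI representations computes the filtration:
  the members of class \<open>\<beta>\<close> span a complement of \<open>F_{<\<beta>}\<close> in \<open>F_\<beta>\<close>. Their number is recovered from the
  dimension of \<open>F_\<beta> / F_{<\<beta>}\<close> at one vertex (\<open>multiplicities_unique\<close>). Finally, an indecomposable
  representation is equal to a member of its own decomposition, so it is FLEI, and the uniqueness covers
  all decompositions into indecomposables.
\<close>

section \<open>Linear algebra in subspaces\<close>

lemma vector_space_module: "vector_space s \<Longrightarrow> module s"
  by (simp add: module_iff_vector_space)

lemmas subspace_zeroI = module.subspace_0[OF vector_space_module]
lemmas subspace_addI = module.subspace_add[OF vector_space_module]
lemmas subspace_diffI = module.subspace_diff[OF vector_space_module]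
lemmas subspace_scaleI = module.subspace_scale[OF vector_space_module]
lemmas subspace_sumI = module.subspace_sum[OF vector_space_module]

lemma subspaceI':
  assumes "vector_space s" "0 \<in> U" "\<And>x y. x \<in> U \<Longrightarrow> y \<in> U \<Longrightarrow> x + y \<in> U"
    "\<And>c x. x \<in> U \<Longrightarrow> s c x \<in> U"
  shows "module.subspace s U"
  using assms by (simp add: module.subspace_def[OF vector_space_module])

lemma linear_onI:
  assumes "\<And>x y. x \<in> U \<Longrightarrow> y \<in> U \<Longrightarrow> f (x + y) = f x + f y"
    "\<And>c x. x \<in> U \<Longrightarrow> f (s c x) = s' c (f x)"
  shows "linear_on s s' U f"
  using assms by (simp add: linear_on_def)

lemma linear_on_add: "linear_on s s' U f \<Longrightarrow> x \<in> U \<Longrightarrow> y \<in> U \<Longrightarrow> f (x + y) = f x + f y"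
  by (simp add: linear_on_def)

lemma linear_on_scale: "linear_on s s' U f \<Longrightarrow> x \<in> U \<Longrightarrow> f (s c x) = s' c (f x)"
  by (simp add: linear_on_def)

lemma linear_on_zero:
  fixes f :: "'b::ab_group_add \<Rightarrow> 'c::ab_group_add"
  shows "linear_on s s' U f \<Longrightarrow> 0 \<in> U \<Longrightarrow> f 0 = 0"
  using linear_on_add[of s s' U f 0 0] by simp

lemma linear_on_diff:
  fixes f :: "'b::ab_group_add \<Rightarrow> 'c::ab_group_add"
  assumes "vector_space s" "module.subspace s U" "linear_on s s' U f" "x \<in> U" "y \<in> U"
  shows "f (x - y) = f x - f y"
  using linear_on_add[OF assms(3) subspace_diffI[OF assms(1,2,4,5)] assms(5)]
  by (simp add: algebra_simps)

lemma linear_on_sum: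
  fixes f :: "'b::ab_group_add \<Rightarrow> 'c::ab_group_add"
  assumes "vector_space s" "module.subspace s U" "linear_on s s' U f" "\<And>i. i \<in> I \<Longrightarrow> g i \<in> U"
  shows "f (sum g I) = (\<Sum>i\<in>I. f (g i))"
  using assms(4)
proof (induction I rule: infinite_finite_induct)
  case (insert x F)
  have "sum g F \<in> U"
    using insert by (intro subspace_sumI[OF assms(1,2)]) auto
  with insert show ?case
    by (simp add: linear_on_add[OF assms(3)])
qed (use linear_on_zero[OF assms(3)] subspace_zeroI[OF assms(1,2)] in auto)

lemma linear_on_subset: "linear_on s s' U f \<Longrightarrow> W \<subseteq> U \<Longrightarrow> linear_on s s' W f"
  unfolding linear_on_def by blast

lemma linear_on_comp:
  "linear_on s s' U f \<Longrightarrow> linear_on s' s'' W g \<Longrightarrow> f ` U \<subseteq> W \<Longrightarrow> linear_on s s'' U (\<lambda>x. g (f x))"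
  unfolding linear_on_def by (simp add: image_subset_iff)

lemma linear_on_inj:
  fixes f :: "'b::ab_group_add \<Rightarrow> 'c::ab_group_add"
  assumes "vector_space s" "module.subspace s U" "linear_on s s' U f" "\<And>x. x \<in> U \<Longrightarrow> f x = 0 \<Longrightarrow> x = 0"
  shows "inj_on f U"
proof (rule inj_onI)
  fix x y assume "x \<in> U" "y \<in> U" "f x = f y"
  then have "x - y = 0"
    using assms(4)[OF subspace_diffI[OF assms(1,2)]] linear_on_diff[OF assms(1-3)] by simp
  then show "x = y" by simp
qed

lemma linear_on_injD:
  fixes f :: "'b::ab_group_add \<Rightarrow> 'c::ab_group_add"
  assumes "vector_space s" "module.subspace s U" "linear_on s s' U f" "inj_on f U" "x \<in> U" "f x = 0"
  shows "x = 0"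
  using inj_onD[OF assms(4), of x 0] assms(5,6) linear_on_zero[OF assms(3)] subspace_zeroI[OF assms(1,2)] by simp

lemma linear_on_inv:
  fixes f :: "'b::ab_group_add \<Rightarrow> 'c::ab_group_add"
  assumes "vector_space s" "module.subspace s U" "linear_on s s' U f" "bij_betw f U W"
  shows "linear_on s' s W (inv_into U f)"
proof -
  have W: "W = f ` U" and inj: "inj_on f U" using assms(4) by (auto simp: bij_betw_def)
  show ?thesis
    unfolding W
  proof (rule linear_onI; elim imageE; hypsubst)
    fix x y assume "x \<in> U" "y \<in> U"
    then show "inv_into U f (f x + f y) = inv_into U f (f x) + inv_into U f (f y)"
      by (simp add: linear_on_add[OF assms(3), symmetric] inv_into_f_f[OF inj] subspace_addI[OF assms(1,2)])
  next
    fix c x assume "x \<in> U"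
    then show "inv_into U f (s' c (f x)) = s c (inv_into U f (f x))"
      by (simp add: linear_on_scale[OF assms(3), symmetric] inv_into_f_f[OF inj] subspace_scaleI[OF assms(1,2)])
  qed
qed

lemma linear_on_image_subspace:
  fixes f :: "'b::ab_group_add \<Rightarrow> 'c::ab_group_add"
  assumes "vector_space s" "vector_space s'" "module.subspace s U" "linear_on s s' U f"
  shows "module.subspace s' (f ` U)"
proof (rule subspaceI'[OF assms(2)])
  show "0 \<in> f ` U"
    using linear_on_zero[OF assms(4)] subspace_zeroI[OF assms(1,3)] by force
  show "x + y \<in> f ` U" if "x \<in> f ` U" "y \<in> f ` U" for x y
    using that subspace_addI[OF assms(1,3)] linear_on_add[OF assms(4), symmetric] by auto
  show "s' c x \<in> f ` U" if "x \<in> f ` U" for c x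
    using that subspace_scaleI[OF assms(1,3)] linear_on_scale[OF assms(4), symmetric] by auto
qed

lemma linear_on_preimage_subspace:
  fixes f :: "'b::ab_group_add \<Rightarrow> 'c::ab_group_add"
  assumes "vector_space s" "vector_space s'" "module.subspace s U" "linear_on s s' U f"
    and "module.subspace s' W"
  shows "module.subspace s {x \<in> U. f x \<in> W}"
proof (rule subspaceI'[OF assms(1)])
  show "0 \<in> {x \<in> U. f x \<in> W}"
    using linear_on_zero[OF assms(4)] subspace_zeroI[OF assms(1,3)] subspace_zeroI[OF assms(2,5)] by simp
qed (use subspace_addI[OF assms(1,3)] subspace_addI[OF assms(2,5)] subspace_scaleI[OF assms(1,3)]
       subspace_scaleI[OF assms(2,5)] linear_on_add[OF assms(4)] linear_on_scale[OF assms(4)] in auto)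

text \<open>
  Maps given on a subspace only are extended to the ambient space, so that the library on linear
  maps between whole spaces applies to them.
\<close>

lemma linear_on_extend:
  fixes f :: "'b::ab_group_add \<Rightarrow> 'c::ab_group_add"
  assumes "vector_space s" "vector_space s'" "module.subspace s U" "linear_on s s' U f"
  obtains g where "Vector_Spaces.linear s s' g" "\<And>x. x \<in> U \<Longrightarrow> g x = f x"
proof -
  interpret S: vector_space s by fact
  interpret S': vector_space s' by fact
  interpret P: vector_space_pair s s' ..
  obtain B where B: "B \<subseteq> U" "S.independent B" "U \<subseteq> S.span B"
    using S.maximal_independent_subset by blast
  obtain g where g: "Vector_Spaces.linear s s' g" "\<forall>x\<in>B. g x = f x"
    using P.linear_independent_extend[OF B(2)] by blast
  interpret g: Vector_Spaces.linear s s' g by fact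
  have "x \<in> U \<and> g x = f x" if "x \<in> S.span B" for x
    using that
  proof (induction rule: S.span_induct_alt)
    case base
    then show ?case using linear_on_zero[OF assms(4)] S.subspace_0[OF assms(3)] by simp
  next
    case (step c x y)
    then have "x \<in> U" "s c x \<in> U" "g x = f x" using B(1) g(2) S.subspace_scale[OF assms(3)] by auto
    with step show ?case
      using S.subspace_add[OF assms(3)]
      by (simp add: linear_on_add[OF assms(4)] linear_on_scale[OF assms(4)] g.add g.scale)
  qed
  then show ?thesis using that[OF g(1)] B(3) by blast
qed

definition fin_dim :: "('k::field \<Rightarrow> 'b::ab_group_add \<Rightarrow> 'b) \<Rightarrow> 'b set \<Rightarrow> bool" where
  "fin_dim s U \<longleftrightarrow> (\<exists>B. finite B \<and> U = module.span s B)"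

lemma fin_dim_basis:
  assumes "vector_space s" "fin_dim s U" "module.subspace s W" "W \<subseteq> U"
  obtains B where "finite B" "\<not> module.dependent s B" "module.span s B = W" "card B = vector_space.dim s W"
proof -
  interpret S: vector_space s by fact
  obtain A where A: "finite A" "U = S.span A" using assms(2) by (auto simp: fin_dim_def)
  obtain B where B: "B \<subseteq> W" "S.independent B" "W \<subseteq> S.span B" "card B = S.dim W"
    using S.basis_exists by blast
  have "B \<subseteq> S.span A" using B(1) assms(4) A(2) by blast
  then have "finite B" using S.independent_span_bound[OF A(1) B(2)] by blast
  moreover have "S.span B = W" using S.span_subspace[OF B(1,3) assms(3)] .
  ultimately show ?thesis using that B by blast
qed

lemma fin_dim_subspace:
  assumes "vector_space s" "fin_dim s U" "module.subspace s W" "W \<subseteq> U"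
  shows "fin_dim s W"
  using fin_dim_basis[OF assms] unfolding fin_dim_def by metis

lemma fin_dim_dim_mono:
  assumes "vector_space s" "fin_dim s U" "module.subspace s U" "module.subspace s W" "W \<subseteq> U"
  shows "vector_space.dim s W \<le> vector_space.dim s U"
    and "vector_space.dim s W = vector_space.dim s U \<Longrightarrow> W = U"
proof -
  interpret S: vector_space s by fact
  obtain B where B: "finite B" "S.independent B" "S.span B = W" "card B = S.dim W"
    using fin_dim_basis[OF assms(1,2,4,5)] .
  have "B \<subseteq> U" using B(3) assms(5) S.span_superset by blast
  then obtain C where C: "B \<subseteq> C" "C \<subseteq> U" "S.independent C" "U \<subseteq> S.span C"
    using S.maximal_independent_subset_extend[OF _ B(2)] by blast
  obtain A where A: "finite A" "U = S.span A" using assms(2) by (auto simp: fin_dim_def)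
  have fC: "finite C" using S.independent_span_bound[OF A(1) C(3)] C(2) A(2) by blast
  have UC: "card C = S.dim U" using S.basis_card_eq_dim[OF C(2,4,3)] .
  show "S.dim W \<le> S.dim U" using card_mono[OF fC C(1)] B(4) UC by simp
  assume "S.dim W = S.dim U"
  then have "B = C" using card_subset_eq[OF fC C(1)] B(4) UC by simp
  then show "W = U" using B(3) S.span_subspace[OF C(2,4) assms(3)] by simp
qed

lemma linear_on_dim_image:
  fixes f :: "'b::ab_group_add \<Rightarrow> 'c::ab_group_add"
  assumes "vector_space s" "vector_space s'" "module.subspace s U" "linear_on s s' U f" "fin_dim s U"
  shows "fin_dim s' (f ` U)"
    and "vector_space.dim s' (f ` U) \<le> vector_space.dim s U"
    and "inj_on f U \<longleftrightarrow> vector_space.dim s' (f ` U) = vector_space.dim s U"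
proof -
  interpret S: vector_space s by fact
  interpret S': vector_space s' by fact
  obtain g where g: "Vector_Spaces.linear s s' g" "\<And>x. x \<in> U \<Longrightarrow> g x = f x"
    using linear_on_extend[OF assms(1-4)] by blast
  interpret g: Vector_Spaces.linear s s' g by fact
  obtain B where B: "finite B" "S.independent B" "S.span B = U" "card B = S.dim U"
    using fin_dim_basis[OF assms(1,5,3) order_refl] .
  have fg: "f ` U = g ` U" using g(2) by (auto intro!: image_cong)
  have span: "S'.span (g ` B) = f ` U" using g.span_image[of B] fg B(3) by simp
  show "fin_dim s' (f ` U)" unfolding fin_dim_def using span B(1) by blast
  have "S'.dim (f ` U) \<le> card (g ` B)"
    using S'.dim_le_card[of "f ` U" "g ` B"] span B(1) by blast
  then show "S'.dim (f ` U) \<le> S.dim U" using card_image_le[OF B(1), of g] B(4) by simp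
  have inj: "inj_on f U \<longleftrightarrow> inj_on g (S.span B)" using inj_on_cong[of U g f] g(2) B(3) by simp
  show "inj_on f U \<longleftrightarrow> S'.dim (f ` U) = S.dim U"
  proof
    assume "inj_on f U"
    then have i: "inj_on g (S.span B)" using inj by simp
    have "S'.independent (g ` B)" by (rule g.independent_injective_image[OF B(2) i])
    moreover have "card (g ` B) = card B"
      using card_image[OF inj_on_subset[OF i S.span_superset]] .
    ultimately show "S'.dim (f ` U) = S.dim U"
      using S'.dim_span_eq_card_independent[of "g ` B"] B(4) span by simp
  next
    assume eq: "S'.dim (f ` U) = S.dim U"
    obtain C where C: "C \<subseteq> g ` B" "S'.independent C" "g ` B \<subseteq> S'.span C"
      using S'.maximal_independent_subset by blast
    have "S'.span C = f ` U" using span C S'.span_eq S'.span_superset by (metis order_trans)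
    then have "card C = S.dim U" using S'.dim_span_eq_card_independent[OF C(2)] eq by simp
    then have "card (g ` B) \<le> card C" using card_image_le[OF B(1), of g] B(4) by simp
    then have *: "C = g ` B" using C(1) B(1) by (meson card_seteq finite_imageI)
    with \<open>card C = S.dim U\<close> B have "inj_on g B" by (metis eq_card_imp_inj_on)
    then show "inj_on f U" using C(2) * inj g.inj_on_span_iff_independent_image by simp
  qed
qed

text \<open>
  The image of \<open>p\<close> is a complement of \<open>N\<close> in \<open>U\<close>, and so a model of the quotient \<open>U / N\<close> inside the
  same ambient space.
\<close>

lemma exists_projection_along:
  fixes N U :: "'b::ab_group_add set"
  assumes "vector_space s" "module.subspace s N" "module.subspace s U" "N \<subseteq> U"
  obtains p where "linear_on s s U p" "p ` U \<subseteq> U" "\<And>x. x \<in> U \<Longrightarrow> p x = 0 \<longleftrightarrow> x \<in> N"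
    "\<And>x. x \<in> U \<Longrightarrow> x - p x \<in> N"
proof -
  interpret S: vector_space s by fact
  interpret P: vector_space_pair s s ..
  obtain A where A: "A \<subseteq> N" "S.independent A" "N \<subseteq> S.span A"
    using S.maximal_independent_subset by blast
  obtain B where B: "A \<subseteq> B" "B \<subseteq> U" "S.independent B" "U \<subseteq> S.span B"
    using S.maximal_independent_subset_extend[OF _ A(2), of U] A(1) assms(4) by blast
  obtain p where p: "Vector_Spaces.linear s s p" "\<forall>x\<in>B. p x = (if x \<in> A then 0 else x)"
    using P.linear_independent_extend[OF B(3), of "\<lambda>x. if x \<in> A then 0 else x"] by blast
  interpret p: Vector_Spaces.linear s s p by fact
  have *: "x \<in> U \<and> p x \<in> S.span (B - A) \<and> x - p x \<in> N" if "x \<in> S.span B" for x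
    using that
  proof (induction rule: S.span_induct_alt)
    case base
    then show ?case using S.subspace_0 assms S.span_zero by simp
  next
    case (step c x y)
    have x: "x \<in> U" "p x \<in> S.span (B - A)" "x - p x \<in> N"
      using step(1) B(2) p(2) A(1) S.subspace_0[OF assms(2)] by (auto intro: S.span_base S.span_zero)
    have "(s c x + y) - p (s c x + y) = s c (x - p x) + (y - p y)"
      by (simp add: p.add p.scale S.scale_right_diff_distrib)
    moreover have "s c (x - p x) + (y - p y) \<in> N"
      using x(3) step by (simp add: S.subspace_add[OF assms(2)] S.subspace_scale[OF assms(2)])
    moreover have "s c x + y \<in> U" "p (s c x + y) \<in> S.span (B - A)"
      using x step by (simp_all add: p.add p.scale S.subspace_add[OF assms(3)]
          S.subspace_scale[OF assms(3)] S.span_add S.span_scale)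
    ultimately show ?case by metis
  qed
  have pN: "p x = 0" if "x \<in> N" for x
  proof -
    have "x \<in> S.span A" using that A(3) by blast
    then show ?thesis
      using p(2) B(1) by (induction rule: S.span_induct_alt) (auto simp: p.add p.scale)
  qed
  show ?thesis
  proof
    show "linear_on s s U p" by (simp add: linear_on_def p.add p.scale)
    have "S.span (B - A) \<subseteq> U" using S.span_minimal[OF _ assms(3), of "B - A"] B(2) by blast
    then show "p ` U \<subseteq> U" using * B(4) by blast
    show 1: "x - p x \<in> N" if "x \<in> U" for x using * that B(4) by blast
    show "p x = 0 \<longleftrightarrow> x \<in> N" if "x \<in> U" for x
      using pN 1[OF that] by (metis diff_zero)
  qed
qed

lemma span_UN_iff_finite_sum:
  assumes "vector_space s" "\<And>j. j \<in> J \<Longrightarrow> module.subspace s (X j)"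
  shows "x \<in> module.span s (\<Union>j\<in>J. X j) \<longleftrightarrow>
    (\<exists>T f. finite T \<and> T \<subseteq> J \<and> (\<forall>j\<in>T. f j \<in> X j) \<and> x = (\<Sum>j\<in>T. f j))"
proof -
  interpret S: vector_space s by fact
  show ?thesis
  proof
    assume "x \<in> S.span (\<Union>j\<in>J. X j)"
    then show "\<exists>T f. finite T \<and> T \<subseteq> J \<and> (\<forall>j\<in>T. f j \<in> X j) \<and> x = (\<Sum>j\<in>T. f j)"
    proof (induction rule: S.span_induct_alt)
      case base
      show ?case by (rule exI[of _ "{}"]) simp
    next
      case (step c x y)
      then obtain T f where T: "finite T" "T \<subseteq> J" "\<forall>j\<in>T. f j \<in> X j" "y = (\<Sum>j\<in>T. f j)" by blast
      obtain j where j: "j \<in> J" "x \<in> X j" using step by blast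
      define f' where "f' = (\<lambda>i. if i = j then s c x + (if j \<in> T then f j else 0) else f i)"
      have "f' j \<in> X j"
        using j T(3) assms(2)[OF j(1)] by (simp add: f'_def S.subspace_add S.subspace_scale S.subspace_0)
      moreover have "(\<Sum>i\<in>insert j T. f' i) = s c x + y"
      proof -
        have "(\<Sum>i\<in>insert j T. f' i) = f' j + (\<Sum>i\<in>T - {j}. f' i)"
          using T(1) by (simp add: sum.insert_remove)
        also have "(\<Sum>i\<in>T - {j}. f' i) = (\<Sum>i\<in>T - {j}. f i)"
          by (rule sum.cong) (auto simp: f'_def)
        also have "f' j + \<dots> = s c x + y"
          using T(1) by (simp add: f'_def T(4) sum.remove)
        finally show ?thesis .
      qed
      ultimately show ?case using T j
        by (intro exI[of _ "insert j T"] exI[of _ f']) (auto simp: f'_def)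
    qed
  next
    assume "\<exists>T f. finite T \<and> T \<subseteq> J \<and> (\<forall>j\<in>T. f j \<in> X j) \<and> x = (\<Sum>j\<in>T. f j)"
    then show "x \<in> S.span (\<Union>j\<in>J. X j)"
      by (auto intro!: S.span_sum intro: S.span_base)
  qed
qed

section \<open>Morphisms of representations\<close>

locale rep_quiver =
  fixes Q :: "('v, 'a) pre_digraph"
  assumes wf: "wf_digraph Q"
begin

lemma tail_in [simp]: "a \<in> arcs Q \<Longrightarrow> tail Q a \<in> verts Q"
  and head_in [simp]: "a \<in> arcs Q \<Longrightarrow> head Q a \<in> verts Q"
  using wf by (auto simp: wf_digraph_def)

lemma rep_vs: "quiver_rep Q V \<Longrightarrow> vector_space (scal V)"
  and rep_subspace: "quiver_rep Q V \<Longrightarrow> i \<in> verts Q \<Longrightarrow> module.subspace (scal V) (spc V i)"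
  and rep_linear: "quiver_rep Q V \<Longrightarrow> a \<in> arcs Q \<Longrightarrow>
        linear_on (scal V) (scal V) (spc V (tail Q a)) (mor V a)"
  and rep_mor_in: "quiver_rep Q V \<Longrightarrow> a \<in> arcs Q \<Longrightarrow> x \<in> spc V (tail Q a) \<Longrightarrow>
        mor V a x \<in> spc V (head Q a)"
  by (auto simp: quiver_rep_def)

lemma rep_zero: "quiver_rep Q V \<Longrightarrow> i \<in> verts Q \<Longrightarrow> 0 \<in> spc V i"
  and rep_add: "quiver_rep Q V \<Longrightarrow> i \<in> verts Q \<Longrightarrow> x \<in> spc V i \<Longrightarrow> y \<in> spc V i \<Longrightarrow> x + y \<in> spc V i"
  and rep_diff: "quiver_rep Q V \<Longrightarrow> i \<in> verts Q \<Longrightarrow> x \<in> spc V i \<Longrightarrow> y \<in> spc V i \<Longrightarrow> x - y \<in> spc V i"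
  and rep_scale: "quiver_rep Q V \<Longrightarrow> i \<in> verts Q \<Longrightarrow> x \<in> spc V i \<Longrightarrow> scal V c x \<in> spc V i"
  by (meson rep_vs rep_subspace subspace_zeroI subspace_addI subspace_diffI subspace_scaleI)+

lemma rep_sum: "quiver_rep Q V \<Longrightarrow> i \<in> verts Q \<Longrightarrow> (\<And>t. t \<in> T \<Longrightarrow> f t \<in> spc V i) \<Longrightarrow> sum f T \<in> spc V i"
  by (meson rep_vs rep_subspace subspace_sumI)

lemma rep_mor_zero:
  fixes V :: "('v, 'a, 'k::field, 'b::ab_group_add) rep"
  shows "quiver_rep Q V \<Longrightarrow> a \<in> arcs Q \<Longrightarrow> mor V a 0 = 0"
  by (meson linear_on_zero rep_linear rep_zero tail_in)

lemma restr_simps [simp]: "scal (restr V X) = scal V" "spc (restr V X) = X" "mor (restr V X) = mor V"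
  "restr (restr V X) Y = restr V Y"
  by (simp_all add: restr_def)

lemma subrep_subspace: "subrep Q V X \<Longrightarrow> i \<in> verts Q \<Longrightarrow> module.subspace (scal V) (X i)"
  and subrep_subset: "subrep Q V X \<Longrightarrow> i \<in> verts Q \<Longrightarrow> X i \<subseteq> spc V i"
  and subrep_in: "subrep Q V X \<Longrightarrow> i \<in> verts Q \<Longrightarrow> x \<in> X i \<Longrightarrow> x \<in> spc V i"
  and subrep_mor: "subrep Q V X \<Longrightarrow> a \<in> arcs Q \<Longrightarrow> x \<in> X (tail Q a) \<Longrightarrow> mor V a x \<in> X (head Q a)"
  unfolding subrep_def by (blast | simp add: image_subset_iff)+

lemma quiver_rep_restr:
  "quiver_rep Q V \<Longrightarrow> subrep Q V X \<Longrightarrow> quiver_rep Q (restr V X)"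
  unfolding quiver_rep_def subrep_def using linear_on_subset by fastforce

lemma subrep_spc: "quiver_rep Q V \<Longrightarrow> subrep Q V (spc V)"
  by (auto simp: quiver_rep_def subrep_def)

lemma subrep_restr: "subrep Q V X \<Longrightarrow> subrep Q (restr V X) Y \<longleftrightarrow> subrep Q V Y \<and> (\<forall>i\<in>verts Q. Y i \<subseteq> X i)"
  by (auto simp: subrep_def subset_iff)

lemma morphism_linear: "morphism Q V W \<phi> \<Longrightarrow> i \<in> verts Q \<Longrightarrow> linear_on (scal V) (scal W) (spc V i) (\<phi> i)"
  and morphism_in: "morphism Q V W \<phi> \<Longrightarrow> i \<in> verts Q \<Longrightarrow> x \<in> spc V i \<Longrightarrow> \<phi> i x \<in> spc W i"
  and morphism_mor: "morphism Q V W \<phi> \<Longrightarrow> a \<in> arcs Q \<Longrightarrow> x \<in> spc V (tail Q a) \<Longrightarrow>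
     \<phi> (head Q a) (mor V a x) = mor W a (\<phi> (tail Q a) x)"
  by (auto simp: morphism_def)

lemma morphism_add: "morphism Q V W \<phi> \<Longrightarrow> i \<in> verts Q \<Longrightarrow> x \<in> spc V i \<Longrightarrow> y \<in> spc V i \<Longrightarrow>
    \<phi> i (x + y) = \<phi> i x + \<phi> i y"
  by (auto simp: morphism_def linear_on_def)

lemma morphism_zero:
  fixes V :: "('v, 'a, 'k::field, 'b::ab_group_add) rep" and W :: "('v, 'a, 'k, 'c::ab_group_add) rep"
  shows "quiver_rep Q V \<Longrightarrow> morphism Q V W \<phi> \<Longrightarrow> i \<in> verts Q \<Longrightarrow> \<phi> i 0 = 0"
  using morphism_linear linear_on_zero rep_zero by metis

lemma morphism_diff:
  fixes V :: "('v, 'a, 'k::field, 'b::ab_group_add) rep" and W :: "('v, 'a, 'k, 'c::ab_group_add) rep"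
  shows "quiver_rep Q V \<Longrightarrow> morphism Q V W \<phi> \<Longrightarrow> i \<in> verts Q \<Longrightarrow> x \<in> spc V i \<Longrightarrow> y \<in> spc V i \<Longrightarrow>
     \<phi> i (x - y) = \<phi> i x - \<phi> i y"
  by (rule linear_on_diff[OF rep_vs rep_subspace morphism_linear])

lemma morphism_sum_arg:
  fixes V :: "('v, 'a, 'k::field, 'b::ab_group_add) rep" and W :: "('v, 'a, 'k, 'c::ab_group_add) rep"
  assumes "quiver_rep Q V" "morphism Q V W \<phi>" "i \<in> verts Q" "\<And>t. t \<in> T \<Longrightarrow> g t \<in> spc V i"
  shows "\<phi> i (sum g T) = (\<Sum>t\<in>T. \<phi> i (g t))"
  by (rule linear_on_sum[OF rep_vs[OF assms(1)] rep_subspace[OF assms(1,3)] morphism_linear[OF assms(2,3)] assms(4)])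

lemma morphism_comp:
  assumes "morphism Q U V \<phi>" "morphism Q V W \<psi>"
  shows "morphism Q U W (\<lambda>i x. \<psi> i (\<phi> i x))"
proof -
  have "linear_on (scal U) (scal W) (spc U i) (\<lambda>x. \<psi> i (\<phi> i x))" if "i \<in> verts Q" for i
    by (rule linear_on_comp[OF morphism_linear[OF assms(1) that] morphism_linear[OF assms(2) that]])
      (use assms that in \<open>auto intro: morphism_in\<close>)
  then show ?thesis
    using assms unfolding morphism_def by (simp add: image_subset_iff)
qed

lemma morphism_id: "morphism Q V V (\<lambda>i x. x)"
  by (simp add: morphism_def linear_on_def)

lemma morphism_zero_map:
  fixes V :: "('v, 'a, 'k::field, 'b::ab_group_add) rep" and W :: "('v, 'a, 'k, 'c::ab_group_add) rep"
  assumes "quiver_rep Q W"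
  shows "morphism Q V W (\<lambda>i x. 0)"
  using assms rep_zero[OF assms] rep_mor_zero[OF assms]
  by (auto simp: morphism_def linear_on_def module.scale_zero_right[OF vector_space_module[OF rep_vs[OF assms]]])

lemma morphism_plus:
  fixes V :: "('v, 'a, 'k::field, 'b::ab_group_add) rep" and W :: "('v, 'a, 'k, 'c::ab_group_add) rep"
  assumes "quiver_rep Q W" "morphism Q V W \<phi>" "morphism Q V W \<psi>"
  shows "morphism Q V W (\<lambda>i x. \<phi> i x + \<psi> i x)"
proof -
  interpret W: vector_space "scal W" by (rule rep_vs[OF assms(1)])
  show ?thesis
    using assms(2,3) rep_add[OF assms(1)] linear_on_add[OF rep_linear[OF assms(1)]]
    unfolding morphism_def linear_on_def by (auto simp: image_subset_iff W.scale_right_distrib)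
qed

lemma morphism_sum:
  fixes V :: "('v, 'a, 'k::field, 'b::ab_group_add) rep" and W :: "('v, 'a, 'k, 'c::ab_group_add) rep"
  assumes "quiver_rep Q W" "\<And>t. t \<in> T \<Longrightarrow> morphism Q V W (\<phi> t)"
  shows "morphism Q V W (\<lambda>i x. \<Sum>t\<in>T. \<phi> t i x)"
  using assms(2)
proof (induction T rule: infinite_finite_induct)
  case (insert t T)
  then show ?case using morphism_plus[OF assms(1), of V "\<phi> t" "\<lambda>i x. \<Sum>t\<in>T. \<phi> t i x"] by simp
qed (simp_all add: morphism_zero_map[OF assms(1)])

lemma morphism_uminus:
  fixes V :: "('v, 'a, 'k::field, 'b::ab_group_add) rep" and W :: "('v, 'a, 'k, 'c::ab_group_add) rep"
  assumes "quiver_rep Q W" "morphism Q V W \<phi>"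
  shows "morphism Q V W (\<lambda>i x. - \<phi> i x)"
proof -
  interpret W: vector_space "scal W" by (rule rep_vs[OF assms(1)])
  have "- y \<in> spc W i" if "i \<in> verts Q" "y \<in> spc W i" for i y
    using rep_diff[OF assms(1) that(1) rep_zero[OF assms(1) that(1)] that(2)] by simp
  moreover have "mor W a (- y) = - mor W a y" if "a \<in> arcs Q" "y \<in> spc W (tail Q a)" for a y
    using linear_on_diff[OF rep_vs[OF assms(1)] rep_subspace[OF assms(1) tail_in[OF that(1)]]
        rep_linear[OF assms(1) that(1)], of 0 y] that rep_zero[OF assms(1)] rep_mor_zero[OF assms(1)] by simp
  ultimately show ?thesis
    using assms(2) unfolding morphism_def linear_on_def by (auto simp: image_subset_iff)
qed

lemma morphism_restr_dom: "morphism Q V W \<phi> \<Longrightarrow> subrep Q V X \<Longrightarrow> morphism Q (restr V X) W \<phi>"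
  unfolding morphism_def subrep_def restr_simps
  by (meson linear_on_subset image_mono order_trans subsetD tail_in)

lemma morphism_restr_cod:
  "morphism Q V W \<phi> \<Longrightarrow> (\<And>i x. i \<in> verts Q \<Longrightarrow> x \<in> spc V i \<Longrightarrow> \<phi> i x \<in> X i) \<Longrightarrow> morphism Q V (restr W X) \<phi>"
  unfolding morphism_def by auto

lemma morphism_into_subrep: "morphism Q V (restr W X) \<phi> \<Longrightarrow> subrep Q W X \<Longrightarrow> morphism Q V W \<phi>"
  unfolding morphism_def subrep_def by (auto simp: image_subset_iff subset_eq)

lemma morphism_inclusion: "subrep Q V X \<Longrightarrow> morphism Q (restr V X) V (\<lambda>i x. x)"
  by (rule morphism_restr_dom[OF morphism_id])

lemma isomorphism_inv:
  fixes V :: "('v, 'a, 'k::field, 'b::ab_group_add) rep" and W :: "('v, 'a, 'k, 'c::ab_group_add) rep"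
  assumes "quiver_rep Q V" "isomorphism Q V W \<phi>"
  shows "isomorphism Q W V (\<lambda>i. inv_into (spc V i) (\<phi> i))"
proof -
  have m: "morphism Q V W \<phi>" and b: "\<And>i. i \<in> verts Q \<Longrightarrow> bij_betw (\<phi> i) (spc V i) (spc W i)"
    using assms(2) by (auto simp: isomorphism_def)
  have b': "bij_betw (inv_into (spc V i) (\<phi> i)) (spc W i) (spc V i)" if "i \<in> verts Q" for i
    using b[OF that] by (rule bij_betw_inv_into)
  have "linear_on (scal W) (scal V) (spc W i) (inv_into (spc V i) (\<phi> i))" if "i \<in> verts Q" for i
    by (rule linear_on_inv[OF rep_vs rep_subspace morphism_linear b]) (use assms(1) m that in auto)
  moreover have "inv_into (spc V (head Q a)) (\<phi> (head Q a)) (mor W a x) =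
      mor V a (inv_into (spc V (tail Q a)) (\<phi> (tail Q a)) x)" if a: "a \<in> arcs Q" "x \<in> spc W (tail Q a)" for a x
  proof -
    obtain y where y: "y \<in> spc V (tail Q a)" "x = \<phi> (tail Q a) y"
      using b[of "tail Q a"] a by (auto simp: bij_betw_def)
    have "mor W a x = \<phi> (head Q a) (mor V a y)" using morphism_mor[OF m a(1) y(1)] y(2) by simp
    then show ?thesis
      using y a rep_mor_in[OF assms(1) a(1) y(1)]
      by (simp add: bij_betw_inv_into_left[OF b[OF tail_in[OF a(1)]]] bij_betw_inv_into_left[OF b[OF head_in[OF a(1)]]])
  qed
  ultimately show ?thesis using b' unfolding isomorphism_def morphism_def bij_betw_def by simp
qed

lemma isomorphism_comp:
  assumes "isomorphism Q U V \<phi>" "isomorphism Q V W \<psi>"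
  shows "isomorphism Q U W (\<lambda>i x. \<psi> i (\<phi> i x))"
proof -
  have "bij_betw (\<lambda>x. \<psi> i (\<phi> i x)) (spc U i) (spc W i)" if "i \<in> verts Q" for i
    using bij_betw_trans[of "\<phi> i" "spc U i" "spc V i" "\<psi> i" "spc W i"] assms that
    by (simp add: isomorphism_def comp_def)
  then show ?thesis
    using assms morphism_comp[of U V \<phi> W \<psi>] by (simp add: isomorphism_def)
qed

lemma isomorphic_sym:
  fixes V :: "('v, 'a, 'k::field, 'b::ab_group_add) rep" and W :: "('v, 'a, 'k, 'c::ab_group_add) rep"
  shows "quiver_rep Q V \<Longrightarrow> isomorphic Q V W \<Longrightarrow> isomorphic Q W V"
  unfolding isomorphic_def using isomorphism_inv by blast

lemma isomorphic_trans: "isomorphic Q U V \<Longrightarrow> isomorphic Q V W \<Longrightarrow> isomorphic Q U W"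
  unfolding isomorphic_def using isomorphism_comp by blast

lemma isomorphismI:
  fixes V :: "('v, 'a, 'k::field, 'b::ab_group_add) rep" and W :: "('v, 'a, 'k, 'c::ab_group_add) rep"
  assumes "quiver_rep Q V" "morphism Q V W \<phi>"
    "\<And>i x. i \<in> verts Q \<Longrightarrow> x \<in> spc V i \<Longrightarrow> \<phi> i x = 0 \<Longrightarrow> x = 0"
    "\<And>i. i \<in> verts Q \<Longrightarrow> spc W i \<subseteq> \<phi> i ` spc V i"
  shows "isomorphism Q V W \<phi>"
proof -
  have "inj_on (\<phi> i) (spc V i)" if "i \<in> verts Q" for i
    by (rule linear_on_inj[OF rep_vs[OF assms(1)] rep_subspace[OF assms(1) that] morphism_linear[OF assms(2) that]])
      (use assms(3) that in auto)
  then show ?thesis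
    unfolding isomorphism_def bij_betw_def using assms(2,4) morphism_in[OF assms(2)] by auto
qed

lemma isomorphism_eq_zero:
  fixes V :: "('v, 'a, 'k::field, 'b::ab_group_add) rep" and W :: "('v, 'a, 'k, 'c::ab_group_add) rep"
  assumes "quiver_rep Q V" "isomorphism Q V W \<phi>" "i \<in> verts Q" "x \<in> spc V i" "\<phi> i x = 0"
  shows "x = 0"
proof -
  have m: "morphism Q V W \<phi>" and b: "inj_on (\<phi> i) (spc V i)"
    using assms(2,3) by (auto simp: isomorphism_def bij_betw_def)
  show ?thesis
    by (rule linear_on_injD[OF rep_vs[OF assms(1)] rep_subspace[OF assms(1,3)] morphism_linear[OF m assms(3)] b assms(4,5)])
qed

section \<open>Kernels and images\<close>

lemma subrep_preimage:
  fixes V :: "('v, 'a, 'k::field, 'b::ab_group_add) rep" and W :: "('v, 'a, 'k, 'c::ab_group_add) rep"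
  assumes "quiver_rep Q V" "quiver_rep Q W" "morphism Q V W \<phi>" "subrep Q W X"
  shows "subrep Q V (\<lambda>i. {x \<in> spc V i. \<phi> i x \<in> X i})"
  unfolding subrep_def
proof (intro conjI ballI)
  fix i assume i: "i \<in> verts Q"
  show "module.subspace (scal V) {x \<in> spc V i. \<phi> i x \<in> X i}"
    by (rule linear_on_preimage_subspace[OF rep_vs rep_vs rep_subspace morphism_linear subrep_subspace])
       (use assms i in auto)
qed (use assms(3,4) in \<open>auto simp: rep_mor_in[OF assms(1)] morphism_mor subrep_mor\<close>)

lemma subrep_zero:
  fixes V :: "('v, 'a, 'k::field, 'b::ab_group_add) rep"
  assumes "quiver_rep Q V"
  shows "subrep Q V (\<lambda>i. {0})"
  unfolding subrep_def
  using rep_zero[OF assms] rep_mor_zero[OF assms] module.subspace_single_0[OF vector_space_module[OF rep_vs[OF assms]]]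
  by simp

lemma subrep_kernel:
  fixes V :: "('v, 'a, 'k::field, 'b::ab_group_add) rep" and W :: "('v, 'a, 'k, 'c::ab_group_add) rep"
  assumes "quiver_rep Q V" "quiver_rep Q W" "morphism Q V W \<phi>"
  shows "subrep Q V (\<lambda>i. {x \<in> spc V i. \<phi> i x = 0})"
  using subrep_preimage[OF assms subrep_zero[OF assms(2)]] by simp

lemma subrep_image:
  fixes V :: "('v, 'a, 'k::field, 'b::ab_group_add) rep" and W :: "('v, 'a, 'k, 'c::ab_group_add) rep"
  assumes "quiver_rep Q V" "quiver_rep Q W" "morphism Q V W \<phi>"
  shows "subrep Q W (\<lambda>i. \<phi> i ` spc V i)"
  unfolding subrep_def
proof (intro conjI ballI)
  fix i assume i: "i \<in> verts Q"
  show "module.subspace (scal W) (\<phi> i ` spc V i)"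
    by (rule linear_on_image_subspace[OF rep_vs rep_vs rep_subspace morphism_linear])
       (use assms i in auto)
next
  fix a assume a: "a \<in> arcs Q"
  show "mor W a ` \<phi> (tail Q a) ` spc V (tail Q a) \<subseteq> \<phi> (head Q a) ` spc V (head Q a)"
    using morphism_mor[OF assms(3) a, symmetric] rep_mor_in[OF assms(1) a] by auto
qed (use assms(3) morphism_in in auto)

section \<open>FLEI representations\<close>

lemma flei_iff: "flei Q V \<longleftrightarrow> (\<forall>i\<in>verts Q. fin_dim (scal V) (spc V i)) \<and>
   finite {a\<in>arcs Q. \<not> bij_betw (mor V a) (spc V (tail Q a)) (spc V (head Q a))}"
  by (simp add: flei_def fin_dim_def)

lemma flei_fin_dim: "flei Q V \<Longrightarrow> i \<in> verts Q \<Longrightarrow> fin_dim (scal V) (spc V i)"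
  by (simp add: flei_iff)

lemma morphism_image_fin_dim:
  fixes V :: "('v, 'a, 'k::field, 'b::ab_group_add) rep" and W :: "('v, 'a, 'k, 'c::ab_group_add) rep"
  assumes "quiver_rep Q V" "quiver_rep Q W" "flei Q V" "morphism Q V W \<phi>" "i \<in> verts Q"
  shows "fin_dim (scal W) (\<phi> i ` spc V i)"
  by (rule linear_on_dim_image(1)[OF rep_vs[OF assms(1)] rep_vs[OF assms(2)] rep_subspace[OF assms(1,5)]
        morphism_linear[OF assms(4,5)] flei_fin_dim[OF assms(3,5)]])

lemma flei_isomorphic:
  fixes V :: "('v, 'a, 'k::field, 'b::ab_group_add) rep" and W :: "('v, 'a, 'k, 'c::ab_group_add) rep"
  assumes "quiver_rep Q V" "quiver_rep Q W" "isomorphic Q V W" "flei Q V"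
  shows "flei Q W"
proof -
  obtain \<phi> where phi: "isomorphism Q V W \<phi>" using assms(3) by (auto simp: isomorphic_def)
  have m: "morphism Q V W \<phi>" and b: "\<And>i. i \<in> verts Q \<Longrightarrow> bij_betw (\<phi> i) (spc V i) (spc W i)"
    using phi by (auto simp: isomorphism_def)
  have "fin_dim (scal W) (spc W i)" if "i \<in> verts Q" for i
    using morphism_image_fin_dim[OF assms(1,2,4) m that] b[OF that] by (auto simp: bij_betw_def)
  moreover have "bij_betw (mor W a) (spc W (tail Q a)) (spc W (head Q a))"
    if a: "a \<in> arcs Q" and bm: "bij_betw (mor V a) (spc V (tail Q a)) (spc V (head Q a))" for a
  proof -
    have "bij_betw (\<phi> (head Q a) \<circ> (mor V a \<circ> inv_into (spc V (tail Q a)) (\<phi> (tail Q a))))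
        (spc W (tail Q a)) (spc W (head Q a))"
      using a by (intro bij_betw_trans[OF bij_betw_trans[OF bij_betw_inv_into[OF b] bm] b]) auto
    moreover have "mor W a x = (\<phi> (head Q a) \<circ> (mor V a \<circ> inv_into (spc V (tail Q a)) (\<phi> (tail Q a)))) x"
      if "x \<in> spc W (tail Q a)" for x
      using that morphism_mor[OF m a, of "inv_into (spc V (tail Q a)) (\<phi> (tail Q a)) x"]
        b[OF tail_in[OF a]] bij_betw_inv_into_right[OF b[OF tail_in[OF a]] that]
      by (simp add: bij_betw_def inv_into_into)
    ultimately show ?thesis by (simp cong: bij_betw_cong)
  qed
  ultimately show ?thesis
    using assms(4) unfolding flei_iff
    by (auto elim!: rev_finite_subset)
qed

text \<open>
  Along an arrow where both representations have isomorphisms, the image inherits injectivity from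
  \<open>W\<close> and surjectivity from \<open>V\<close>. Subrepresentations of FLEI representations are in general not FLEI;
  the ones that occur below are images.
\<close>

lemma flei_image:
  fixes V :: "('v, 'a, 'k::field, 'b::ab_group_add) rep" and W :: "('v, 'a, 'k, 'c::ab_group_add) rep"
  assumes "quiver_rep Q V" "quiver_rep Q W" "flei Q V" "flei Q W" "morphism Q V W \<phi>"
  shows "flei Q (restr W (\<lambda>i. \<phi> i ` spc V i))"
  unfolding flei_iff restr_simps
proof (intro conjI ballI)
  fix i assume i: "i \<in> verts Q"
  show "fin_dim (scal W) (\<phi> i ` spc V i)"
    by (rule morphism_image_fin_dim[OF assms(1-3,5) i])
next
  have "bij_betw (mor W a) (\<phi> (tail Q a) ` spc V (tail Q a)) (\<phi> (head Q a) ` spc V (head Q a))"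
    if a: "a \<in> arcs Q" and b: "bij_betw (mor V a) (spc V (tail Q a)) (spc V (head Q a))"
      "bij_betw (mor W a) (spc W (tail Q a)) (spc W (head Q a))" for a
    unfolding bij_betw_def
  proof
    show "inj_on (mor W a) (\<phi> (tail Q a) ` spc V (tail Q a))"
      using b(2) a morphism_in[OF assms(5)] by (auto simp: bij_betw_def intro: inj_on_subset)
    have "spc V (head Q a) = mor V a ` spc V (tail Q a)" using b(1) by (simp add: bij_betw_def)
    then show "mor W a ` \<phi> (tail Q a) ` spc V (tail Q a) = \<phi> (head Q a) ` spc V (head Q a)"
      using morphism_mor[OF assms(5) a] by (auto simp: image_image intro!: image_cong)
  qed
  then have "{a \<in> arcs Q. \<not> bij_betw (mor W a) (\<phi> (tail Q a) ` spc V (tail Q a)) (\<phi> (head Q a) ` spc V (head Q a))}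
    \<subseteq> {a\<in>arcs Q. \<not> bij_betw (mor V a) (spc V (tail Q a)) (spc V (head Q a))} \<union>
      {a\<in>arcs Q. \<not> bij_betw (mor W a) (spc W (tail Q a)) (spc W (head Q a))}" by blast
  then show "finite {a \<in> arcs Q. \<not> bij_betw (mor W a) (\<phi> (tail Q a) ` spc V (tail Q a)) (\<phi> (head Q a) ` spc V (head Q a))}"
    using assms(3,4) unfolding flei_iff by (meson finite_Un finite_subset)
qed

lemma zero_family_isomorphic:
  fixes V :: "('v, 'a, 'k::field, 'b::ab_group_add) rep" and W :: "('v, 'a, 'k, 'c::ab_group_add) rep"
  assumes "quiver_rep Q V" "isomorphism Q V W \<phi>"
  shows "zero_family Q (spc V) \<longleftrightarrow> zero_family Q (spc W)"
proof -
  have "spc V i = {0} \<longleftrightarrow> spc W i = {0}" if "i \<in> verts Q" for i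
  proof -
    have b: "bij_betw (\<phi> i) (spc V i) (spc W i)" and m: "morphism Q V W \<phi>"
      using assms(2) that by (auto simp: isomorphism_def)
    have z: "\<phi> i 0 = 0" "0 \<in> spc V i" using morphism_zero[OF assms(1) m that] rep_zero[OF assms(1) that] by auto
    have im: "spc W i = \<phi> i ` spc V i" and inj: "inj_on (\<phi> i) (spc V i)"
      using b by (auto simp: bij_betw_def)
    have "x = 0" if "x \<in> spc V i" "spc W i = {0}" for x
      using that inj_onD[OF inj, of x 0] z im by auto
    then show ?thesis using z im by auto
  qed
  then show ?thesis by (simp add: zero_family_def)
qed

text \<open>
  A decomposition of \<open>W\<close> is pulled back along the isomorphism.
\<close>

lemma indecomposable_isomorphic:
  fixes V :: "('v, 'a, 'k::field, 'b::ab_group_add) rep" and W :: "('v, 'a, 'k, 'c::ab_group_add) rep"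
  assumes "quiver_rep Q W" "isomorphic Q V W" "indecomposable Q V"
  shows "indecomposable Q W"
proof -
  obtain \<phi> where phi: "isomorphism Q V W \<phi>" using assms(2) by (auto simp: isomorphic_def)
  have m: "morphism Q V W \<phi>" and b: "\<And>i. i \<in> verts Q \<Longrightarrow> bij_betw (\<phi> i) (spc V i) (spc W i)"
    using phi by (auto simp: isomorphism_def)
  have V: "quiver_rep Q V" using assms(3) by (simp add: indecomposable_def)
  have "zero_family Q X \<or> zero_family Q Y"
    if XY: "subrep Q W X" "subrep Q W Y" "is_direct_sum2 Q W (spc W) X Y" for X Y
  proof -
    let ?P = "\<lambda>Z i. {x \<in> spc V i. \<phi> i x \<in> Z i}"
    have sub: "subrep Q V (?P X)" "subrep Q V (?P Y)"
      using subrep_preimage[OF V assms(1) m] XY by auto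
    have inj: "x = 0" if "i \<in> verts Q" "x \<in> spc V i" "\<phi> i x = 0" for i x
      using isomorphism_eq_zero[OF V phi that] .
    have surj: "\<exists>x\<in>spc V i. \<phi> i x = w" if "i \<in> verts Q" "w \<in> spc W i" for i w
      using b that by (force simp: bij_betw_def)
    have "is_direct_sum2 Q V (spc V) (?P X) (?P Y)"
      unfolding is_direct_sum2_def
    proof (intro ballI conjI equalityI subsetI)
      fix i v assume i: "i \<in> verts Q" and v: "v \<in> spc V i"
      have "\<phi> i v \<in> {x + y |x y. x \<in> X i \<and> y \<in> Y i}"
        using XY(3) i v morphism_in[OF m] by (auto simp: is_direct_sum2_def)
      then obtain x y where xy: "x \<in> X i" "y \<in> Y i" "\<phi> i v = x + y" by blast
      obtain x' where x': "x' \<in> spc V i" "\<phi> i x' = x" using surj i xy subrep_in XY by metis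
      obtain y' where y': "y' \<in> spc V i" "\<phi> i y' = y" using surj i xy subrep_in XY by metis
      have "\<phi> i v = \<phi> i (x' + y')" using xy x' y' morphism_add[OF m i] by simp
      then have "v = x' + y'"
        using inj_onD[of "\<phi> i" "spc V i" v "x' + y'"] b[OF i] v rep_add[OF V i x'(1) y'(1)] by (auto simp: bij_betw_def)
      with x' y' xy show "v \<in> {x + y |x y. x \<in> ?P X i \<and> y \<in> ?P Y i}" by auto
    next
      fix i v assume "i \<in> verts Q" "v \<in> {x + y |x y. x \<in> ?P X i \<and> y \<in> ?P Y i}"
      then show "v \<in> spc V i" using rep_add[OF V] by auto
    next
      fix i v assume i: "i \<in> verts Q" and v: "v \<in> ?P X i \<inter> ?P Y i"
      then have "\<phi> i v \<in> X i \<inter> Y i" by auto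
      then have "\<phi> i v = 0" using XY(3) i unfolding is_direct_sum2_def by blast
      then show "v \<in> {0}" using inj i v by auto
    next
      fix i and v :: 'b assume i: "i \<in> verts Q" and v: "v \<in> {0}"
      then show "v \<in> ?P X i \<inter> ?P Y i"
        using rep_zero[OF V i] morphism_zero[OF V m i]
          subspace_zeroI[OF rep_vs[OF assms(1)] subrep_subspace[OF XY(1) i]]
          subspace_zeroI[OF rep_vs[OF assms(1)] subrep_subspace[OF XY(2) i]] by simp
    qed
    then have "zero_family Q (?P X) \<or> zero_family Q (?P Y)"
      using assms(3) sub by (simp add: indecomposable_def)
    moreover have "zero_family Q Z" if Z: "zero_family Q (?P Z)" "subrep Q W Z" for Z
      unfolding zero_family_def
    proof (intro ballI equalityI subsetI)
      fix i z assume i: "i \<in> verts Q" and z: "z \<in> Z i"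
      then obtain x where x: "x \<in> spc V i" "\<phi> i x = z" using surj subrep_in[OF Z(2)] by metis
      then have "x \<in> ?P Z i" using z by simp
      then have "x = 0" using Z(1) i unfolding zero_family_def by (metis singletonD)
      then show "z \<in> {0}" using x morphism_zero[OF V m i] by simp
    next
      fix i and z :: 'c assume "i \<in> verts Q" "z \<in> {0}"
      then show "z \<in> Z i" using subspace_zeroI[OF rep_vs[OF assms(1)] subrep_subspace[OF Z(2)]] by simp
    qed
    ultimately show ?thesis using XY by blast
  qed
  then show ?thesis
    using assms(1,3) zero_family_isomorphic[OF V phi] by (simp add: indecomposable_def)
qed

text \<open>
  A basis is sent to distinct monomials.
\<close>

lemma fin_dim_poly_model:
  fixes s :: "'k::field \<Rightarrow> 'b::ab_group_add \<Rightarrow> 'b"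
  assumes "vector_space s" "module.subspace s U" "fin_dim s U"
  obtains f :: "'b \<Rightarrow> 'k poly" where "linear_on s smult U f" "inj_on f U"
proof -
  interpret S: vector_space s by fact
  interpret P: vector_space "smult :: 'k \<Rightarrow> 'k poly \<Rightarrow> 'k poly"
    by standard (auto simp: smult_add_right smult_add_left)
  interpret SP: vector_space_pair s "smult :: 'k \<Rightarrow> 'k poly \<Rightarrow> 'k poly" ..
  obtain B where B: "finite B" "S.independent B" "S.span B = U" "card B = S.dim U"
    using fin_dim_basis[OF assms(1,3,2) order_refl] .
  obtain e :: "'b \<Rightarrow> nat" where e: "inj_on e B" using finite_imp_inj_to_nat_seg[OF B(1)] by blast
  obtain f where f: "Vector_Spaces.linear s smult f" "\<forall>x\<in>B. f x = monom (1::'k) (e x)"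
    using SP.linear_independent_extend[OF B(2), of "\<lambda>x. monom 1 (e x)"] by blast
  interpret f: Vector_Spaces.linear s smult f by fact
  have "x = 0" if x: "x \<in> U" "f x = 0" for x
  proof -
    obtain u where u: "x = (\<Sum>v\<in>B. s (u v) v)" using x(1) B(3) S.span_finite[OF B(1)] by auto
    have "f x = (\<Sum>v\<in>B. smult (u v) (monom 1 (e v)))" using f(2) by (simp add: u f.sum f.scale)
    then have fx: "f x = (\<Sum>v\<in>B. monom (u v) (e v))" by (simp add: smult_monom)
    have "u w = 0" if "w \<in> B" for w
    proof -
      have "coeff (f x) (e w) = (\<Sum>v\<in>B. if v = w then u v else 0)"
        unfolding fx coeff_sum by (rule sum.cong) (use e that in \<open>auto dest: inj_onD\<close>)
      then show ?thesis using that B(1) \<open>f x = 0\<close> by simp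
    qed
    then show ?thesis by (simp add: u)
  qed
  moreover have "linear_on s smult U f" by (simp add: linear_on_def f.add f.scale)
  ultimately show ?thesis using that linear_on_inj[OF assms(1,2)] by blast
qed

text \<open>
  Hence the isomorphism classes formed among polynomial representations contain a copy of every
  FLEI representation, over whatever ambient space it lives.
\<close>

lemma flei_poly_model:
  fixes V :: "('v, 'a, 'k::field, 'b::ab_group_add) rep"
  assumes "quiver_rep Q V" "flei Q V"
  obtains W :: "('v, 'a, 'k, 'k poly) rep" where "quiver_rep Q W" "isomorphic Q V W"
proof -
  have "\<forall>i\<in>verts Q. \<exists>f :: 'b \<Rightarrow> 'k poly. linear_on (scal V) smult (spc V i) f \<and> inj_on f (spc V i)"
    using fin_dim_poly_model[OF rep_vs rep_subspace flei_fin_dim] assms by metis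
  then obtain f :: "'v \<Rightarrow> 'b \<Rightarrow> 'k poly" where
    f: "\<And>i. i \<in> verts Q \<Longrightarrow> linear_on (scal V) smult (spc V i) (f i)" "\<And>i. i \<in> verts Q \<Longrightarrow> inj_on (f i) (spc V i)"
    by metis
  have vs: "vector_space (smult :: 'k \<Rightarrow> 'k poly \<Rightarrow> 'k poly)"
    by standard (auto simp: smult_add_right smult_add_left)
  define W where "W = \<lparr>scal = smult, spc = (\<lambda>i. f i ` spc V i),
    mor = (\<lambda>a x. f (head Q a) (mor V a (inv_into (spc V (tail Q a)) (f (tail Q a)) x)))\<rparr>"
  have W: "quiver_rep Q W"
    unfolding quiver_rep_def
  proof (intro conjI ballI)
    show "vector_space (scal W)" using vs by (simp add: W_def)
    fix i assume "i \<in> verts Q"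
    then show "module.subspace (scal W) (spc W i)"
      using linear_on_image_subspace[OF rep_vs vs rep_subspace f(1)] assms(1) by (simp add: W_def)
  next
    fix a assume a: "a \<in> arcs Q"
    have b: "bij_betw (f (tail Q a)) (spc V (tail Q a)) (spc W (tail Q a))"
      using f(2) a by (simp add: W_def bij_betw_def)
    have im: "inv_into (spc V (tail Q a)) (f (tail Q a)) ` spc W (tail Q a) = spc V (tail Q a)"
      using bij_betw_inv_into[OF b] by (simp add: bij_betw_def)
    have "linear_on smult (scal V) (spc W (tail Q a)) (inv_into (spc V (tail Q a)) (f (tail Q a)))"
      by (rule linear_on_inv[OF rep_vs[OF assms(1)] rep_subspace[OF assms(1) tail_in[OF a]] f(1)[OF tail_in[OF a]] b])
    from linear_on_comp[OF this rep_linear[OF assms(1) a]]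
    have "linear_on smult (scal V) (spc W (tail Q a)) (\<lambda>x. mor V a (inv_into (spc V (tail Q a)) (f (tail Q a)) x))"
      using im by blast
    from linear_on_comp[OF this f(1)[OF head_in[OF a]]]
    show "linear_on (scal W) (scal W) (spc W (tail Q a)) (mor W a)"
      using im rep_mor_in[OF assms(1) a] unfolding W_def by fastforce
    show "mor W a ` spc W (tail Q a) \<subseteq> spc W (head Q a)"
      using im rep_mor_in[OF assms(1) a] unfolding W_def by fastforce
  qed
  have "isomorphism Q V W f"
    unfolding isomorphism_def morphism_def
    using f rep_mor_in[OF assms(1)] by (auto simp: W_def bij_betw_def)
  then show ?thesis using that W by (auto simp: isomorphic_def)
qed

end

section \<open>Cutting a tree at an arrow\<close>

context rep_quiver
begin

text \<open>
  Paths in the underlying undirected graph that use arrows of \<open>A\<close> only are handled through the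
  reflexive transitive closure of \<open>adj A\<close>.
\<close>

definition adj :: "'a set \<Rightarrow> ('v \<times> 'v) set" where
  "adj A = {(x, y). \<exists>a\<in>A. x = tail Q a \<and> y = head Q a \<or> x = head Q a \<and> y = tail Q a}"

lemma adj_sym: "(x, y) \<in> (adj A)\<^sup>* \<Longrightarrow> (y, x) \<in> (adj A)\<^sup>*"
proof -
  have "sym (adj A)" by (auto simp: adj_def sym_def)
  then show "(x, y) \<in> (adj A)\<^sup>* \<Longrightarrow> (y, x) \<in> (adj A)\<^sup>*" using sym_rtrancl symD by metis
qed

lemma adj_arrow: "a \<in> A \<Longrightarrow> (tail Q a, head Q a) \<in> adj A" "a \<in> A \<Longrightarrow> (head Q a, tail Q a) \<in> adj A"
  by (auto simp: adj_def)

lemma simple_path: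
  assumes "(x, y) \<in> (adj A)\<^sup>*"
  shows "\<exists>vs es. vs \<noteq> [] \<and> hd vs = x \<and> last vs = y \<and> distinct vs \<and> length vs = Suc (length es) \<and>
     set es \<subseteq> A \<and> (\<forall>n<length es. {tail Q (es ! n), head Q (es ! n)} = {vs ! n, vs ! Suc n})"
  using assms
proof (induction rule: rtrancl_induct)
  case base
  show ?case by (rule exI[of _ "[x]"], rule exI[of _ "[]"]) simp
next
  case (step y z)
  then obtain vs es where *: "vs \<noteq> []" "hd vs = x" "last vs = y" "distinct vs" "length vs = Suc (length es)"
    "set es \<subseteq> A" "\<forall>n<length es. {tail Q (es ! n), head Q (es ! n)} = {vs ! n, vs ! Suc n}" by blast
  obtain a where a: "a \<in> A" "{tail Q a, head Q a} = {y, z}" using step(2) by (auto simp: adj_def)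
  show ?case
  proof (cases "z \<in> set vs")
    case True
    then obtain n where n: "n < length vs" "vs ! n = z" by (auto simp: in_set_conv_nth)
    have "last (take (Suc n) vs) = z" using n by (simp add: take_Suc_conv_app_nth)
    moreover have "hd (take (Suc n) vs) = x" using * by simp
    ultimately show ?thesis using * n
      by (intro exI[of _ "take (Suc n) vs"] exI[of _ "take n es"]) (auto dest: in_set_takeD)
  next
    case False
    have "{tail Q ((es @ [a]) ! n), head Q ((es @ [a]) ! n)} = {(vs @ [z]) ! n, (vs @ [z]) ! Suc n}"
      if "n < Suc (length es)" for n
    proof (cases "n = length es")
      case True
      have "vs ! n = y" using * True last_conv_nth[of vs] by simp
      then show ?thesis using True * a by (simp add: nth_append)
    next
      case False
      then show ?thesis using that * by (auto simp: nth_append)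
    qed
    then show ?thesis using * False a
      by (intro exI[of _ "vs @ [z]"] exI[of _ "es @ [a]"]) auto
  qed
qed

text \<open>
  A path from a base vertex to \<open>q\<close> uses no arrow of \<open>B\<close> after the last one, so removing finitely many
  arrows leaves finitely many components, represented by the base vertex and the ends of the removed
  arrows.
\<close>

lemma finitely_many_components:
  assumes conn: "\<And>x y. x \<in> verts Q \<Longrightarrow> y \<in> verts Q \<Longrightarrow> (x, y) \<in> (adj (arcs Q))\<^sup>*"
    and "finite B" "B \<subseteq> arcs Q"
  obtains R where "finite R" "R \<subseteq> verts Q" "\<And>q. q \<in> verts Q \<Longrightarrow> \<exists>r\<in>R. (r, q) \<in> (adj (arcs Q - B))\<^sup>*"
proof (cases "verts Q = {}")
  case True
  then show ?thesis using that[of "{}"] by simp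
next
  case False
  then obtain v where v: "v \<in> verts Q" by blast
  let ?R = "insert v (tail Q ` B \<union> head Q ` B)"
  have "\<exists>r\<in>?R. (r, q) \<in> (adj (arcs Q - B))\<^sup>*" if "(v, q) \<in> (adj (arcs Q))\<^sup>*" for q
    using that
  proof (induction rule: rtrancl_induct)
    case (step y z)
    then obtain a where a: "a \<in> arcs Q" "y = tail Q a \<and> z = head Q a \<or> y = head Q a \<and> z = tail Q a"
      by (auto simp: adj_def)
    show ?case
    proof (cases "a \<in> B")
      case True
      then have "z \<in> ?R" using a by auto
      then show ?thesis by blast
    next
      case False
      then have "(y, z) \<in> adj (arcs Q - B)" using a by (auto simp: adj_def)
      then show ?thesis using step(3) by (meson rtrancl.rtrancl_into_rtrancl)
    qed
  qed auto
  then have "\<exists>r\<in>?R. (r, q) \<in> (adj (arcs Q - B))\<^sup>*" if "q \<in> verts Q" for q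
    using conn[OF v that] by simp
  moreover have "finite ?R" "?R \<subseteq> verts Q" using assms(2,3) v by auto
  ultimately show ?thesis using that by blast
qed

end

locale tree_rep = rep_quiver Q for Q :: "('v, 'a) pre_digraph" +
  assumes tree: "tree_quiver Q"
begin

lemma connected_adj:
  assumes "x \<in> verts Q" "y \<in> verts Q"
  shows "(x, y) \<in> (adj (arcs Q))\<^sup>*"
proof -
  have "(x, y) \<in> rtrancl_on (verts Q) (arcs_ends (with_proj (mk_symmetric Q)))"
    using tree assms unfolding tree_quiver_def Digraph_Component.connected_def strongly_connected_def reachable_def by simp
  then show ?thesis
  proof (induction rule: rtrancl_on_induct)
    case (step y z)
    then have "(y, z) \<in> adj (arcs Q)" by (auto simp: parcs_mk_symmetric adj_def)
    then show ?case using step by (meson rtrancl.rtrancl_into_rtrancl)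
  qed simp
qed

text \<open>
  A path around the arrow, shortened to one without repeated vertices, would close up with the arrow
  to an undirected cycle.
\<close>

lemma arrow_separates:
  assumes a: "a \<in> arcs Q"
  shows "(tail Q a, head Q a) \<notin> (adj (arcs Q - {a}))\<^sup>*"
proof
  assume "(tail Q a, head Q a) \<in> (adj (arcs Q - {a}))\<^sup>*"
  then obtain vs es where *: "vs \<noteq> []" "hd vs = tail Q a" "last vs = head Q a" "distinct vs"
    "length vs = Suc (length es)" "set es \<subseteq> arcs Q - {a}"
    "\<forall>n<length es. {tail Q (es ! n), head Q (es ! n)} = {vs ! n, vs ! Suc n}"
    using simple_path by metis
  have "distinct es"
  proof (rule ccontr)
    assume "\<not> distinct es"
    then obtain m n where mn: "m < n" "n < length es" "es ! m = es ! n"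
      unfolding distinct_conv_nth by (metis linorder_neqE_nat)
    then have "{vs ! m, vs ! Suc m} = {vs ! n, vs ! Suc n}" using * by (metis less_trans)
    then have "vs ! m = vs ! n \<or> vs ! m = vs ! Suc n" by (auto simp: doubleton_eq_iff)
    moreover have "m < length vs" "n < length vs" "Suc n < length vs" using mn *(5) by auto
    ultimately show False using *(4) mn(1) by (auto simp: nth_eq_iff_index_eq)
  qed
  moreover have "set vs \<subseteq> verts Q"
  proof
    fix v assume "v \<in> set vs"
    then obtain n where n: "n < length vs" "vs ! n = v" by (auto simp: in_set_conv_nth)
    show "v \<in> verts Q"
    proof (cases n)
      case 0
      then show ?thesis using n * a by (metis hd_conv_nth tail_in)
    next
      case (Suc m)
      then have m: "m < length es" using n * by simp
      then have "v \<in> {tail Q (es ! m), head Q (es ! m)}" using * n Suc by auto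
      moreover have "es ! m \<in> arcs Q" using m *(6) nth_mem by blast
      ultimately show ?thesis by auto
    qed
  qed
  moreover have "{tail Q ((es @ [a]) ! n), head Q ((es @ [a]) ! n)} = {vs ! n, vs ! (Suc n mod length vs)}"
    if "n < length vs" for n
  proof (cases "n = length es")
    case True
    then have "vs ! n = head Q a" "vs ! 0 = tail Q a" using * by (simp_all add: last_conv_nth hd_conv_nth)
    then show ?thesis using True * by auto
  next
    case False
    then show ?thesis using that * by (simp add: nth_append)
  qed
  ultimately have "undirected_cycle Q vs (es @ [a])"
    using * a unfolding undirected_cycle_def by auto
  then show False using tree by (auto simp: tree_quiver_def)
qed

definition dadj :: "'a set \<Rightarrow> ('v \<times> 'v) set" where
  "dadj A = {(tail Q a, head Q a) | a. a \<in> A}"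

definition reach :: "'v \<Rightarrow> 'v set" where
  "reach i = {j. (i, j) \<in> (dadj (arcs Q))\<^sup>*}"

text \<open>
  Fix a vertex \<open>i\<close>. The arrows in \<open>inward i\<close> enter the set of vertices reachable from \<open>i\<close> from outside.
  They are the arrows at which the representation generated freely at \<open>i\<close> fails to be an isomorphism.
  Cutting the tree at an arrow \<open>a\<close> leaves two components, and \<open>branch a\<close> is the one on the side of the
  tail.
\<close>

definition inward :: "'v \<Rightarrow> 'a set" where
  "inward i = {a \<in> arcs Q. head Q a \<in> reach i \<and> tail Q a \<notin> reach i}"

definition branch :: "'a \<Rightarrow> 'v set" where
  "branch a = {x. (tail Q a, x) \<in> (adj (arcs Q - {a}))\<^sup>*}"

lemma dadj_adj: "(x, y) \<in> (dadj A)\<^sup>* \<Longrightarrow> (x, y) \<in> (adj A)\<^sup>*"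
proof -
  have "dadj A \<subseteq> adj A" by (auto simp: dadj_def adj_def)
  then show "(x, y) \<in> (dadj A)\<^sup>* \<Longrightarrow> (x, y) \<in> (adj A)\<^sup>*" using rtrancl_mono by blast
qed

text \<open>
  The alternative is that the path uses \<open>a\<close>; then the part before the first use avoids \<open>a\<close>.
\<close>

lemma dadj_avoid:
  assumes "(x, y) \<in> (dadj (arcs Q))\<^sup>*"
  shows "(x, y) \<in> (dadj (arcs Q - {a}))\<^sup>* \<or>
    (x, tail Q a) \<in> (dadj (arcs Q - {a}))\<^sup>* \<and> (head Q a, y) \<in> (dadj (arcs Q))\<^sup>*"
  using assms
proof (induction rule: rtrancl_induct)
  case (step y z)
  then obtain b where b: "b \<in> arcs Q" "y = tail Q b" "z = head Q b" by (auto simp: dadj_def)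
  have "(y, z) \<in> dadj (arcs Q - {a})" if "b \<noteq> a" using that b by (auto simp: dadj_def)
  moreover have "(head Q a, z) \<in> (dadj (arcs Q))\<^sup>*" if "(head Q a, y) \<in> (dadj (arcs Q))\<^sup>*"
    using that step(2) by (rule rtrancl_into_rtrancl)
  ultimately show ?case
    using step(3) b by (cases "b = a") (auto intro: rtrancl_into_rtrancl)
qed simp

lemma no_directed_cycle:
  assumes "a \<in> arcs Q"
  shows "(head Q a, tail Q a) \<notin> (dadj (arcs Q))\<^sup>*"
  using dadj_avoid[of "head Q a" "tail Q a" a] dadj_adj adj_sym arrow_separates[OF assms] by blast

lemma reach_refl [simp]: "i \<in> reach i"
  by (simp add: reach_def)

lemma reach_step: "a \<in> arcs Q \<Longrightarrow> tail Q a \<in> reach i \<Longrightarrow> head Q a \<in> reach i"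
  unfolding reach_def dadj_def by (auto intro: rtrancl_into_rtrancl)

lemma reach_no_return:
  assumes "a \<in> arcs Q" "tail Q a \<in> reach i"
  shows "head Q a \<noteq> i"
  using no_directed_cycle[OF assms(1)] assms(2) by (auto simp: reach_def)

text \<open>
  Two such arrows would join their common head to \<open>i\<close> in two ways. Uniqueness of the arrow by which a
  directed path arrives makes the image of a vector along directed paths well defined.
\<close>

lemma reach_unique_arrow:
  assumes a: "a \<in> arcs Q" "tail Q a \<in> reach i" and b: "b \<in> arcs Q" "tail Q b \<in> reach i"
    and eq: "head Q a = head Q b"
  shows "a = b"
proof (rule ccontr)
  assume "a \<noteq> b"
  have "(i, tail Q a) \<in> (dadj (arcs Q - {a}))\<^sup>*"
    using dadj_avoid[of i "tail Q a" a] a by (auto simp: reach_def)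
  moreover have "(i, tail Q b) \<in> (dadj (arcs Q - {a}))\<^sup>*"
    using dadj_avoid[of i "tail Q b" a] b eq no_directed_cycle[OF b(1)] by (auto simp: reach_def)
  moreover have "(tail Q b, head Q a) \<in> dadj (arcs Q - {a})"
    using b \<open>a \<noteq> b\<close> eq by (auto simp: dadj_def)
  ultimately have "(i, tail Q a) \<in> (adj (arcs Q - {a}))\<^sup>*" "(i, head Q a) \<in> (adj (arcs Q - {a}))\<^sup>*"
    by (auto intro: dadj_adj rtrancl_into_rtrancl)
  then have "(tail Q a, head Q a) \<in> (adj (arcs Q - {a}))\<^sup>*"
    using adj_sym rtrancl_trans by meson
  then show False using arrow_separates[OF a(1)] by simp
qed

lemma reach_adj:
  assumes "A \<subseteq> inward i" "j \<in> reach i"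
  shows "(i, j) \<in> (adj (arcs Q - A))\<^sup>*"
proof -
  have "j \<in> reach i \<and> (i, j) \<in> (adj (arcs Q - A))\<^sup>*"
    using assms(2) unfolding reach_def mem_Collect_eq
  proof (induction rule: rtrancl_induct)
    case (step y z)
    then obtain a where a: "a \<in> arcs Q" "y = tail Q a" "z = head Q a" by (auto simp: dadj_def)
    have "a \<notin> A" using step(3) a assms(1) by (auto simp: inward_def reach_def)
    then have "(y, z) \<in> adj (arcs Q - A)" using a by (auto simp: adj_def)
    then show ?case using step by (meson rtrancl_into_rtrancl)
  qed simp
  then show ?thesis ..
qed

text \<open>
  Directed paths from \<open>i\<close> never use an inward arrow, because its tail is not reachable; a common vertex
  would connect both ends of \<open>a\<close> without \<open>a\<close>.
\<close>

lemma branch_disjoint_reach: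
  assumes "a \<in> inward i" "j \<in> reach i"
  shows "j \<notin> branch a"
proof
  assume "j \<in> branch a"
  then have "(tail Q a, j) \<in> (adj (arcs Q - {a}))\<^sup>*" by (simp add: branch_def)
  moreover have "(i, j) \<in> (adj (arcs Q - {a}))\<^sup>*" "(i, head Q a) \<in> (adj (arcs Q - {a}))\<^sup>*"
    using reach_adj[of "{a}" i] assms by (auto simp: inward_def)
  ultimately have "(tail Q a, head Q a) \<in> (adj (arcs Q - {a}))\<^sup>*"
    using adj_sym rtrancl_trans by meson
  then show False using arrow_separates assms(1) by (auto simp: inward_def)
qed

lemma tail_in_branch [simp]: "tail Q a \<in> branch a"
  by (simp add: branch_def)

lemma branch_closed:
  assumes "c \<in> arcs Q" "c \<noteq> a"
  shows "tail Q c \<in> branch a \<longleftrightarrow> head Q c \<in> branch a"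
  using adj_arrow[of c "arcs Q - {a}"] assms unfolding branch_def
  by (auto intro: rtrancl_into_rtrancl)

lemma tail_notin_branch:
  assumes "a \<in> inward i" "b \<in> inward i" "a \<noteq> b"
  shows "tail Q a \<notin> branch b"
  using branch_closed[of a b] branch_disjoint_reach[of b i] assms by (auto simp: inward_def)

definition trunk :: "'v \<Rightarrow> 'a set \<Rightarrow> 'v set" where
  "trunk i A = {x. (i, x) \<in> (adj (arcs Q - A))\<^sup>*}"

lemma trunk_branch_cover:
  assumes "i \<in> verts Q" "A \<subseteq> inward i" "q \<in> verts Q"
  shows "q \<in> trunk i A \<or> (\<exists>a\<in>A. q \<in> branch a)"
  using connected_adj[OF assms(1,3)]
proof (induction rule: rtrancl_induct)
  case base
  then show ?case by (simp add: trunk_def)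
next
  case (step y z)
  then obtain c where c: "c \<in> arcs Q" "y = tail Q c \<and> z = head Q c \<or> y = head Q c \<and> z = tail Q c"
    by (auto simp: adj_def)
  show ?case
  proof (cases "c \<in> A")
    case True
    then have "head Q c \<in> trunk i A"
      using reach_adj[OF assms(2)] assms(2) by (auto simp: inward_def trunk_def)
    moreover have "tail Q c \<in> branch c" by simp
    ultimately show ?thesis using True c by blast
  next
    case False
    then have "(y, z) \<in> adj (arcs Q - A)" using c by (auto simp: adj_def)
    then have "y \<in> trunk i A \<Longrightarrow> z \<in> trunk i A" by (auto simp: trunk_def intro: rtrancl_into_rtrancl)
    moreover have "y \<in> branch a \<Longrightarrow> z \<in> branch a" if "a \<in> A" for a
      using branch_closed[OF c(1), of a] c False that by auto
    ultimately show ?thesis using step(3) by blast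
  qed
qed

lemma trunk_branch_disjoint:
  assumes "A \<subseteq> inward i" "a \<in> A" "q \<in> trunk i A"
  shows "q \<notin> branch a"
  using assms(3) unfolding trunk_def mem_Collect_eq
proof (induction rule: rtrancl_induct)
  case base
  then show ?case using branch_disjoint_reach[of a i i] assms by auto
next
  case (step y z)
  then obtain c where "c \<in> arcs Q" "c \<noteq> a" "y = tail Q c \<and> z = head Q c \<or> y = head Q c \<and> z = tail Q c"
    using assms(2) by (auto simp: adj_def)
  then show ?case using step(3) branch_closed[of c a] by auto
qed

lemma trunk_inward:
  assumes "q \<in> trunk i (inward i)"
  shows "q \<in> reach i"
  using assms unfolding trunk_def mem_Collect_eq
proof (induction rule: rtrancl_induct)
  case (step y z)
  then show ?case using reach_step by (auto simp: adj_def inward_def)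
qed simp

section \<open>Subspace representations\<close>

text \<open>
  A subspace representation: all maps are inclusions into one space \<open>P\<close>, and the space is cut down to
  \<open>L a\<close> on the branch behind the arrow \<open>a \<in> A\<close>. For a set \<open>A\<close> of arrows pointing inward to \<open>i\<close>, the
  branches do not meet the component of \<open>i\<close>, and the data amount to a configuration of subspaces
  \<open>L a \<subseteq> P\<close>.
\<close>

definition branch_rep :: "'a set \<Rightarrow> 'k::field poly set \<Rightarrow> ('a \<Rightarrow> 'k poly set) \<Rightarrow> ('v, 'a, 'k, 'k poly) rep" where
  "branch_rep A P L = \<lparr>scal = smult, spc = (\<lambda>q. P \<inter> (\<Inter>a\<in>{a\<in>A. q \<in> branch a}. L a)), mor = (\<lambda>a x. x)\<rparr>"

lemma smult_vs: "vector_space (smult :: 'k::field \<Rightarrow> 'k poly \<Rightarrow> 'k poly)"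
  by standard (auto simp: smult_add_right smult_add_left)

lemma branch_rep_simps [simp]: "scal (branch_rep A P L) = smult" "mor (branch_rep A P L) a x = x"
  by (simp_all add: branch_rep_def)

lemma branch_rep_trunk: "A \<subseteq> inward i \<Longrightarrow> q \<in> trunk i A \<Longrightarrow> spc (branch_rep A P L) q = P"
  using trunk_branch_disjoint by (fastforce simp: branch_rep_def)

lemma branch_rep_tail:
  assumes "A \<subseteq> inward i" "a \<in> A" "L a \<subseteq> P"
  shows "spc (branch_rep A P L) (tail Q a) = L a"
proof -
  have "{b \<in> A. tail Q a \<in> branch b} = {a}"
    using tail_notin_branch[of a i] assms by auto
  then show ?thesis using assms by (auto simp: branch_rep_def)
qed

lemma branch_rep_arrow:
  fixes P :: "'k::field poly set"
  assumes "A \<subseteq> inward i" "c \<in> arcs Q"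
  shows "spc (branch_rep A P L) (tail Q c) \<subseteq> spc (branch_rep A P L) (head Q c)"
    and "c \<notin> A \<Longrightarrow> spc (branch_rep A P L) (tail Q c) = spc (branch_rep A P L) (head Q c)"
proof -
  have "head Q c \<notin> branch c" if "c \<in> A"
    using branch_disjoint_reach[of c i] that assms by (auto simp: inward_def)
  then have "{a\<in>A. head Q c \<in> branch a} \<subseteq> {a\<in>A. tail Q c \<in> branch a}"
    using branch_closed[OF assms(2)] by (metis (mono_tags, lifting) Collect_mono)
  then show "spc (branch_rep A P L) (tail Q c) \<subseteq> spc (branch_rep A P L) (head Q c)"
    by (auto simp: branch_rep_def)
  assume "c \<notin> A"
  then have "tail Q c \<in> branch a \<longleftrightarrow> head Q c \<in> branch a" if "a \<in> A" for a
    using branch_closed[OF assms(2), of a] that by blast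
  then have "{a\<in>A. head Q c \<in> branch a} = {a\<in>A. tail Q c \<in> branch a}" by blast
  then show "spc (branch_rep A P L) (tail Q c) = spc (branch_rep A P L) (head Q c)"
    by (simp add: branch_rep_def)
qed

lemma branch_rep_quiver_rep:
  fixes P :: "'k::field poly set"
  assumes "A \<subseteq> inward i" "module.subspace smult P" "\<And>a. a \<in> A \<Longrightarrow> module.subspace smult (L a)"
  shows "quiver_rep Q (branch_rep A P L)"
proof -
  interpret P: vector_space "smult :: 'k \<Rightarrow> 'k poly \<Rightarrow> 'k poly" by (rule smult_vs)
  have "P.subspace (spc (branch_rep A P L) q)" for q
    unfolding branch_rep_def using assms(2,3) by (auto intro!: P.subspace_inter P.subspace_Int)
  moreover have "mor (branch_rep A P L) a ` spc (branch_rep A P L) (tail Q a) \<subseteq> spc (branch_rep A P L) (head Q a)"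
    if "a \<in> arcs Q" for a
    using branch_rep_arrow(1)[OF assms(1) that, of P L] by simp
  ultimately show ?thesis using smult_vs by (simp add: quiver_rep_def linear_on_def)
qed

lemma branch_rep_flei:
  fixes P :: "'k::field poly set"
  assumes "A \<subseteq> inward i" "module.subspace smult P" "\<And>a. a \<in> A \<Longrightarrow> module.subspace smult (L a)"
    and "finite A" "fin_dim smult P"
  shows "flei Q (branch_rep A P L)"
  unfolding flei_iff
proof (intro conjI ballI)
  fix q assume "q \<in> verts Q"
  then have "module.subspace smult (spc (branch_rep A P L) q)"
    using rep_subspace[OF branch_rep_quiver_rep[OF assms(1-3)]] by simp
  then show "fin_dim (scal (branch_rep A P L)) (spc (branch_rep A P L) q)"
    using fin_dim_subspace[OF smult_vs assms(5), of "spc (branch_rep A P L) q"] by (auto simp: branch_rep_def)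
next
  let ?B = "branch_rep A P L"
  have "bij_betw (mor ?B a) (spc ?B (tail Q a)) (spc ?B (head Q a))" if "a \<in> arcs Q" "a \<notin> A" for a
    using branch_rep_arrow(2)[OF assms(1) that, of P L] by (simp add: bij_betw_def inj_on_def)
  then have "{a \<in> arcs Q. \<not> bij_betw (mor ?B a) (spc ?B (tail Q a)) (spc ?B (head Q a))} \<subseteq> A"
    by blast
  then show "finite {a \<in> arcs Q. \<not> bij_betw (mor ?B a) (spc ?B (tail Q a)) (spc ?B (head Q a))}"
    using assms(4) finite_subset by blast
qed

text \<open>
  A decomposition is constant along the arrows outside \<open>A\<close>. It is therefore determined by a
  decomposition of \<open>P\<close> to which every \<open>L a\<close> is adapted, and the last hypothesis says that such a
  decomposition of the subspace configuration is trivial.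
\<close>

lemma branch_rep_indecomposable:
  fixes P :: "'k::field poly set"
  assumes i: "i \<in> verts Q" and A: "A \<subseteq> inward i" and P: "module.subspace smult P"
    and L: "\<And>a. a \<in> A \<Longrightarrow> module.subspace smult (L a)" "\<And>a. a \<in> A \<Longrightarrow> L a \<subseteq> P"
    and nz: "P \<noteq> {0}"
    and split: "\<And>X Y. module.subspace smult X \<Longrightarrow> module.subspace smult Y \<Longrightarrow>
       P = {x + y | x y. x \<in> X \<and> y \<in> Y} \<Longrightarrow> X \<inter> Y = {0} \<Longrightarrow>
       (\<And>a l. a \<in> A \<Longrightarrow> l \<in> L a \<Longrightarrow> \<exists>x\<in>X \<inter> L a. \<exists>y\<in>Y \<inter> L a. l = x + y) \<Longrightarrow> X = {0} \<or> Y = {0}"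
  shows "indecomposable Q (branch_rep A P L)"
proof -
  let ?B = "branch_rep A P L"
  have B: "quiver_rep Q ?B" using branch_rep_quiver_rep[OF A P L(1)] .
  have it: "i \<in> trunk i A" by (simp add: trunk_def)
  have Bi: "spc ?B i = P" using branch_rep_trunk[OF A it] .
  have main: "zero_family Q X \<or> zero_family Q Y"
    if X: "subrep Q ?B X" and Y: "subrep Q ?B Y" and XY: "is_direct_sum2 Q ?B (spc ?B) X Y" for X Y
  proof -
    have X0: "0 \<in> X q" "0 \<in> Y q" if "q \<in> verts Q" for q
      using subspace_zeroI[OF smult_vs] subrep_subspace[OF X that] subrep_subspace[OF Y that] by auto
    have mono: "X (tail Q c) \<subseteq> X (head Q c)" "Y (tail Q c) \<subseteq> Y (head Q c)" if "c \<in> arcs Q" for c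
      using subrep_mor[OF X that] subrep_mor[OF Y that] by auto
    have const: "X (tail Q c) = X (head Q c)" "Y (tail Q c) = Y (head Q c)" if c: "c \<in> arcs Q" "c \<notin> A" for c
    proof -
      have eq: "spc ?B (head Q c) = spc ?B (tail Q c)" using branch_rep_arrow(2)[OF A c, of P L] by simp
      have dec: "\<exists>x\<in>X (tail Q c). \<exists>y\<in>Y (tail Q c). z = x + y" if "z \<in> spc ?B (head Q c)" for z
        using XY c that unfolding eq is_direct_sum2_def by auto
      have disj: "X (head Q c) \<inter> Y (head Q c) = {0}" using XY c unfolding is_direct_sum2_def by auto
      have "z \<in> X (tail Q c)" if zh: "z \<in> X (head Q c)" for z
      proof -
        obtain x y where xy: "x \<in> X (tail Q c)" "y \<in> Y (tail Q c)" "z = x + y"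
          using dec[OF subrep_in[OF X _ zh]] c by auto
        then have "y \<in> X (head Q c)"
          using mono(1)[OF c(1)] zh subspace_diffI[OF smult_vs subrep_subspace[OF X, simplified], of "head Q c" z x] c by auto
        then have "y = 0" using xy(2) mono(2)[OF c(1)] disj by auto
        then show ?thesis using xy by simp
      qed
      then show "X (tail Q c) = X (head Q c)" using mono(1)[OF c(1)] by auto
      have "z \<in> Y (tail Q c)" if zh: "z \<in> Y (head Q c)" for z
      proof -
        obtain x y where xy: "x \<in> X (tail Q c)" "y \<in> Y (tail Q c)" "z = x + y"
          using dec[OF subrep_in[OF Y _ zh]] c by auto
        then have "x \<in> Y (head Q c)"
          using mono(2)[OF c(1)] zh subspace_diffI[OF smult_vs subrep_subspace[OF Y, simplified], of "head Q c" z y] c by auto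
        then have "x = 0" using xy(1) mono(1)[OF c(1)] disj by auto
        then show ?thesis using xy by simp
      qed
      then show "Y (tail Q c) = Y (head Q c)" using mono(2)[OF c(1)] by auto
    qed
    have trunk: "X q = X i \<and> Y q = Y i" if "q \<in> trunk i A" for q
      using that unfolding trunk_def mem_Collect_eq
    proof (induction rule: rtrancl_induct)
      case (step y z)
      then show ?case using const by (auto simp: adj_def)
    qed simp
    have head: "X (head Q a) = X i \<and> Y (head Q a) = Y i" if "a \<in> A" for a
      using trunk[of "head Q a"] reach_adj[OF A, of "head Q a"] that A by (auto simp: trunk_def inward_def)
    have br: "X q = X (tail Q a) \<and> Y q = Y (tail Q a)" if a: "a \<in> A" and q: "q \<in> branch a" for a q
    proof -
      have "q \<in> branch a \<and> X q = X (tail Q a) \<and> Y q = Y (tail Q a)"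
        using q unfolding branch_def mem_Collect_eq
      proof (induction rule: rtrancl_induct)
        case (step y z)
        then obtain c where c: "c \<in> arcs Q" "c \<noteq> a" "y = tail Q c \<and> z = head Q c \<or> y = head Q c \<and> z = tail Q c"
          by (auto simp: adj_def)
        have y: "y \<in> branch a" using step(3) by (simp add: branch_def)
        then have yz: "tail Q c \<in> branch a" "head Q c \<in> branch a" using branch_closed[OF c(1,2)] c(3) by auto
        then have "c \<notin> A" using branch_disjoint_reach[of a i] a A by (auto simp: inward_def)
        then have "X y = X z \<and> Y y = Y z" using const[OF c(1)] c(3) by auto
        moreover have "(tail Q a, z) \<in> (adj (arcs Q - {a}))\<^sup>*" using yz c(3) unfolding branch_def by auto
        ultimately show ?case using step(3) by simp
      qed simp
      then show ?thesis by simp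
    qed
    have zero: "zero_family Q Z" if Z: "Z = X \<or> Z = Y" "Z i = {0}" for Z
      unfolding zero_family_def
    proof
      fix q assume q: "q \<in> verts Q"
      consider "q \<in> trunk i A" | a where "a \<in> A" "q \<in> branch a"
        using trunk_branch_cover[OF i A q] by blast
      then show "Z q = {0}"
      proof cases
        case 1
        then show ?thesis using trunk Z by auto
      next
        case 2
        then have "a \<in> arcs Q" using A by (auto simp: inward_def)
        then have "Z (tail Q a) \<subseteq> {0}" using mono[of a] head[OF 2(1)] Z by auto
        then show ?thesis using br[OF 2] Z(1) X0[OF q] by auto
      qed
    qed
    have "X i = {0} \<or> Y i = {0}"
    proof (rule split)
      show "module.subspace smult (X i)" "module.subspace smult (Y i)"
        using subrep_subspace[OF X i] subrep_subspace[OF Y i] by simp_all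
      show "P = {x + y | x y. x \<in> X i \<and> y \<in> Y i}" "X i \<inter> Y i = {0}"
        using XY i Bi unfolding is_direct_sum2_def by auto
      fix a l assume a: "a \<in> A" and l: "l \<in> L a"
      have aa: "a \<in> arcs Q" using a A by (auto simp: inward_def)
      have t: "spc ?B (tail Q a) = L a" using branch_rep_tail[where L = L and P = P, OF A a] L(2)[OF a] by simp
      have "l \<in> {x + y | x y. x \<in> X (tail Q a) \<and> y \<in> Y (tail Q a)}"
        using conjunct1[OF bspec[OF XY[unfolded is_direct_sum2_def] tail_in[OF aa]]] l unfolding t by (rule subst)
      then obtain x y where "x \<in> X (tail Q a)" "y \<in> Y (tail Q a)" "l = x + y"
        by blast
      moreover have "X (tail Q a) \<subseteq> X i \<inter> L a" "Y (tail Q a) \<subseteq> Y i \<inter> L a"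
        using mono[OF aa] head[OF a] subrep_subset[OF X tail_in[OF aa]] subrep_subset[OF Y tail_in[OF aa]] t by auto
      ultimately show "\<exists>x\<in>X i \<inter> L a. \<exists>y\<in>Y i \<inter> L a. l = x + y" by blast
    qed
    then show ?thesis using zero by blast
  qed
  have "\<not> zero_family Q (spc ?B)" using nz Bi i by (auto simp: zero_family_def)
  then show ?thesis using B main unfolding indecomposable_def by blast
qed

lemma branch_rep_morphism:
  assumes "\<And>x y. f (x + y) = f x + f y" "\<And>c x. f (smult c x) = smult c (f x)"
    "f ` P \<subseteq> P'" "\<And>a. a \<in> A \<Longrightarrow> f ` L a \<subseteq> L' a"
  shows "morphism Q (branch_rep A P L) (branch_rep A P' L') (\<lambda>q. f)"
  using assms unfolding morphism_def linear_on_def branch_rep_def by (auto simp: image_subset_iff)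

lemma constants:
  "module.subspace smult (range (\<lambda>c::'k::field. [:c:]))" "fin_dim smult (range (\<lambda>c::'k. [:c:]))"
  "range (\<lambda>c::'k. [:c:]) \<noteq> {0}"
proof -
  interpret P: vector_space "smult :: 'k \<Rightarrow> 'k poly \<Rightarrow> 'k poly" by (rule smult_vs)
  have eq: "range (\<lambda>c::'k. [:c:]) = P.span {1}"
    by (simp add: P.span_singleton)
  show "module.subspace smult (range (\<lambda>c::'k::field. [:c:]))" unfolding eq by simp
  show "fin_dim smult (range (\<lambda>c::'k. [:c:]))" unfolding fin_dim_def eq by blast
  have "[:1::'k:] \<noteq> 0" by simp
  then show "range (\<lambda>c::'k. [:c:]) \<noteq> {0}" by blast
qed

lemma constants_split:
  fixes X Y :: "'k::field poly set"
  assumes "module.subspace smult X" "module.subspace smult Y"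
    "range (\<lambda>c::'k. [:c:]) = {x + y | x y. x \<in> X \<and> y \<in> Y}" "X \<inter> Y = {0}"
  shows "X = {0} \<or> Y = {0}"
proof (rule ccontr)
  interpret P: vector_space "smult :: 'k \<Rightarrow> 'k poly \<Rightarrow> 'k poly" by (rule smult_vs)
  have z: "0 \<in> X" "0 \<in> Y" using assms P.subspace_0 by auto
  have sub: "X \<subseteq> range (\<lambda>c. [:c:])" "Y \<subseteq> range (\<lambda>c. [:c:])"
    unfolding assms(3) using z by force+
  assume "\<not> (X = {0} \<or> Y = {0})"
  then obtain x y where xy: "x \<in> X" "x \<noteq> 0" "y \<in> Y" "y \<noteq> 0" using z by blast
  then obtain c d where cd: "x = [:c:]" "y = [:d:]" using sub by blast
  then have "smult (d / c) x = y" using xy by simp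
  then have "y \<in> X" using P.subspace_scale[OF assms(1) xy(1)] by metis
  then show False using assms(4) xy by blast
qed

section \<open>Path representations\<close>

text \<open>
  The representation freely generated by one vector at \<open>i\<close>: the field at the vertices reachable from
  \<open>i\<close>, and zero elsewhere.
\<close>

definition path_rep :: "'v \<Rightarrow> ('v, 'a, 'k::field, 'k poly) rep" where
  "path_rep i = branch_rep (inward i) (range (\<lambda>c. [:c:])) (\<lambda>_. {0})"

lemma path_rep_reach: "q \<in> reach i \<Longrightarrow> spc (path_rep i) q = range (\<lambda>c. [:c:])"
  unfolding path_rep_def by (rule branch_rep_trunk[OF order_refl]) (simp add: trunk_def reach_adj)

lemma path_rep_notin_reach:
  assumes "i \<in> verts Q" "q \<in> verts Q" "q \<notin> reach i"
  shows "spc (path_rep i) q = {0}"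
proof -
  obtain a where "a \<in> inward i" "q \<in> branch a"
    using trunk_branch_cover[OF assms(1) order_refl assms(2)] trunk_inward assms(3) by blast
  moreover have "(0::'k::field poly) \<in> range (\<lambda>c. [:c:])" by (metis pCons_0_0 rangeI)
  ultimately show ?thesis by (auto simp: path_rep_def branch_rep_def)
qed

lemma path_rep_indecomposable:
  assumes "i \<in> verts Q"
  shows "indecomposable Q (path_rep i :: ('v, 'a, 'k::field, 'k poly) rep)"
  unfolding path_rep_def
proof (rule branch_rep_indecomposable[OF assms order_refl constants(1) _ _ constants(3)])
  show "module.subspace smult {0::'k poly}"
    using module.subspace_single_0[OF vector_space_module[OF smult_vs]] .
  show "{0} \<subseteq> range (\<lambda>c::'k. [:c:])" by (metis empty_subsetI insert_subset pCons_0_0 rangeI)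
qed (use constants_split in blast)

lemma path_rep_flei:
  assumes "finite (inward i)"
  shows "flei Q (path_rep i)"
  unfolding path_rep_def
  by (rule branch_rep_flei[OF order_refl constants(1) _ assms constants(2)])
    (rule module.subspace_single_0[OF vector_space_module[OF smult_vs]])

text \<open>
  \<open>carried V i v j w\<close> holds iff \<open>w\<close> is the image of \<open>v\<close> along the directed path from \<open>i\<close> to \<open>j\<close>.
\<close>

inductive carried :: "('v, 'a, 'k, 'b) rep \<Rightarrow> 'v \<Rightarrow> 'b \<Rightarrow> 'v \<Rightarrow> 'b \<Rightarrow> bool" for V i v where
  start: "carried V i v i v"
| step: "carried V i v j w \<Longrightarrow> a \<in> arcs Q \<Longrightarrow> tail Q a = j \<Longrightarrow> carried V i v (head Q a) (mor V a w)"

lemma carried_reach: "carried V i v j w \<Longrightarrow> j \<in> reach i"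
  by (induction rule: carried.induct) (auto intro: reach_step)

lemma carried_exists:
  assumes "j \<in> reach i"
  shows "\<exists>w. carried V i v j w"
  using assms unfolding reach_def mem_Collect_eq
proof (induction rule: rtrancl_induct)
  case base
  show ?case by (rule exI) (rule carried.start)
next
  case (step y z)
  then obtain a where a: "a \<in> arcs Q" "y = tail Q a" "z = head Q a" by (auto simp: dadj_def)
  then show ?case using step(3) carried.step[of V i v y _ a] by blast
qed

lemma carried_unique:
  assumes "carried V i v j w" "carried V i v j w'"
  shows "w = w'"
  using assms
proof (induction arbitrary: w' rule: carried.induct)
  case start
  then show ?case
  proof (cases rule: carried.cases)
    case (step j' w'' a)
    then show ?thesis using carried_reach[OF step(3)] reach_no_return[of a i] by auto
  qed simp
next
  case (step j w a)
  have tr: "tail Q a \<in> reach i" using carried_reach[OF step(1)] step(3) by simp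
  from step(5) show ?case
  proof (cases rule: carried.cases)
    case start
    then show ?thesis using reach_no_return[OF step(2) tr] by simp
  next
    case (step j' w'' b)
    have "tail Q b \<in> reach i" using carried_reach[OF step(3)] step(5) by simp
    then have "a = b" using reach_unique_arrow[OF \<open>a \<in> arcs Q\<close> tr step(4)] step(1) by simp
    then show ?thesis using step \<open>tail Q a = j\<close> \<open>\<And>w'. carried V i v j w' \<Longrightarrow> w = w'\<close> by auto
  qed
qed

text \<open>
  The generator can be sent to any vector at \<open>i\<close>, and a reachable vertex \<open>j\<close> then has to map by
  multiples of the vector carried along the directed path to \<open>j\<close>. In a tree this path is unique, so
  nothing obstructs the definition.
\<close>

lemma path_rep_hits:
  fixes V :: "('v, 'a, 'k::field, 'b::ab_group_add) rep"
  assumes "quiver_rep Q V" "i \<in> verts Q" "v \<in> spc V i"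
  obtains \<phi> where "morphism Q (path_rep i) V \<phi>" "1 \<in> spc (path_rep i :: ('v, 'a, 'k, 'k poly) rep) i" "\<phi> i 1 = v"
proof -
  interpret V: vector_space "scal V" by (rule rep_vs[OF assms(1)])
  define w where "w = (\<lambda>j. THE w. carried V i v j w)"
  have w: "carried V i v j (w j)" if "j \<in> reach i" for j
    unfolding w_def using carried_exists[OF that] carried_unique by (metis theI)
  have w_in: "w j \<in> spc V j" if "j \<in> reach i" for j
    using w[OF that]
  proof (induction rule: carried.induct)
    case (step j w a)
    then show ?case using rep_mor_in[OF assms(1) step(2)] by simp
  qed (use assms in simp)
  have w_step: "w (head Q a) = mor V a (w (tail Q a))" if "a \<in> arcs Q" "tail Q a \<in> reach i" for a
    using carried_unique[OF w[OF reach_step[OF that]] carried.step[OF w[OF that(2)] that(1) refl]] .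
  define \<phi> where "\<phi> = (\<lambda>j p. if j \<in> reach i then scal V (coeff p 0) (w j) else 0)"
  have "morphism Q (path_rep i) V \<phi>"
    unfolding morphism_def
  proof (intro conjI ballI)
    fix q assume q: "q \<in> verts Q"
    show "linear_on (scal (path_rep i)) (scal V) (spc (path_rep i) q) (\<phi> q)"
      by (rule linear_onI) (auto simp: \<phi>_def path_rep_def V.scale_left_distrib)
    show "\<phi> q ` spc (path_rep i) q \<subseteq> spc V q"
      using q w_in rep_scale[OF assms(1) q] rep_zero[OF assms(1) q] by (auto simp: \<phi>_def)
  next
    fix a and x :: "'k poly" assume a: "a \<in> arcs Q" and x: "x \<in> spc (path_rep i) (tail Q a)"
    show "\<phi> (head Q a) (mor (path_rep i) a x) = mor V a (\<phi> (tail Q a) x)"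
    proof (cases "tail Q a \<in> reach i")
      case True
      then show ?thesis
        using reach_step[OF a True] w_step[OF a True] linear_on_scale[OF rep_linear[OF assms(1) a] w_in[OF True]]
        by (simp add: \<phi>_def path_rep_def)
    next
      case False
      then have "x = 0" using path_rep_notin_reach[OF assms(2) tail_in[OF a] False] x by blast
      then show ?thesis using False rep_mor_zero[OF assms(1) a] by (simp add: \<phi>_def path_rep_def)
    qed
  qed
  moreover have "w i = v" using carried_unique[OF w[OF reach_refl] carried.start] .
  moreover have "(1 :: 'k poly) \<in> spc (path_rep i) i" by (simp add: path_rep_reach one_pCons)
  ultimately show ?thesis using that[of \<phi>] by (simp add: \<phi>_def)
qed

end

section \<open>Direct sums\<close>

context rep_quiver
begin

definition decomposes :: "('v, 'a, 'k::field, 'b::ab_group_add) rep \<Rightarrow> ('v \<Rightarrow> 'b set) set \<Rightarrow> bool" where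
  "decomposes V D \<longleftrightarrow> (\<forall>X\<in>D. subrep Q V X) \<and> is_direct_sum Q V (spc V) D (\<lambda>X. X)"

lemma is_direct_sum_zero:
  fixes V :: "('v, 'a, 'k::field, 'b::ab_group_add) rep"
  assumes "is_direct_sum Q V Z J X" "i \<in> verts Q" "finite T" "T \<subseteq> J" "\<And>j. j \<in> T \<Longrightarrow> f j \<in> X j i"
    "(\<Sum>j\<in>T. f j) = 0" "j \<in> T"
  shows "f j = 0"
  using conjunct2[OF bspec[OF assms(1)[unfolded is_direct_sum_def] assms(2)], THEN spec, THEN spec, of T f]
    assms(3-7) by simp

text \<open>
  The components of a vector \<open>x\<close> in a decomposition \<open>D\<close>. They are required to vanish outside a finite
  part of \<open>D\<close>, also for families that are not in \<open>D\<close>, so that \<open>g\<close> is unique as a function.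
\<close>

definition components :: "('v \<Rightarrow> 'b::ab_group_add set) set \<Rightarrow> 'v \<Rightarrow> 'b \<Rightarrow> (('v \<Rightarrow> 'b set) \<Rightarrow> 'b) \<Rightarrow> bool" where
  "components D i x g \<longleftrightarrow> (\<exists>T. finite T \<and> T \<subseteq> D \<and> (\<forall>X\<in>D. g X \<in> X i) \<and> (\<forall>X. X \<notin> T \<longrightarrow> g X = 0) \<and>
     x = (\<Sum>X\<in>T. g X))"

lemma decomposes_subrep: "decomposes V D \<Longrightarrow> X \<in> D \<Longrightarrow> subrep Q V X"
  by (simp add: decomposes_def)

lemma components_exist:
  fixes V :: "('v, 'a, 'k::field, 'b::ab_group_add) rep"
  assumes V: "quiver_rep Q V" and D: "decomposes V D" and i: "i \<in> verts Q" and x: "x \<in> spc V i"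
  shows "\<exists>g. components D i x g"
proof -
  have "x \<in> module.span (scal V) (\<Union>X\<in>D. X i)" using D i x by (auto simp: decomposes_def is_direct_sum_def)
  then obtain T f where T: "finite T" "T \<subseteq> D" "\<forall>X\<in>T. f X \<in> X i" "x = (\<Sum>X\<in>T. f X)"
    using span_UN_iff_finite_sum[OF rep_vs[OF V], of D "\<lambda>X. X i"] decomposes_subrep[OF D] subrep_subspace i by metis
  have "0 \<in> X i" if "X \<in> D" for X
    using subspace_zeroI[OF rep_vs[OF V] subrep_subspace[OF decomposes_subrep[OF D that] i]] .
  then have "components D i x (\<lambda>X. if X \<in> T then f X else 0)"
    unfolding components_def using T by (intro exI[of _ T]) auto
  then show ?thesis by blast
qed

lemma components_unique:
  fixes V :: "('v, 'a, 'k::field, 'b::ab_group_add) rep"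
  assumes V: "quiver_rep Q V" and D: "decomposes V D" and i: "i \<in> verts Q"
    and g: "components D i x g" and h: "components D i x h"
  shows "g = h"
proof
  fix X
  obtain T where T: "finite T" "T \<subseteq> D" "\<forall>X\<in>D. g X \<in> X i" "\<forall>X. X \<notin> T \<longrightarrow> g X = 0" "x = (\<Sum>X\<in>T. g X)"
    using g unfolding components_def by blast
  obtain U where U: "finite U" "U \<subseteq> D" "\<forall>X\<in>D. h X \<in> X i" "\<forall>X. X \<notin> U \<longrightarrow> h X = 0" "x = (\<Sum>X\<in>U. h X)"
    using h unfolding components_def by blast
  have "(\<Sum>X\<in>T \<union> U. g X) = x"
    by (subst T(5), rule sum.mono_neutral_right) (use T(1-4) U(1-4) in auto)
  moreover have "(\<Sum>X\<in>T \<union> U. h X) = x"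
    by (subst U(5), rule sum.mono_neutral_right) (use T(1-4) U(1-4) in auto)
  ultimately have "(\<Sum>X\<in>T \<union> U. g X - h X) = 0" by (simp add: sum_subtractf)
  moreover have "g Y - h Y \<in> Y i" if "Y \<in> D" for Y
    using subspace_diffI[OF rep_vs[OF V] subrep_subspace[OF decomposes_subrep[OF D that] i]] T(3) U(3) that by auto
  moreover have "is_direct_sum Q V (spc V) D (\<lambda>X. X)" using D by (simp add: decomposes_def)
  ultimately have "g Y - h Y = 0" if "Y \<in> T \<union> U" for Y
    by (intro is_direct_sum_zero[of V "spc V" D "\<lambda>X. X" i "T \<union> U" "\<lambda>X. g X - h X"])
      (use i T(1,2) U(1,2) that in auto)
  from this[of X] show "g X = h X" using T(4) U(4) by (cases "X \<in> T \<union> U") auto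
qed

definition proj :: "('v \<Rightarrow> 'b::ab_group_add set) set \<Rightarrow> ('v \<Rightarrow> 'b set) \<Rightarrow> 'v \<Rightarrow> 'b \<Rightarrow> 'b" where
  "proj D X i x = (THE g. components D i x g) X"

context
  fixes V :: "('v, 'a, 'k::field, 'b::ab_group_add) rep" and D
  assumes V: "quiver_rep Q V" and D: "decomposes V D"
begin

lemma proj_eq: "i \<in> verts Q \<Longrightarrow> components D i x g \<Longrightarrow> proj D X i x = g X"
  unfolding proj_def using components_unique[OF V D] the_equality[of "components D i x" g] by metis

lemma proj_components:
  assumes "i \<in> verts Q" "x \<in> spc V i"
  shows "components D i x (\<lambda>X. proj D X i x)"
proof -
  obtain g where g: "components D i x g" using components_exist[OF V D assms] ..
  then have "(\<lambda>X. proj D X i x) = g" using proj_eq[OF assms(1)] by auto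
  then show ?thesis using g by simp
qed

lemma components_add:
  assumes i: "i \<in> verts Q" and g: "components D i x g" and h: "components D i y h"
  shows "components D i (x + y) (\<lambda>X. g X + h X)"
proof -
  obtain T where T: "finite T" "T \<subseteq> D" "\<forall>X\<in>D. g X \<in> X i" "\<forall>X. X \<notin> T \<longrightarrow> g X = 0" "x = (\<Sum>X\<in>T. g X)"
    using g unfolding components_def by blast
  obtain U where U: "finite U" "U \<subseteq> D" "\<forall>X\<in>D. h X \<in> X i" "\<forall>X. X \<notin> U \<longrightarrow> h X = 0" "y = (\<Sum>X\<in>U. h X)"
    using h unfolding components_def by blast
  have "(\<Sum>X\<in>T \<union> U. g X) = x"
    by (subst T(5), rule sum.mono_neutral_right) (use T(1-4) U(1-4) in auto)
  moreover have "(\<Sum>X\<in>T \<union> U. h X) = y"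
    by (subst U(5), rule sum.mono_neutral_right) (use T(1-4) U(1-4) in auto)
  ultimately have "x + y = (\<Sum>X\<in>T \<union> U. g X + h X)" by (simp add: sum.distrib)
  moreover have "g X + h X \<in> X i" if "X \<in> D" for X
    using subspace_addI[OF rep_vs[OF V] subrep_subspace[OF decomposes_subrep[OF D that] i]] T(3) U(3) that by auto
  ultimately show ?thesis
    unfolding components_def using T U by (intro exI[of _ "T \<union> U"]) auto
qed

lemma components_map:
  assumes g: "components D i x g" and i: "i \<in> verts Q"
    and h: "\<And>X. X \<in> D \<Longrightarrow> h ` X i \<subseteq> X j" "h 0 = 0" "linear_on (scal V) (scal V) (spc V i) h"
  shows "components D j (h x) (\<lambda>X. h (g X))"
proof -
  obtain T where T: "finite T" "T \<subseteq> D" "\<forall>X\<in>D. g X \<in> X i" "\<forall>X. X \<notin> T \<longrightarrow> g X = 0" "x = (\<Sum>X\<in>T. g X)"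
    using g unfolding components_def by blast
  have "h x = (\<Sum>X\<in>T. h (g X))"
    unfolding T(5) by (rule linear_on_sum[OF rep_vs[OF V] rep_subspace[OF V i] h(3)])
      (use T decomposes_subrep[OF D] subrep_in i in blast)
  moreover have "\<forall>X\<in>D. h (g X) \<in> X j" using T(3) h(1) by blast
  ultimately show ?thesis unfolding components_def using T h(2) by (intro exI[of _ T]) auto
qed

lemma proj_in: "X \<in> D \<Longrightarrow> i \<in> verts Q \<Longrightarrow> x \<in> spc V i \<Longrightarrow> proj D X i x \<in> X i"
  using proj_components unfolding components_def by blast

lemma proj_sum:
  assumes "i \<in> verts Q" "x \<in> spc V i"
  obtains T where "finite T" "T \<subseteq> D" "x = (\<Sum>X\<in>T. proj D X i x)" "\<And>X. X \<in> D \<Longrightarrow> X \<notin> T \<Longrightarrow> proj D X i x = 0"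
  using proj_components[OF assms] unfolding components_def by blast

lemma proj_sum_finite:
  assumes "i \<in> verts Q" "x \<in> spc V i" "finite D"
  shows "x = (\<Sum>X\<in>D. proj D X i x)"
proof -
  obtain T where T: "finite T" "T \<subseteq> D" "x = (\<Sum>X\<in>T. proj D X i x)" "\<And>X. X \<in> D \<Longrightarrow> X \<notin> T \<Longrightarrow> proj D X i x = 0"
    using proj_sum[OF assms(1,2)] by blast
  have "(\<Sum>X\<in>T. proj D X i x) = (\<Sum>X\<in>D. proj D X i x)"
    by (rule sum.mono_neutral_left) (use T assms(3) in auto)
  then show ?thesis using T(3) by simp
qed

lemma proj_member:
  assumes "X \<in> D" "i \<in> verts Q" "x \<in> X i"
  shows "proj D X i x = x" and "Y \<noteq> X \<Longrightarrow> proj D Y i x = 0"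
proof -
  have "0 \<in> Y i" if "Y \<in> D" for Y
    using subspace_zeroI[OF rep_vs[OF V] subrep_subspace[OF decomposes_subrep[OF D that] assms(2)]] .
  then have "components D i x (\<lambda>Y. if Y = X then x else 0)"
    unfolding components_def using assms by (intro exI[of _ "{X}"]) auto
  from proj_eq[OF assms(2) this] show "proj D X i x = x" "Y \<noteq> X \<Longrightarrow> proj D Y i x = 0" by auto
qed

lemma proj_morphism:
  assumes X: "X \<in> D"
  shows "morphism Q V (restr V X) (proj D X)"
  unfolding morphism_def restr_simps
proof (intro conjI ballI)
  interpret V: vector_space "scal V" by (rule rep_vs[OF V])
  fix i assume i: "i \<in> verts Q"
  show "linear_on (scal V) (scal V) (spc V i) (proj D X i)"
  proof (rule linear_onI)
    fix x y assume "x \<in> spc V i" "y \<in> spc V i"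
    then show "proj D X i (x + y) = proj D X i x + proj D X i y"
      using proj_eq[OF i components_add[OF i proj_components[OF i] proj_components[OF i]]] by blast
  next
    fix c x assume x: "x \<in> spc V i"
    have "scal V c ` Y i \<subseteq> Y i" if "Y \<in> D" for Y
      using V.subspace_scale[OF subrep_subspace[OF decomposes_subrep[OF D that] i]] by blast
    then show "proj D X i (scal V c x) = scal V c (proj D X i x)"
      by (intro proj_eq[OF i components_map[OF proj_components[OF i x] i]])
        (auto simp: linear_on_def V.scale_right_distrib V.scale_left_commute)
  qed
  show "proj D X i ` spc V i \<subseteq> X i" using proj_in[OF X i] by blast
next
  fix a x assume a: "a \<in> arcs Q" and x: "x \<in> spc V (tail Q a)"
  show "proj D X (head Q a) (mor V a x) = mor V a (proj D X (tail Q a) x)"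
    by (intro proj_eq[OF head_in[OF a] components_map[OF proj_components[OF tail_in[OF a] x] tail_in[OF a]]])
      (use rep_linear[OF V a] rep_mor_zero[OF V a] subrep_mor[OF decomposes_subrep[OF D] a] in auto)
qed

end

lemma is_direct_sum_union:
  fixes V :: "('v, 'a, 'k::field, 'b::ab_group_add) rep"
  assumes V: "quiver_rep Q V" and X: "is_direct_sum Q V X D (\<lambda>X. X)" and Y: "is_direct_sum Q V Y E (\<lambda>X. X)"
    and Z: "is_direct_sum2 Q V Z X Y"
  shows "is_direct_sum Q V Z (D \<union> E) (\<lambda>X. X)"
  unfolding is_direct_sum_def
proof (intro ballI conjI allI impI)
  interpret V: vector_space "scal V" by (rule rep_vs[OF V])
  fix i assume i: "i \<in> verts Q"
  have Xi: "X i = V.span (\<Union>W\<in>D. W i)" and Yi: "Y i = V.span (\<Union>W\<in>E. W i)"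
    and Zi: "Z i = {x + y | x y. x \<in> X i \<and> y \<in> Y i}" and disj: "X i \<inter> Y i = {0}"
    using X Y Z i by (simp_all add: is_direct_sum_def is_direct_sum2_def)
  show "Z i = V.span (\<Union>W\<in>D \<union> E. W i)"
    by (simp add: Zi Xi Yi UN_Un V.span_Un)
  fix T f W assume T: "finite T \<and> T \<subseteq> D \<union> E \<and> (\<forall>j\<in>T. f j \<in> j i) \<and> (\<Sum>j\<in>T. f j) = 0" and W: "W \<in> T"
  have 1: "(\<Sum>j\<in>T. f j) = (\<Sum>j\<in>T \<inter> D. f j) + (\<Sum>j\<in>T - D. f j)"
    using T sum.Int_Diff[of T f D] by simp
  have 2: "(\<Sum>j\<in>T \<inter> D. f j) \<in> X i" "(\<Sum>j\<in>T - D. f j) \<in> Y i"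
    unfolding Xi Yi using T by (auto intro!: V.span_sum intro: V.span_base)
  have "(\<Sum>j\<in>T \<inter> D. f j) = - (\<Sum>j\<in>T - D. f j)" using 1 T by (simp add: eq_neg_iff_add_eq_0)
  then have "(\<Sum>j\<in>T \<inter> D. f j) \<in> Y i" using 2(2) by (simp add: Yi V.span_neg)
  then have s: "(\<Sum>j\<in>T \<inter> D. f j) = 0" using 2(1) disj by auto
  then have s': "(\<Sum>j\<in>T - D. f j) = 0" using 1 T by simp
  show "f W = 0"
  proof (cases "W \<in> D")
    case True
    have "finite (T \<inter> D) \<and> T \<inter> D \<subseteq> D \<and> (\<forall>j\<in>T \<inter> D. f j \<in> j i) \<and> (\<Sum>j\<in>T \<inter> D. f j) = 0"
      using T s by auto
    then have "\<forall>j\<in>T \<inter> D. f j = 0" using X i unfolding is_direct_sum_def by blast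
    then show ?thesis using True W by simp
  next
    case False
    have "finite (T - D) \<and> T - D \<subseteq> E \<and> (\<forall>j\<in>T - D. f j \<in> j i) \<and> (\<Sum>j\<in>T - D. f j) = 0"
      using T s' by auto
    then have "\<forall>j\<in>T - D. f j = 0" using Y i unfolding is_direct_sum_def by blast
    then show ?thesis using False W by simp
  qed
qed

text \<open>
  A vector of \<open>X\<close> at the head is the image of some \<open>x + y\<close>. The part coming from \<open>y\<close> lies in both summands,
  and is zero.
\<close>

lemma summand_bij:
  fixes V :: "('v, 'a, 'k::field, 'b::ab_group_add) rep"
  assumes V: "quiver_rep Q V" and X: "subrep Q V X" and Y: "subrep Q V Y" and Z: "subrep Q V Z"
    and ds: "is_direct_sum2 Q V Z X Y" and a: "a \<in> arcs Q"
    and b: "bij_betw (mor V a) (Z (tail Q a)) (Z (head Q a))"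
  shows "bij_betw (mor V a) (X (tail Q a)) (X (head Q a))"
  unfolding bij_betw_def
proof
  have Y0: "0 \<in> Y i" if "i \<in> verts Q" for i
    using subspace_zeroI[OF rep_vs[OF V] subrep_subspace[OF Y that]] .
  have XZ: "X i \<subseteq> Z i" if "i \<in> verts Q" for i
    using ds Y0[OF that] that unfolding is_direct_sum2_def by force
  show "inj_on (mor V a) (X (tail Q a))" using b XZ[OF tail_in[OF a]] by (auto simp: bij_betw_def intro: inj_on_subset)
  show "mor V a ` X (tail Q a) = X (head Q a)"
  proof
    show "mor V a ` X (tail Q a) \<subseteq> X (head Q a)" using subrep_mor[OF X a] by blast
    show "X (head Q a) \<subseteq> mor V a ` X (tail Q a)"
    proof
      fix z assume z: "z \<in> X (head Q a)"
      then have "z \<in> mor V a ` Z (tail Q a)"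
        using b XZ[OF head_in[OF a]] unfolding bij_betw_def by blast
      then obtain w where w: "w \<in> Z (tail Q a)" "mor V a w = z" by blast
      obtain x y where xy: "x \<in> X (tail Q a)" "y \<in> Y (tail Q a)" "w = x + y"
        using ds w(1) tail_in[OF a] unfolding is_direct_sum2_def by blast
      have "z = mor V a x + mor V a y"
        using w(2) xy linear_on_add[OF rep_linear[OF V a]] subrep_in[OF X tail_in[OF a]] subrep_in[OF Y tail_in[OF a]] by simp
      then have "mor V a y = z - mor V a x" by simp
      then have "mor V a y \<in> X (head Q a)"
        using subspace_diffI[OF rep_vs[OF V] subrep_subspace[OF X head_in[OF a]] z subrep_mor[OF X a xy(1)]] by simp
      then have "mor V a y = 0" using subrep_mor[OF Y a xy(2)] ds head_in[OF a] unfolding is_direct_sum2_def by blast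
      then show "z \<in> mor V a ` X (tail Q a)" using xy \<open>z = _\<close> by auto
    qed
  qed
qed

lemma is_direct_sum2_commute: "is_direct_sum2 Q V Z X Y \<Longrightarrow> is_direct_sum2 Q V Z Y (X :: 'v \<Rightarrow> 'b::ab_group_add set)"
proof -
  have "{x + y | x y. x \<in> X i \<and> y \<in> Y i} = {x + y | x y. x \<in> Y i \<and> y \<in> X i}" for i
    by auto (metis add.commute)+
  then show "is_direct_sum2 Q V Z X Y \<Longrightarrow> is_direct_sum2 Q V Z Y X"
    by (simp add: is_direct_sum2_def Int_commute)
qed

end

section \<open>FLEI representations of a tree decompose\<close>

context tree_rep
begin

text \<open>
  All summands of \<open>V\<close> have isomorphisms along the arrows where \<open>V\<close> has. Up to isomorphism they are
  constant on the finitely many components that remain when the other arrows are removed, and a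
  summand is zero once it vanishes at one vertex \<open>r \<in> R\<close> of each component. Splitting off nonzero
  summands therefore lowers the finite number \<open>\<Sum>r\<in>R. dim (X r)\<close>.
\<close>

lemma flei_decomposition:
  fixes V :: "('v, 'a, 'k::field, 'b::ab_group_add) rep"
  assumes V: "quiver_rep Q V" and fl: "flei Q V"
  obtains D where "finite D" "decomposes V D"
    "\<And>X. X \<in> D \<Longrightarrow> indecomposable Q (restr V X)" "\<And>X. X \<in> D \<Longrightarrow> flei Q (restr V X)"
proof -
  interpret V: vector_space "scal V" by (rule rep_vs[OF V])
  define B where "B = {a\<in>arcs Q. \<not> bij_betw (mor V a) (spc V (tail Q a)) (spc V (head Q a))}"
  have B: "finite B" "B \<subseteq> arcs Q" using fl by (auto simp: B_def flei_iff)
  obtain R where R: "finite R" "R \<subseteq> verts Q" "\<And>q. q \<in> verts Q \<Longrightarrow> \<exists>r\<in>R. (r, q) \<in> (adj (arcs Q - B))\<^sup>*"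
    using finitely_many_components[OF connected_adj B] by blast
  define good where "good X \<longleftrightarrow> subrep Q V X \<and> (\<forall>a\<in>arcs Q - B. bij_betw (mor V a) (X (tail Q a)) (X (head Q a)))" for X
  have good_flei: "flei Q (restr V X)" if "good X" for X
  proof -
    have "fin_dim (scal V) (X i)" if "i \<in> verts Q" for i
      using fin_dim_subspace[OF rep_vs[OF V] flei_fin_dim[OF fl that]] \<open>good X\<close> that
      by (simp add: good_def subrep_subspace subrep_subset)
    moreover have "{a\<in>arcs Q. \<not> bij_betw (mor V a) (X (tail Q a)) (X (head Q a))} \<subseteq> B"
      using \<open>good X\<close> by (auto simp: good_def)
    ultimately show ?thesis using finite_subset[OF _ B(1)] by (simp add: flei_iff)
  qed
  have z: "0 \<in> X i" if "good X" "i \<in> verts Q" for X i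
    using subspace_zeroI[OF rep_vs[OF V] subrep_subspace] that by (auto simp: good_def)
  have zero_on_R: "zero_family Q X" if X: "good X" and zR: "\<And>r. r \<in> R \<Longrightarrow> X r = {0}" for X
    unfolding zero_family_def
  proof
    fix q assume "q \<in> verts Q"
    then obtain r where r: "r \<in> R" "(r, q) \<in> (adj (arcs Q - B))\<^sup>*" using R(3) by blast
    from r(2) show "X q = {0}"
    proof (induction rule: rtrancl_induct)
      case base
      then show ?case using zR r by simp
    next
      case (step y q')
      then obtain a where a: "a \<in> arcs Q" "a \<notin> B" "y = tail Q a \<and> q' = head Q a \<or> y = head Q a \<and> q' = tail Q a"
        by (auto simp: adj_def)
      have b: "bij_betw (mor V a) (X (tail Q a)) (X (head Q a))" using X a by (auto simp: good_def)
      have "X (tail Q a) = {0} \<longleftrightarrow> X (head Q a) = {0}"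
      proof
        assume "X (tail Q a) = {0}"
        then show "X (head Q a) = {0}" using b rep_mor_zero[OF V a(1)] by (simp add: bij_betw_def)
      next
        assume h: "X (head Q a) = {0}"
        have "w = 0" if "w \<in> X (tail Q a)" for w
        proof -
          have "mor V a w = mor V a 0" using b h that rep_mor_zero[OF V a(1)] by (auto simp: bij_betw_def)
          then show ?thesis using b that z[OF X tail_in[OF a(1)]] by (auto simp: bij_betw_def dest: inj_onD)
        qed
        then show "X (tail Q a) = {0}" using z[OF X tail_in[OF a(1)]] by blast
      qed
      then show ?case using step(3) a(3) by auto
    qed
  qed
  have main: "\<exists>D. finite D \<and> (\<forall>Y\<in>D. subrep Q V Y \<and> indecomposable Q (restr V Y) \<and> flei Q (restr V Y)) \<and>
      is_direct_sum Q V X D (\<lambda>X. X)" if "good X" "(\<Sum>r\<in>R. V.dim (X r)) = n" for X n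
    using that
  proof (induction n arbitrary: X rule: less_induct)
    case (less n)
    have X: "subrep Q V X" using less.prems by (simp add: good_def)
    consider "zero_family Q X" | "\<not> zero_family Q X" "indecomposable Q (restr V X)" |
        "\<not> zero_family Q X" "\<not> indecomposable Q (restr V X)" by blast
    then show ?case
    proof cases
      case 1
      then show ?thesis by (intro exI[of _ "{}"]) (simp add: is_direct_sum_def zero_family_def)
    next
      case 2
      have "is_direct_sum Q V X {X} (\<lambda>X. X)"
        unfolding is_direct_sum_def
      proof (intro ballI conjI allI impI)
        fix i assume i: "i \<in> verts Q"
        show "X i = V.span (\<Union>j\<in>{X}. j i)"
          by (subst V.span_eq_iff[THEN iffD2]) (simp_all add: subrep_subspace[OF X i])
      next
        fix i T j and f :: "('v \<Rightarrow> 'b set) \<Rightarrow> 'b"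
        assume "finite T \<and> T \<subseteq> {X} \<and> (\<forall>j\<in>T. f j \<in> j i) \<and> sum f T = 0" "j \<in> T"
        then have "T = {X}" "j = X" "sum f T = 0" by auto
        then show "f j = 0" by simp
      qed
      then show ?thesis using 2 X good_flei less.prems by (intro exI[of _ "{X}"]) simp
    next
      case 3
      obtain Y Z where YZ: "subrep Q (restr V X) Y" "subrep Q (restr V X) Z"
        "is_direct_sum2 Q (restr V X) X Y Z" "\<not> zero_family Q Y" "\<not> zero_family Q Z"
        using 3 quiver_rep_restr[OF V X] unfolding indecomposable_def by auto
      have ds: "is_direct_sum2 Q V X Y Z" using YZ(3) by (simp add: is_direct_sum2_def)
      have Y: "subrep Q V Y" "\<And>i. i \<in> verts Q \<Longrightarrow> Y i \<subseteq> X i"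
        and Z: "subrep Q V Z" "\<And>i. i \<in> verts Q \<Longrightarrow> Z i \<subseteq> X i"
        using YZ(1,2) subrep_restr[OF X] by auto
      have gY: "good Y" using summand_bij[OF V Y(1) Z(1) X ds] Y(1) less.prems by (auto simp: good_def)
      have gZ: "good Z" using summand_bij[OF V Z(1) Y(1) X is_direct_sum2_commute[OF ds]] Z(1) less.prems
        by (auto simp: good_def)
      have smaller: "(\<Sum>r\<in>R. V.dim (W r)) < n"
        if W: "good W" "\<And>i. i \<in> verts Q \<Longrightarrow> W i \<subseteq> X i" and W': "good W'" "\<not> zero_family Q W'"
          "\<And>i. i \<in> verts Q \<Longrightarrow> W' i \<subseteq> X i" "\<And>i. i \<in> verts Q \<Longrightarrow> W i \<inter> W' i = {0}" for W W'
      proof -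
        have sub: "V.subspace (W i)" "V.subspace (X i)" "fin_dim (scal V) (X i)" if "i \<in> verts Q" for i
          using W(1) X that flei_fin_dim[OF good_flei[OF less.prems(1)] that] by (auto simp: good_def subrep_subspace)
        obtain r where r: "r \<in> R" "W' r \<noteq> {0}" using zero_on_R[OF W'(1)] W'(2) by blast
        then have rv: "r \<in> verts Q" using R(2) by blast
        have "W r \<noteq> X r" using r(2) W'(3,4)[OF rv] by blast
        then have "V.dim (W r) < V.dim (X r)"
          using fin_dim_dim_mono[OF rep_vs[OF V] sub(3,2,1) W(2), OF rv rv rv rv] by linarith
        moreover have "V.dim (W i) \<le> V.dim (X i)" if "i \<in> R" for i
          using fin_dim_dim_mono(1)[OF rep_vs[OF V] sub(3,2,1) W(2)] that R(2) by blast
        ultimately have "(\<Sum>r\<in>R. V.dim (W r)) < (\<Sum>r\<in>R. V.dim (X r))"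
          using r(1) R(1) by (intro sum_strict_mono_ex1) auto
        then show ?thesis using less.prems by simp
      qed
      have disj: "Y i \<inter> Z i = {0}" if "i \<in> verts Q" for i using ds that by (simp add: is_direct_sum2_def)
      obtain DY where DY: "finite DY" "\<forall>Y\<in>DY. subrep Q V Y \<and> indecomposable Q (restr V Y) \<and> flei Q (restr V Y)"
        "is_direct_sum Q V Y DY (\<lambda>X. X)"
        using less.IH[OF smaller[OF gY Y(2) gZ YZ(5) Z(2) disj] gY refl] by auto
      obtain DZ where DZ: "finite DZ" "\<forall>Y\<in>DZ. subrep Q V Y \<and> indecomposable Q (restr V Y) \<and> flei Q (restr V Y)"
        "is_direct_sum Q V Z DZ (\<lambda>X. X)"
        using less.IH[OF smaller[OF gZ Z(2) gY YZ(4) Y(2)] gZ refl] disj by (auto simp: Int_commute)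
      show ?thesis
        using is_direct_sum_union[OF V DY(3) DZ(3) ds] DY DZ by (intro exI[of _ "DY \<union> DZ"]) auto
    qed
  qed
  have "good (spc V)" using subrep_spc[OF V] by (auto simp: good_def B_def)
  from main[OF this refl] show ?thesis using that unfolding decomposes_def by blast
qed

end

section \<open>Quotients\<close>

context rep_quiver
begin

text \<open>
  When \<open>p\<close> consists of projections along a subrepresentation \<open>L\<close>, this is \<open>S / L\<close>, realised on complements
  of the spaces \<open>L i\<close> without leaving the ambient space.
\<close>

definition quot :: "('v, 'a, 'k, 'b) rep \<Rightarrow> ('v \<Rightarrow> 'b \<Rightarrow> 'b) \<Rightarrow> ('v, 'a, 'k, 'b) rep" where
  "quot S p = \<lparr>scal = scal S, spc = (\<lambda>i. p i ` spc S i), mor = (\<lambda>a x. p (head Q a) (mor S a x))\<rparr>"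

lemma quotient_exists:
  fixes S :: "('v, 'a, 'k::field, 'b::ab_group_add) rep"
  assumes S: "quiver_rep Q S" and L: "subrep Q S L"
  obtains p where "quiver_rep Q (quot S p)" "morphism Q S (quot S p) p"
    "\<And>i. i \<in> verts Q \<Longrightarrow> p i ` spc S i \<subseteq> spc S i"
    "\<And>i x. i \<in> verts Q \<Longrightarrow> x \<in> spc S i \<Longrightarrow> p i x = 0 \<longleftrightarrow> x \<in> L i"
    "\<And>i x. i \<in> verts Q \<Longrightarrow> x \<in> spc S i \<Longrightarrow> x - p i x \<in> L i"
proof -
  have "\<forall>i\<in>verts Q. \<exists>p. linear_on (scal S) (scal S) (spc S i) p \<and> p ` spc S i \<subseteq> spc S i \<and>
      (\<forall>x\<in>spc S i. (p x = 0 \<longleftrightarrow> x \<in> L i) \<and> x - p x \<in> L i)"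
  proof
    fix i assume i: "i \<in> verts Q"
    obtain p where "linear_on (scal S) (scal S) (spc S i) p" "p ` spc S i \<subseteq> spc S i"
      "\<And>x. x \<in> spc S i \<Longrightarrow> p x = 0 \<longleftrightarrow> x \<in> L i" "\<And>x. x \<in> spc S i \<Longrightarrow> x - p x \<in> L i"
      using exists_projection_along[OF rep_vs[OF S] subrep_subspace[OF L i] rep_subspace[OF S i] subrep_subset[OF L i]] by blast
    then show "\<exists>p. linear_on (scal S) (scal S) (spc S i) p \<and> p ` spc S i \<subseteq> spc S i \<and>
      (\<forall>x\<in>spc S i. (p x = 0 \<longleftrightarrow> x \<in> L i) \<and> x - p x \<in> L i)" by blast
  qed
  then obtain p where p: "\<And>i. i \<in> verts Q \<Longrightarrow> linear_on (scal S) (scal S) (spc S i) (p i)"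
    "\<And>i. i \<in> verts Q \<Longrightarrow> p i ` spc S i \<subseteq> spc S i"
    "\<And>i x. i \<in> verts Q \<Longrightarrow> x \<in> spc S i \<Longrightarrow> p i x = 0 \<longleftrightarrow> x \<in> L i"
    "\<And>i x. i \<in> verts Q \<Longrightarrow> x \<in> spc S i \<Longrightarrow> x - p i x \<in> L i" by metis
  have "quiver_rep Q (quot S p)"
    unfolding quiver_rep_def
  proof (intro conjI ballI)
    show "vector_space (scal (quot S p))" using rep_vs[OF S] by (simp add: quot_def)
    show "module.subspace (scal (quot S p)) (spc (quot S p) i)" if "i \<in> verts Q" for i
      using linear_on_image_subspace[OF rep_vs[OF S] rep_vs[OF S] rep_subspace[OF S that] p(1)[OF that]]
      by (simp add: quot_def)
    fix a assume a: "a \<in> arcs Q"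
    have im: "mor S a ` spc S (tail Q a) \<subseteq> spc S (head Q a)" using rep_mor_in[OF S a] by blast
    have "linear_on (scal S) (scal S) (spc S (tail Q a)) (\<lambda>x. p (head Q a) (mor S a x))"
      by (rule linear_on_comp[OF rep_linear[OF S a] p(1)[OF head_in[OF a]] im])
    then show "linear_on (scal (quot S p)) (scal (quot S p)) (spc (quot S p) (tail Q a)) (mor (quot S p) a)"
      using linear_on_subset[OF _ p(2)[OF tail_in[OF a]]] by (simp add: quot_def)
    show "mor (quot S p) a ` spc (quot S p) (tail Q a) \<subseteq> spc (quot S p) (head Q a)"
      using p(2)[OF tail_in[OF a]] im by (auto simp: quot_def)
  qed
  moreover have "morphism Q S (quot S p) p"
    unfolding morphism_def
  proof (intro conjI ballI)
    fix a x assume a: "a \<in> arcs Q" and x: "x \<in> spc S (tail Q a)"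
    have px: "p (tail Q a) x \<in> spc S (tail Q a)" using p(2)[OF tail_in[OF a]] x by blast
    have "mor S a x - mor S a (p (tail Q a) x) = mor S a (x - p (tail Q a) x)"
      using linear_on_diff[OF rep_vs[OF S] rep_subspace[OF S tail_in[OF a]] rep_linear[OF S a] x px] by simp
    also have "\<dots> \<in> L (head Q a)" using subrep_mor[OF L a] p(4) a x by simp
    finally have "p (head Q a) (mor S a x - mor S a (p (tail Q a) x)) = 0"
      using p(3)[OF head_in[OF a]] subrep_in[OF L head_in[OF a]] by blast
    then show "p (head Q a) (mor S a x) = mor (quot S p) a (p (tail Q a) x)"
      using linear_on_diff[OF rep_vs[OF S] rep_subspace[OF S head_in[OF a]] p(1)[OF head_in[OF a]]
          rep_mor_in[OF S a x] rep_mor_in[OF S a px]] by (simp add: quot_def)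
  qed (use p(1) in \<open>auto simp: quot_def\<close>)
  ultimately show ?thesis using that p(2-4) by blast
qed

lemma quotient_flei:
  fixes S :: "('v, 'a, 'k::field, 'b::ab_group_add) rep"
  assumes S: "quiver_rep Q S" "flei Q S" and L: "subrep Q S L" "flei Q (restr S L)"
    and q: "quiver_rep Q (quot S p)" and m: "morphism Q S (quot S p) p"
    and p: "\<And>i. i \<in> verts Q \<Longrightarrow> p i ` spc S i \<subseteq> spc S i"
      "\<And>i x. i \<in> verts Q \<Longrightarrow> x \<in> spc S i \<Longrightarrow> p i x = 0 \<longleftrightarrow> x \<in> L i"
      "\<And>i x. i \<in> verts Q \<Longrightarrow> x \<in> spc S i \<Longrightarrow> x - p i x \<in> L i"
  shows "flei Q (quot S p)"
proof -
  let ?q = "quot S p"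
  have fd: "fin_dim (scal ?q) (spc ?q i)" if "i \<in> verts Q" for i
    using morphism_image_fin_dim[OF S(1) q S(2) m that] by (simp add: quot_def)
  have idem: "p i y = y" if i: "i \<in> verts Q" and y: "y \<in> spc ?q i" for i y
  proof -
    obtain x where x: "x \<in> spc S i" "y = p i x" using y by (auto simp: quot_def)
    have "p i x \<in> spc S i" using p(1)[OF i] x by auto
    then have "p i x - p i (p i x) = p i (x - p i x)" using morphism_diff[OF S(1) m i x(1)] by simp
    also have "\<dots> = 0" using p(2,3)[OF i] x(1) subrep_in[OF L(1) i] by blast
    finally show ?thesis using x by simp
  qed
  have "bij_betw (mor ?q a) (spc ?q (tail Q a)) (spc ?q (head Q a))"
    if a: "a \<in> arcs Q" and b: "bij_betw (mor S a) (spc S (tail Q a)) (spc S (head Q a))"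
      "bij_betw (mor S a) (L (tail Q a)) (L (head Q a))" for a
    unfolding bij_betw_def
  proof
    have t: "tail Q a \<in> verts Q" and h: "head Q a \<in> verts Q" using a by auto
    show "inj_on (mor ?q a) (spc ?q (tail Q a))"
    proof (rule linear_on_inj[OF rep_vs[OF q] rep_subspace[OF q t] rep_linear[OF q a]])
      fix y assume y: "y \<in> spc ?q (tail Q a)" "mor ?q a y = 0"
      then have yS: "y \<in> spc S (tail Q a)" using p(1)[OF t] by (auto simp: quot_def)
      then have "mor S a y \<in> L (head Q a)"
        using y(2) p(2)[OF h rep_mor_in[OF S(1) a yS]] by (simp add: quot_def)
      then have "mor S a y \<in> mor S a ` L (tail Q a)" using b(2) by (simp add: bij_betw_def)
      then obtain l where l: "l \<in> L (tail Q a)" "mor S a l = mor S a y" by auto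
      then have "y \<in> L (tail Q a)"
        using b(1) yS subrep_in[OF L(1) t l(1)] by (auto simp: bij_betw_def dest: inj_onD)
      then show "y = 0" using p(2)[OF t yS] idem[OF t y(1)] by simp
    qed
    have "mor ?q a ` p (tail Q a) ` spc S (tail Q a) = p (head Q a) ` mor S a ` spc S (tail Q a)"
      using morphism_mor[OF m a] by (simp add: image_image)
    then show "mor ?q a ` spc ?q (tail Q a) = spc ?q (head Q a)"
      using b(1) by (simp add: quot_def bij_betw_def)
  qed
  then have "{a \<in> arcs Q. \<not> bij_betw (mor ?q a) (spc ?q (tail Q a)) (spc ?q (head Q a))} \<subseteq>
     {a\<in>arcs Q. \<not> bij_betw (mor S a) (spc S (tail Q a)) (spc S (head Q a))} \<union>
     {a\<in>arcs Q. \<not> bij_betw (mor S a) (L (tail Q a)) (L (head Q a))}" by blast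
  moreover have "finite \<dots>" using S(2) L(2) by (simp add: flei_iff)
  ultimately show ?thesis using fd finite_subset unfolding flei_iff by blast
qed

text \<open>
  A morphism that kills \<open>L\<close> takes the same value on a coset as on its representative in the complement,
  so the induced morphism on \<open>S / L\<close> is given by \<open>f\<close> itself.
\<close>

lemma quotient_factor:
  fixes S :: "('v, 'a, 'k::field, 'b::ab_group_add) rep" and V :: "('v, 'a, 'k, 'c::ab_group_add) rep"
  assumes S: "quiver_rep Q S" and f: "morphism Q S V f" and L: "\<And>i x. i \<in> verts Q \<Longrightarrow> x \<in> L i \<Longrightarrow> f i x = 0"
    and W: "quiver_rep Q W" "scal W = scal S" "\<And>i. i \<in> verts Q \<Longrightarrow> spc W i \<subseteq> spc S i"
      "\<And>a x. a \<in> arcs Q \<Longrightarrow> x \<in> spc W (tail Q a) \<Longrightarrow> mor S a x - mor W a x \<in> L (head Q a)"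
  shows "morphism Q W V f"
  unfolding morphism_def
proof (intro conjI ballI)
  fix i assume i: "i \<in> verts Q"
  show "linear_on (scal W) (scal V) (spc W i) (f i)"
    using linear_on_subset[OF morphism_linear[OF f i] W(3)[OF i]] W(2) by simp
  show "f i ` spc W i \<subseteq> spc V i" using morphism_in[OF f i] W(3)[OF i] by blast
next
  fix a x assume a: "a \<in> arcs Q" and x: "x \<in> spc W (tail Q a)"
  have xS: "x \<in> spc S (tail Q a)" using W(3)[OF tail_in[OF a]] x by blast
  have "mor W a x \<in> spc S (head Q a)" using rep_mor_in[OF W(1) a x] W(3)[OF head_in[OF a]] by blast
  then have "f (head Q a) (mor S a x) - f (head Q a) (mor W a x) = f (head Q a) (mor S a x - mor W a x)"
    using morphism_diff[OF S f head_in[OF a] rep_mor_in[OF S a xS]] by simp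
  then show "f (head Q a) (mor W a x) = mor V a (f (tail Q a) x)"
    using L[OF head_in[OF a] W(4)[OF a x]] morphism_mor[OF f a xS] by simp
qed

end

context tree_rep
begin

text \<open>
  Instead of the quotient \<open>S / L\<close> and its decomposition, only the maps \<open>\<pi> t\<close> from \<open>S\<close> onto the
  indecomposable summands \<open>W t\<close> of \<open>S / L\<close> are recorded. The last three facts say that \<open>W t\<close> is realised in
  a complement of \<open>L\<close>, as \<open>quotient_factor\<close> requires.
\<close>

lemma flei_quotient_splits:
  fixes S :: "('v, 'a, 'k::field, 'b::ab_group_add) rep"
  assumes S: "quiver_rep Q S" "flei Q S" and L: "subrep Q S L" "flei Q (restr S L)"
  obtains D :: "('v \<Rightarrow> 'b set) set" and W :: "('v \<Rightarrow> 'b set) \<Rightarrow> ('v, 'a, 'k, 'b) rep" and \<pi>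
  where "finite D" "\<And>t. t \<in> D \<Longrightarrow> indecomposable Q (W t)" "\<And>t. t \<in> D \<Longrightarrow> flei Q (W t)"
    "\<And>t. t \<in> D \<Longrightarrow> morphism Q S (W t) (\<pi> t)"
    "\<And>t i. t \<in> D \<Longrightarrow> i \<in> verts Q \<Longrightarrow> spc (W t) i \<subseteq> \<pi> t i ` spc S i"
    "\<And>t i x. t \<in> D \<Longrightarrow> i \<in> verts Q \<Longrightarrow> x \<in> L i \<Longrightarrow> \<pi> t i x = 0"
    "\<And>i x. i \<in> verts Q \<Longrightarrow> x \<in> spc S i \<Longrightarrow> x - (\<Sum>t\<in>D. \<pi> t i x) \<in> L i"
    "\<And>t. t \<in> D \<Longrightarrow> scal (W t) = scal S" "\<And>t i. t \<in> D \<Longrightarrow> i \<in> verts Q \<Longrightarrow> spc (W t) i \<subseteq> spc S i"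
    "\<And>t a x. t \<in> D \<Longrightarrow> a \<in> arcs Q \<Longrightarrow> x \<in> spc (W t) (tail Q a) \<Longrightarrow> mor S a x - mor (W t) a x \<in> L (head Q a)"
proof -
  obtain p where p: "quiver_rep Q (quot S p)" "morphism Q S (quot S p) p"
    "\<And>i. i \<in> verts Q \<Longrightarrow> p i ` spc S i \<subseteq> spc S i"
    "\<And>i x. i \<in> verts Q \<Longrightarrow> x \<in> spc S i \<Longrightarrow> p i x = 0 \<longleftrightarrow> x \<in> L i"
    "\<And>i x. i \<in> verts Q \<Longrightarrow> x \<in> spc S i \<Longrightarrow> x - p i x \<in> L i"
    using quotient_exists[OF S(1) L(1)] by blast
  let ?q = "quot S p"
  have fl: "flei Q ?q" by (rule quotient_flei[OF S L p])
  obtain D where D: "finite D" "decomposes ?q D"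
    "\<And>X. X \<in> D \<Longrightarrow> indecomposable Q (restr ?q X)" "\<And>X. X \<in> D \<Longrightarrow> flei Q (restr ?q X)"
    using flei_decomposition[OF p(1) fl] by blast
  have sub: "subrep Q ?q X" if "X \<in> D" for X using D(2) that by (simp add: decomposes_def)
  have Xq: "x \<in> spc ?q i" if "X \<in> D" "i \<in> verts Q" "x \<in> X i" for X i x
    using subrep_in[OF sub that(2)] that by blast
  have qS: "spc ?q i \<subseteq> spc S i" if "i \<in> verts Q" for i using p(3)[OF that] by (simp add: quot_def)
  show ?thesis
  proof (rule that[of D "\<lambda>X. restr ?q X" "\<lambda>X i x. proj D X i (p i x)"])
    fix X assume X: "X \<in> D"
    show "morphism Q S (restr ?q X) (\<lambda>i x. proj D X i (p i x))"
      by (rule morphism_comp[OF p(2) proj_morphism[OF p(1) D(2) X]])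
    fix i assume i: "i \<in> verts Q"
    show "spc (restr ?q X) i \<subseteq> (\<lambda>x. proj D X i (p i x)) ` spc S i"
    proof
      fix y assume "y \<in> spc (restr ?q X) i"
      then have y: "y \<in> X i" by simp
      then obtain x where "x \<in> spc S i" "p i x = y" using Xq[OF X i] by (auto simp: quot_def)
      then show "y \<in> (\<lambda>x. proj D X i (p i x)) ` spc S i"
        using proj_member(1)[OF p(1) D(2) X i y] by (metis image_eqI)
    qed
    show "spc (restr ?q X) i \<subseteq> spc S i" using Xq[OF X i] qS[OF i] by auto
    show "proj D X i (p i x) = 0" if "x \<in> L i" for x
      using p(4)[OF i subrep_in[OF L(1) i that]] that morphism_zero[OF p(1) proj_morphism[OF p(1) D(2) X] i] by simp
  next
    fix i x assume i: "i \<in> verts Q" and x: "x \<in> spc S i"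
    have "(\<Sum>X\<in>D. proj D X i (p i x)) = p i x"
      using proj_sum_finite[OF p(1) D(2) i _ D(1)] x by (simp add: quot_def)
    then show "x - (\<Sum>X\<in>D. proj D X i (p i x)) \<in> L i" using p(5)[OF i x] by simp
  next
    fix X a x assume X: "X \<in> D" and a: "a \<in> arcs Q" and x: "x \<in> spc (restr ?q X) (tail Q a)"
    then have "x \<in> spc S (tail Q a)" using Xq[OF X tail_in[OF a]] qS[OF tail_in[OF a]] by auto
    then show "mor S a x - mor (restr ?q X) a x \<in> L (head Q a)"
      using p(5)[OF head_in[OF a] rep_mor_in[OF S(1) a]] by (simp add: quot_def)
  qed (use D in \<open>auto simp: quot_def\<close>)
qed

end

section \<open>Finite external direct sums\<close>

context rep_quiver
begin

text \<open>
  The summands of a direct sum are subrepresentations of \<open>V\<close>, which serve as their own indices: a vector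
  of the sum is a function on families of subspaces that vanishes outside \<open>J\<close>.
\<close>

definition dsum :: "('v, 'a, 'k, 'b::ab_group_add) rep \<Rightarrow> ('v \<Rightarrow> 'b set) set \<Rightarrow> ('v, 'a, 'k, ('v \<Rightarrow> 'b set) \<Rightarrow> 'b) rep" where
  "dsum V J = \<lparr>scal = (\<lambda>c f X. scal V c (f X)),
     spc = (\<lambda>i. {f. (\<forall>X\<in>J. f X \<in> X i) \<and> (\<forall>X. X \<notin> J \<longrightarrow> f X = 0)}),
     mor = (\<lambda>a f X. if X \<in> J then mor V a (f X) else 0)\<rparr>"

context
  fixes V :: "('v, 'a, 'k::field, 'b::ab_group_add) rep" and J
  assumes V: "quiver_rep Q V" and J: "\<And>X. X \<in> J \<Longrightarrow> subrep Q V X"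
begin

lemma dsum_vs: "vector_space (scal (dsum V J))"
proof -
  interpret V: vector_space "scal V" by (rule rep_vs[OF V])
  show ?thesis
    by standard (auto simp: dsum_def fun_eq_iff V.scale_right_distrib V.scale_left_distrib)
qed

lemma dsum_quiver_rep: "quiver_rep Q (dsum V J)"
  unfolding quiver_rep_def
proof (intro conjI ballI)
  interpret V: vector_space "scal V" by (rule rep_vs[OF V])
  show "vector_space (scal (dsum V J))" by (rule dsum_vs)
  fix i assume "i \<in> verts Q"
  then show "module.subspace (scal (dsum V J)) (spc (dsum V J) i)"
    using J[THEN subrep_subspace]
    by (intro subspaceI'[OF dsum_vs]) (auto simp: dsum_def V.subspace_0 V.subspace_add V.subspace_scale)
next
  interpret V: vector_space "scal V" by (rule rep_vs[OF V])
  fix a assume a: "a \<in> arcs Q"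
  show "linear_on (scal (dsum V J)) (scal (dsum V J)) (spc (dsum V J) (tail Q a)) (mor (dsum V J) a)"
    using linear_on_add[OF rep_linear[OF V a]] linear_on_scale[OF rep_linear[OF V a]] subrep_in[OF J tail_in[OF a]]
    by (intro linear_onI) (auto simp: dsum_def fun_eq_iff)
  show "mor (dsum V J) a ` spc (dsum V J) (tail Q a) \<subseteq> spc (dsum V J) (head Q a)"
    using subrep_mor[OF J a] by (auto simp: dsum_def)
qed

lemma dsum_inject:
  assumes X: "X \<in> J"
  shows "morphism Q (restr V X) (dsum V J) (\<lambda>i x Y. if Y = X then x else 0)"
proof -
  interpret V: vector_space "scal V" by (rule rep_vs[OF V])
  have "0 \<in> Y i" if "Y \<in> J" "i \<in> verts Q" for Y i
    using V.subspace_0[OF subrep_subspace[OF J[OF that(1)] that(2)]] .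
  then show ?thesis
    unfolding morphism_def restr_simps using X
    by (intro conjI ballI linear_onI ext) (auto simp: dsum_def rep_mor_zero[OF V])
qed

lemma dsum_sum:
  shows "morphism Q (dsum V J) V (\<lambda>i f. \<Sum>X\<in>J. f X)"
proof -
  interpret V: vector_space "scal V" by (rule rep_vs[OF V])
  have "(\<Sum>X\<in>J. f X) \<in> spc V i" if "i \<in> verts Q" "\<forall>X\<in>J. f X \<in> X i" for i f
    using that subrep_in[OF J that(1)] by (intro rep_sum[OF V that(1)]) auto
  moreover have "(\<Sum>X\<in>J. mor V a (f X)) = mor V a (\<Sum>X\<in>J. f X)" if a: "a \<in> arcs Q" "\<forall>X\<in>J. f X \<in> X (tail Q a)" for a f
    using linear_on_sum[OF rep_vs[OF V] rep_subspace[OF V tail_in[OF a(1)]] rep_linear[OF V a(1)], of J f]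
      a subrep_in[OF J tail_in[OF a(1)]] by auto
  ultimately show ?thesis
    by (auto simp: morphism_def linear_on_def dsum_def sum.distrib V.scale_sum_right)
qed

lemma dsum_flei:
  assumes fin: "finite J" and fl: "\<And>X. X \<in> J \<Longrightarrow> flei Q (restr V X)"
  shows "flei Q (dsum V J)"
  unfolding flei_iff
proof (intro conjI ballI)
  interpret V: vector_space "scal V" by (rule rep_vs[OF V])
  interpret S: vector_space "scal (dsum V J)" by (rule dsum_vs)
  fix i assume i: "i \<in> verts Q"
  let ?S = "dsum V J" and ?\<iota> = "\<lambda>X x Y. if Y = X then x else (0::'b)"
  have "\<forall>X\<in>J. \<exists>B. finite B \<and> X i = V.span B" using flei_fin_dim[OF fl i] by (auto simp: fin_dim_def)
  then obtain B where B: "\<And>X. X \<in> J \<Longrightarrow> finite (B X)" "\<And>X. X \<in> J \<Longrightarrow> X i = V.span (B X)" by metis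
  let ?B = "\<Union>X\<in>J. ?\<iota> X ` B X"
  have lin: "module_hom (scal V) (scal ?S) (?\<iota> X)" for X
    by unfold_locales (auto simp: dsum_def fun_eq_iff)
  have "spc ?S i = S.span ?B"
  proof
    show "spc ?S i \<subseteq> S.span ?B"
    proof
      fix f assume f: "f \<in> spc ?S i"
      have eq: "(\<Sum>X\<in>J. ?\<iota> X (f X)) = f"
      proof
        fix Y
        have "(\<Sum>X\<in>K. ?\<iota> X (f X)) Y = (\<Sum>X\<in>K. ?\<iota> X (f X) Y)" if "finite K" for K
          using that by (induction K rule: finite_induct) (simp_all add: plus_fun_def zero_fun_def)
        then have "(\<Sum>X\<in>J. ?\<iota> X (f X)) Y = (\<Sum>X\<in>J. if Y = X then f X else 0)" using fin by simp
        also have "\<dots> = f Y" using fin f by (simp add: dsum_def)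
        finally show "(\<Sum>X\<in>J. ?\<iota> X (f X)) Y = f Y" .
      qed
      have "?\<iota> X (f X) \<in> S.span ?B" if "X \<in> J" for X
      proof -
        have "f X \<in> V.span (B X)" using f that B(2) by (auto simp: dsum_def)
        then have "?\<iota> X (f X) \<in> S.span (?\<iota> X ` B X)" using module_hom.span_image[OF lin] by blast
        then show ?thesis using S.span_mono[of "?\<iota> X ` B X" ?B] that by blast
      qed
      then have "(\<Sum>X\<in>J. ?\<iota> X (f X)) \<in> S.span ?B" by (rule S.span_sum)
      then show "f \<in> S.span ?B" unfolding eq .
    qed
    have "?\<iota> X b \<in> spc ?S i" if "X \<in> J" "b \<in> B X" for X b
    proof -
      have "b \<in> X i" using that B(2) V.span_base by blast
      moreover have "0 \<in> Y i" if "Y \<in> J" for Y using V.subspace_0[OF subrep_subspace[OF J[OF that] i]] .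
      ultimately show ?thesis using \<open>X \<in> J\<close> by (auto simp: dsum_def)
    qed
    then show "S.span ?B \<subseteq> spc ?S i"
      using rep_subspace[OF dsum_quiver_rep i] by (intro S.span_minimal) auto
  qed
  moreover have "finite ?B" using fin B(1) by auto
  ultimately show "fin_dim (scal ?S) (spc ?S i)" unfolding fin_dim_def by blast
next
  let ?S = "dsum V J"
  have "bij_betw (mor ?S a) (spc ?S (tail Q a)) (spc ?S (head Q a))"
    if a: "a \<in> arcs Q" and b: "\<forall>X\<in>J. bij_betw (mor V a) (X (tail Q a)) (X (head Q a))" for a
  proof (rule bij_betw_byWitness[where f' = "\<lambda>g X. if X \<in> J then inv_into (X (tail Q a)) (mor V a) (g X) else 0"])
    show "\<forall>f\<in>spc ?S (tail Q a). (\<lambda>X. if X \<in> J then inv_into (X (tail Q a)) (mor V a) (mor ?S a f X) else 0) = f"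
      using b by (auto simp: dsum_def fun_eq_iff bij_betw_inv_into_left)
    show "\<forall>f\<in>spc ?S (head Q a). mor ?S a (\<lambda>X. if X \<in> J then inv_into (X (tail Q a)) (mor V a) (f X) else 0) = f"
      using b by (auto simp: dsum_def fun_eq_iff bij_betw_inv_into_right)
    show "mor ?S a ` spc ?S (tail Q a) \<subseteq> spc ?S (head Q a)"
      using rep_mor_in[OF dsum_quiver_rep a] by blast
    show "(\<lambda>g X. if X \<in> J then inv_into (X (tail Q a)) (mor V a) (g X) else 0) ` spc ?S (head Q a) \<subseteq> spc ?S (tail Q a)"
      using b by (auto simp: dsum_def bij_betw_def inv_into_into)
  qed
  then have "{a \<in> arcs Q. \<not> bij_betw (mor ?S a) (spc ?S (tail Q a)) (spc ?S (head Q a))} \<subseteq>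
    (\<Union>X\<in>J. {a\<in>arcs Q. \<not> bij_betw (mor V a) (X (tail Q a)) (X (head Q a))})" by blast
  moreover have "finite \<dots>" using fin fl by (auto simp: flei_iff)
  ultimately show "finite {a \<in> arcs Q. \<not> bij_betw (mor ?S a) (spc ?S (tail Q a)) (spc ?S (head Q a))}"
    using finite_subset by blast
qed

end

end

section \<open>Isomorphism classes and their order\<close>

context rep_quiver
begin

definition fin_indec :: "('v, 'a, 'k::field, 'b::ab_group_add) rep \<Rightarrow> bool" where
  "fin_indec X \<longleftrightarrow> indecomposable Q X \<and> flei Q X"

text \<open>
  The class of \<open>X\<close> consists of polynomial representations, while \<open>X\<close> itself may live in any ambient
  space.
\<close>

definition cls :: "('v, 'a, 'k::field, 'b::ab_group_add) rep \<Rightarrow> ('v, 'a, 'k) rep_class" where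
  "cls X = {W. fin_indec W \<and> isomorphic Q X W}"

lemma fin_indec_rep: "fin_indec X \<Longrightarrow> quiver_rep Q X"
  and fin_indec_flei: "fin_indec X \<Longrightarrow> flei Q X"
  and fin_indec_nonzero: "fin_indec X \<Longrightarrow> \<not> zero_family Q (spc X)"
  by (simp_all add: fin_indec_def indecomposable_def)

lemma fin_indec_vector:
  fixes X :: "('v, 'a, 'k::field, 'b::ab_group_add) rep"
  assumes "fin_indec X"
  obtains i x where "i \<in> verts Q" "x \<in> spc X i" "x \<noteq> 0"
proof -
  obtain i where i: "i \<in> verts Q" "spc X i \<noteq> {0}"
    using fin_indec_nonzero[OF assms] by (auto simp: zero_family_def)
  then show ?thesis using that rep_zero[OF fin_indec_rep[OF assms] i(1)] by blast
qed

lemma fin_indec_isomorphic: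
  fixes V :: "('v, 'a, 'k::field, 'b::ab_group_add) rep" and W :: "('v, 'a, 'k, 'c::ab_group_add) rep"
  shows "quiver_rep Q W \<Longrightarrow> isomorphic Q V W \<Longrightarrow> fin_indec V \<Longrightarrow> fin_indec W"
  unfolding fin_indec_def
  using indecomposable_isomorphic flei_isomorphic indecomposable_def by metis

lemma cls_eq:
  fixes V :: "('v, 'a, 'k::field, 'b::ab_group_add) rep" and W :: "('v, 'a, 'k, 'c::ab_group_add) rep"
  assumes "fin_indec V" "isomorphic Q V W"
  shows "cls V = cls W"
  unfolding cls_def
  using isomorphic_trans[OF assms(2)] isomorphic_trans[OF isomorphic_sym[OF fin_indec_rep[OF assms(1)] assms(2)]] by blast

lemma cls_nonempty:
  fixes V :: "('v, 'a, 'k::field, 'b::ab_group_add) rep"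
  assumes "fin_indec V"
  obtains W where "W \<in> cls V"
proof -
  obtain W :: "('v, 'a, 'k, 'k poly) rep" where "quiver_rep Q W" "isomorphic Q V W"
    using flei_poly_model[OF fin_indec_rep[OF assms] fin_indec_flei[OF assms]] .
  then show ?thesis using that fin_indec_isomorphic[OF _ _ assms] by (auto simp: cls_def)
qed

lemma cls_eqD:
  fixes V :: "('v, 'a, 'k::field, 'b::ab_group_add) rep" and W :: "('v, 'a, 'k, 'c::ab_group_add) rep"
  assumes "fin_indec V" "fin_indec W" "cls V = cls W"
  shows "isomorphic Q V W"
proof -
  obtain U where "U \<in> cls V" using cls_nonempty[OF assms(1)] .
  then have "isomorphic Q V U" "isomorphic Q W U" using assms(3) by (auto simp: cls_def)
  then show ?thesis using isomorphic_trans isomorphic_sym[OF fin_indec_rep[OF assms(2)]] by blast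
qed

lemma indec_flei_eq: "indec_flei Q = {cls W | W :: ('v, 'a, 'k::field, 'k poly) rep. fin_indec W}"
proof -
  have "{(V, W). indecomposable Q V \<and> flei Q V \<and> indecomposable Q W \<and> flei Q W \<and> isomorphic Q V W} `` {W} = cls W"
    if "fin_indec W" for W :: "('v, 'a, 'k, 'k poly) rep"
    using that by (auto simp: cls_def fin_indec_def)
  then show ?thesis unfolding indec_flei_def quotient_def by (force simp: fin_indec_def)
qed

lemma cls_in:
  fixes V :: "('v, 'a, 'k::field, 'b::ab_group_add) rep"
  assumes "fin_indec V"
  shows "cls V \<in> indec_flei Q"
proof -
  obtain W where "W \<in> cls V" using cls_nonempty[OF assms] .
  then have "fin_indec W" "cls W = cls V" using cls_eq[OF assms] by (auto simp: cls_def)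
  then show ?thesis unfolding indec_flei_eq by blast
qed

lemma belongs_iff:
  fixes V :: "('v, 'a, 'k::field, 'b::ab_group_add) rep"
  assumes "quiver_rep Q V" "\<alpha> \<in> indec_flei Q"
  shows "belongs Q V \<alpha> \<longleftrightarrow> fin_indec V \<and> cls V = \<alpha>"
proof
  obtain U :: "('v, 'a, 'k, 'k poly) rep" where U: "fin_indec U" "\<alpha> = cls U" using assms(2) unfolding indec_flei_eq by blast
  assume "belongs Q V \<alpha>"
  then obtain W where W: "W \<in> \<alpha>" "isomorphic Q V W" by (auto simp: belongs_def)
  have fW: "fin_indec W" "isomorphic Q U W" using W U by (auto simp: cls_def)
  have fV: "fin_indec V" using fin_indec_isomorphic[OF assms(1) isomorphic_sym[OF assms(1) W(2)] fW(1)] .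
  then show "fin_indec V \<and> cls V = \<alpha>" using cls_eq[OF fV W(2)] cls_eq[OF U(1) fW(2)] U(2) by simp
next
  assume "fin_indec V \<and> cls V = \<alpha>"
  then show "belongs Q V \<alpha>" using cls_nonempty[of V] by (auto simp: belongs_def cls_def)
qed

text \<open>
  The map is transported to polynomial models of \<open>X\<close> and \<open>Y\<close>, which gives a chain of length 2.
\<close>

lemma indec_le_step:
  fixes X :: "('v, 'a, 'k::field, 'b::ab_group_add) rep" and Y :: "('v, 'a, 'k, 'c::ab_group_add) rep"
  assumes X: "fin_indec X" and Y: "fin_indec Y" and f: "nonzero_morphism Q X Y f" "\<not> isomorphism Q X Y f"
  shows "(cls Y, cls X) \<in> indec_le Q"
proof -
  note rX = fin_indec_rep[OF X] and rY = fin_indec_rep[OF Y]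
  have m: "morphism Q X Y f" using f by (simp add: nonzero_morphism_def)
  obtain X' where X': "X' \<in> cls X" using cls_nonempty[OF X] .
  obtain Y' where Y': "Y' \<in> cls Y" using cls_nonempty[OF Y] .
  obtain \<phi> where \<phi>: "isomorphism Q X X' \<phi>" using X' by (auto simp: cls_def isomorphic_def)
  obtain \<psi> where \<psi>: "isomorphism Q Y Y' \<psi>" using Y' by (auto simp: cls_def isomorphic_def)
  have rY': "quiver_rep Q Y'" using Y' fin_indec_rep by (auto simp: cls_def)
  obtain \<phi>' where \<phi>': "isomorphism Q X' X \<phi>'" using isomorphism_inv[OF rX \<phi>] by blast
  obtain \<psi>' where \<psi>': "isomorphism Q Y' Y \<psi>'" using isomorphism_inv[OF rY \<psi>] by blast
  let ?g = "\<lambda>i x. \<psi> i (f i (\<phi>' i x))"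
  have b: "bij_betw (\<phi>' i) (spc X' i) (spc X i)" "bij_betw (\<psi> i) (spc Y i) (spc Y' i)" if "i \<in> verts Q" for i
    using \<phi>' \<psi> that by (auto simp: isomorphism_def)
  have mg: "morphism Q X' Y' ?g"
    using morphism_comp[OF morphism_comp[of X' X \<phi>' Y f] , of Y' \<psi>] m \<phi>' \<psi> by (simp add: isomorphism_def)
  obtain i x where i: "i \<in> verts Q" "x \<in> spc X i" "f i x \<noteq> 0" using f by (auto simp: nonzero_morphism_def)
  obtain x' where x': "x' \<in> spc X' i" "\<phi>' i x' = x" using b(1)[OF i(1)] i(2) by (force simp: bij_betw_def)
  have "?g i x' \<noteq> 0"
    using isomorphism_eq_zero[OF rY \<psi> i(1) morphism_in[OF m i(1,2)]] i(3) x'(2) by auto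
  then have nz: "nonzero_morphism Q X' Y' ?g" using mg i(1) x'(1) by (auto simp: nonzero_morphism_def)
  have "isomorphism Q X Y f" if g: "isomorphism Q X' Y' ?g"
  proof (rule isomorphismI[OF rX m])
    fix j x assume j: "j \<in> verts Q" "x \<in> spc X j" "f j x = 0"
    obtain y where y: "y \<in> spc X' j" "\<phi>' j y = x" using b(1)[OF j(1)] j(2) by (force simp: bij_betw_def)
    have "?g j y = 0" using y j(3) morphism_zero[OF rY _ j(1), of Y' \<psi>] \<psi> by (simp add: isomorphism_def)
    then have "y = 0" using isomorphism_eq_zero[OF _ g j(1) y(1)] X' fin_indec_rep by (auto simp: cls_def)
    then show "x = 0" using y(2) morphism_zero[OF _ _ j(1), of X' X \<phi>'] X' \<phi>' fin_indec_rep by (auto simp: cls_def isomorphism_def)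
  next
    fix j assume j: "j \<in> verts Q"
    show "spc Y j \<subseteq> f j ` spc X j"
    proof
      fix y assume y: "y \<in> spc Y j"
      have "\<psi> j y \<in> ?g j ` spc X' j" using g b(2)[OF j] y j by (auto simp: isomorphism_def bij_betw_def)
      then obtain z where z: "z \<in> spc X' j" "\<psi> j y = \<psi> j (f j (\<phi>' j z))" by blast
      have x: "\<phi>' j z \<in> spc X j" using b(1)[OF j] z(1) by (auto simp: bij_betw_def)
      then have "y = f j (\<phi>' j z)"
        using b(2)[OF j] z(2) y morphism_in[OF m j x] by (auto simp: bij_betw_def dest: inj_onD)
      then show "y \<in> f j ` spc X j" using x by blast
    qed
  qed
  then have ng: "\<not> isomorphism Q X' Y' ?g" using f(2) by blast
  have "\<exists>\<phi>. nonzero_morphism Q ([X', Y'] ! n) ([X', Y'] ! Suc n) \<phi> \<and>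
      \<not> isomorphism Q ([X', Y'] ! n) ([X', Y'] ! Suc n) \<phi>" if "Suc n < 2" for n
    using that nz ng by auto
  moreover have "[X', Y'] ! n \<in> [cls X, cls Y] ! n" if "n < 2" for n
    using that X' Y' by (cases n) auto
  ultimately show ?thesis
    unfolding indec_le_def mem_Collect_eq case_prod_conv
    by (intro exI[of _ "[cls X, cls Y]"] exI[of _ "[X', Y']"]) (simp add: cls_in[OF X] cls_in[OF Y])
qed

lemma isomorphic_dim:
  fixes V :: "('v, 'a, 'k::field, 'b::ab_group_add) rep" and W :: "('v, 'a, 'k, 'c::ab_group_add) rep"
  assumes "quiver_rep Q V" "quiver_rep Q W" "flei Q V" "isomorphic Q V W" "i \<in> verts Q"
  shows "vector_space.dim (scal W) (spc W i) = vector_space.dim (scal V) (spc V i)"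
proof -
  obtain \<phi> where \<phi>: "morphism Q V W \<phi>" "bij_betw (\<phi> i) (spc V i) (spc W i)"
    using assms(4,5) by (auto simp: isomorphic_def isomorphism_def)
  show ?thesis
    using linear_on_dim_image(3)[OF rep_vs[OF assms(1)] rep_vs[OF assms(2)] rep_subspace[OF assms(1,5)]
        morphism_linear[OF \<phi>(1) assms(5)] flei_fin_dim[OF assms(3,5)]] \<phi>(2) by (metis bij_betw_def)
qed

end

locale posetal = tree_rep Q for Q :: "('v, 'a) pre_digraph" +
  fixes LE :: "(('v, 'a, 'k::field) rep_class \<times> ('v, 'a, 'k) rep_class) set"
  assumes LE: "LE = indec_le Q"
    and po: "partial_order_on (indec_flei Q) LE"
    and wfo: "wf_on (indec_flei Q) (LE - Id)"
begin

lemma LE_refl: "\<alpha> \<in> indec_flei Q \<Longrightarrow> (\<alpha>, \<alpha>) \<in> LE"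
  and LE_in: "(\<alpha>, \<beta>) \<in> LE \<Longrightarrow> \<alpha> \<in> indec_flei Q \<and> \<beta> \<in> indec_flei Q"
  and LE_trans: "(\<alpha>, \<beta>) \<in> LE \<Longrightarrow> (\<beta>, \<gamma>) \<in> LE \<Longrightarrow> (\<alpha>, \<gamma>) \<in> LE"
  and LE_antisym: "(\<alpha>, \<beta>) \<in> LE \<Longrightarrow> (\<beta>, \<alpha>) \<in> LE \<Longrightarrow> \<alpha> = \<beta>"
  using po unfolding partial_order_on_def preorder_on_def
  by (auto simp: refl_on_def dest: transD antisymD)

lemma LE_step:
  fixes X :: "('v, 'a, 'k, 'b::ab_group_add) rep" and Y :: "('v, 'a, 'k, 'c::ab_group_add) rep"
  shows "fin_indec X \<Longrightarrow> fin_indec Y \<Longrightarrow> nonzero_morphism Q X Y f \<Longrightarrow> \<not> isomorphism Q X Y f \<Longrightarrow> (cls Y, cls X) \<in> LE"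
  unfolding LE by (rule indec_le_step)

text \<open>
  The image of \<open>g\<close> is FLEI, and \<open>X\<close> has a nonzero map onto some indecomposable summand \<open>W\<close> of it, which
  embeds into \<open>X\<close>. If \<open>g\<close> is not bijective at a vertex, then \<open>W\<close> has smaller dimension than \<open>X\<close> there, so
  neither map is an isomorphism. This yields \<open>X \<ge> W \<ge> X\<close> for nonisomorphic \<open>X\<close> and \<open>W\<close>, against
  antisymmetry.
\<close>

lemma endomorphism_iso:
  fixes X :: "('v, 'a, 'k, 'b::ab_group_add) rep"
  assumes X: "fin_indec X" and g: "nonzero_morphism Q X X g"
  shows "isomorphism Q X X g"
proof (rule ccontr)
  assume not_iso: "\<not> isomorphism Q X X g"
  note rX = fin_indec_rep[OF X] and fX = fin_indec_flei[OF X]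
  have m: "morphism Q X X g" using g by (simp add: nonzero_morphism_def)
  let ?I = "\<lambda>i. g i ` spc X i"
  have I: "subrep Q X ?I" by (rule subrep_image[OF rX rX m])
  have rI: "quiver_rep Q (restr X ?I)" by (rule quiver_rep_restr[OF rX I])
  have fI: "flei Q (restr X ?I)" by (rule flei_image[OF rX rX fX fX m])
  obtain D where D: "finite D" "decomposes (restr X ?I) D"
    "\<And>Y. Y \<in> D \<Longrightarrow> indecomposable Q (restr (restr X ?I) Y)" "\<And>Y. Y \<in> D \<Longrightarrow> flei Q (restr (restr X ?I) Y)"
    using flei_decomposition[OF rI fI] by blast
  obtain i x where i: "i \<in> verts Q" "x \<in> spc X i" "g i x \<noteq> 0" using g by (auto simp: nonzero_morphism_def)
  have "g i x = (\<Sum>Y\<in>D. proj D Y i (g i x))"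
    using proj_sum_finite[OF rI D(2) i(1) _ D(1)] i(2) by simp
  then obtain Y where Y: "Y \<in> D" "proj D Y i (g i x) \<noteq> 0" using i(3) by (metis sum.neutral)
  let ?W = "restr X Y"
  have fW: "fin_indec ?W" using D(3,4)[OF Y(1)] by (simp add: fin_indec_def)
  have subY: "subrep Q X Y" "\<And>j. j \<in> verts Q \<Longrightarrow> Y j \<subseteq> ?I j"
    using decomposes_subrep[OF D(2) Y(1)] subrep_restr[OF I, of Y] by auto
  let ?a = "\<lambda>i x. proj D Y i (g i x)"
  have "morphism Q X (restr X ?I) g" using morphism_restr_cod[OF m, of ?I] by simp
  from morphism_comp[OF this proj_morphism[OF rI D(2) Y(1)]]
  have a: "nonzero_morphism Q X ?W ?a" using i Y(2) by (auto simp: nonzero_morphism_def)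
  obtain j w where "j \<in> verts Q" "w \<in> spc ?W j" "w \<noteq> 0" using fin_indec_vector[OF fW] .
  then have b: "nonzero_morphism Q ?W X (\<lambda>i x. x)"
    using morphism_inclusion[OF subY(1)] by (auto simp: nonzero_morphism_def)
  have "\<not> isomorphic Q X ?W"
  proof
    assume iso: "isomorphic Q X ?W"
    have "bij_betw (g q) (spc X q) (spc X q)" if q: "q \<in> verts Q" for q
    proof -
      let ?d = "vector_space.dim (scal X)"
      note lin = linear_on_dim_image[OF rep_vs[OF rX] rep_vs[OF rX] rep_subspace[OF rX q] morphism_linear[OF m q] flei_fin_dim[OF fX q]]
      have e: "?d (Y q) = ?d (spc X q)"
        using isomorphic_dim[OF rX fin_indec_rep[OF fW] fX iso q] by simp
      have le: "?d (Y q) \<le> ?d (?I q)"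
        using fin_dim_dim_mono(1)[OF rep_vs[OF rX] lin(1) subrep_subspace[OF I q] subrep_subspace[OF subY(1) q] subY(2)[OF q]] .
      have eq: "?d (?I q) = ?d (spc X q)" using e le lin(2) by simp
      have "?I q = spc X q"
        using fin_dim_dim_mono(2)[OF rep_vs[OF rX] flei_fin_dim[OF fX q] rep_subspace[OF rX q]
            subrep_subspace[OF I q] subrep_subset[OF I q] eq] .
      then show ?thesis using lin(3) eq by (simp add: bij_betw_def)
    qed
    then show False using not_iso m by (simp add: isomorphism_def)
  qed
  moreover from this have "\<not> isomorphic Q ?W X" using isomorphic_sym[OF fin_indec_rep[OF fW]] by blast
  ultimately have "(cls ?W, cls X) \<in> LE" "(cls X, cls ?W) \<in> LE"
    using LE_step[OF X fW a] LE_step[OF fW X b] by (auto simp: isomorphic_def)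
  then have "cls X = cls ?W" by (rule LE_antisym[rotated])
  then show False using cls_eqD[OF X fW] \<open>\<not> isomorphic Q X ?W\<close> by blast
qed

text \<open>
  Composing with an isomorphism \<open>Y \<rightarrow> X\<close> reduces the claim to endomorphisms.
\<close>

lemma same_class_iso:
  fixes X :: "('v, 'a, 'k, 'b::ab_group_add) rep" and Y :: "('v, 'a, 'k, 'c::ab_group_add) rep"
  assumes X: "fin_indec X" and Y: "fin_indec Y" and eq: "cls X = cls Y" and f: "nonzero_morphism Q X Y f"
  shows "isomorphism Q X Y f"
proof -
  note rX = fin_indec_rep[OF X] and rY = fin_indec_rep[OF Y]
  have m: "morphism Q X Y f" using f by (simp add: nonzero_morphism_def)
  obtain h where h: "isomorphism Q Y X h" using cls_eqD[OF Y X eq[symmetric]] by (auto simp: isomorphic_def)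
  have mh: "morphism Q Y X h" using h by (simp add: isomorphism_def)
  let ?g = "\<lambda>i x. h i (f i x)"
  obtain i x where i: "i \<in> verts Q" "x \<in> spc X i" "f i x \<noteq> 0" using f by (auto simp: nonzero_morphism_def)
  have "?g i x \<noteq> 0" using isomorphism_eq_zero[OF rY h i(1) morphism_in[OF m i(1,2)]] i(3) by blast
  then have "nonzero_morphism Q X X ?g"
    using morphism_comp[OF m mh] i by (auto simp: nonzero_morphism_def)
  then have g: "isomorphism Q X X ?g" by (rule endomorphism_iso[OF X])
  show ?thesis
  proof (rule isomorphismI[OF rX m])
    fix j x assume j: "j \<in> verts Q" "x \<in> spc X j" "f j x = 0"
    then have "?g j x = 0" using morphism_zero[OF rY mh j(1)] by simp
    then show "x = 0" using isomorphism_eq_zero[OF rX g j(1,2)] by blast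
  next
    fix j assume j: "j \<in> verts Q"
    have bg: "bij_betw (?g j) (spc X j) (spc X j)" and bh: "bij_betw (h j) (spc Y j) (spc X j)"
      using g h j by (auto simp: isomorphism_def)
    show "spc Y j \<subseteq> f j ` spc X j"
    proof
      fix y assume y: "y \<in> spc Y j"
      then have "h j y \<in> ?g j ` spc X j" using bg bh by (auto simp: bij_betw_def)
      then obtain x where x: "x \<in> spc X j" "h j y = h j (f j x)" by blast
      then have "y = f j x" using bh y morphism_in[OF m j x(1)] by (auto simp: bij_betw_def dest: inj_onD)
      then show "y \<in> f j ` spc X j" using x by blast
    qed
  qed
qed

lemma strictly_below:
  fixes X :: "('v, 'a, 'k, 'b::ab_group_add) rep" and Y :: "('v, 'a, 'k, 'c::ab_group_add) rep"
  assumes "fin_indec X" "fin_indec Y" "nonzero_morphism Q X Y f" "\<not> isomorphism Q X Y f"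
  shows "(cls Y, cls X) \<in> LE - Id"
  using LE_step[OF assms] same_class_iso[OF assms(1,2) _ assms(3)] assms(4) by auto

lemma hom_le:
  fixes X :: "('v, 'a, 'k, 'b::ab_group_add) rep" and Y :: "('v, 'a, 'k, 'c::ab_group_add) rep"
  assumes "fin_indec X" "fin_indec Y" "nonzero_morphism Q X Y f"
  shows "(cls Y, cls X) \<in> LE"
proof (cases "isomorphism Q X Y f")
  case True
  then have "cls X = cls Y" using cls_eq[OF assms(1)] by (auto simp: isomorphic_def)
  then show ?thesis using LE_refl[OF cls_in[OF assms(1)]] by simp
qed (use LE_step assms in blast)

section \<open>Finitely many inward arrows\<close>

text \<open>
  Four inward arrows contain the four subspace problem, in which the order fails to be antisymmetric.
  Let \<open>E H\<close> be the configuration of the field with itself as subspace at the arrows in \<open>H\<close> and zero at the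
  others. The configuration \<open>Y\<close> of a plane with the lines spanned by \<open>1\<close>, \<open>1\<close>, \<open>u\<close>, \<open>1 + u\<close> at \<open>a\<close>, \<open>b\<close>, \<open>c\<close>,
  \<open>d\<close> contains \<open>E {a, b}\<close> as the line spanned by \<open>1\<close>, and the quotient by it is \<open>E {c, d}\<close>. It is
  indecomposable because three distinct lines cannot be distributed over two complementary proper
  subspaces of a plane.
\<close>

lemma four_subspaces:
  assumes i: "i \<in> verts Q" and A: "A \<subseteq> inward i" "A = {a, b, c, d}" and dist: "distinct [a, b, c, d]"
  defines "E \<equiv> \<lambda>H. branch_rep A (range (\<lambda>c::'k. [:c:])) (\<lambda>x. if x \<in> H then range (\<lambda>c. [:c:]) else {0})"
  shows "fin_indec (E H)" "(cls (E {c, d}), cls (E {a, b})) \<in> LE"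
proof -
  interpret P: vector_space "smult :: 'k \<Rightarrow> 'k poly \<Rightarrow> 'k poly" by (rule smult_vs)
  let ?C = "range (\<lambda>c::'k. [:c:])"
  define line :: "'k poly \<Rightarrow> 'k poly set" where "line u = range (\<lambda>c. smult c u)" for u
  have line: "P.subspace (line u)" for u unfolding line_def P.span_singleton[symmetric] by (rule P.subspace_span)
  have C_line: "?C = line 1" by (simp add: line_def)
  have zC: "0 \<in> ?C" using P.subspace_0[OF constants(1)] .
  have fE: "fin_indec (E H)" for H
    unfolding E_def fin_indec_def
  proof (intro conjI)
    show "indecomposable Q (branch_rep A ?C (\<lambda>x. if x \<in> H then ?C else {0}))"
      by (rule branch_rep_indecomposable[OF i A(1) constants(1) _ _ constants(3) constants_split])
        (use constants(1) zC in \<open>auto split: if_splits\<close>)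
    show "flei Q (branch_rep A ?C (\<lambda>x. if x \<in> H then ?C else {0}))"
      by (rule branch_rep_flei[OF A(1) constants(1) _ _ constants(2)])
        (use constants(1) A(2) in auto)
  qed
  then show "fin_indec (E H)" .
  \<comment> \<open>two of the three lines \<open>1\<close>, \<open>u\<close>, \<open>1 + u\<close> always span the plane \<open>P\<close>, over any field\<close>
  define u :: "'k poly" where "u = [:0, 1:]"
  define P where "P = P.span {1, u}"
  define L where "L = (\<lambda>x. if x = a \<or> x = b then line 1 else if x = c then line u else line (1 + u))"
  define Y where "Y = branch_rep A P L"
  have sP: "P.subspace P" unfolding P_def by simp
  have u1: "1 \<in> P" "u \<in> P" "1 + u \<in> P"
    unfolding P_def by (simp_all add: P.span_base P.span_add)
  have "P.subspace (L x)" for x using line by (simp add: L_def)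
  moreover have "L x \<subseteq> P" for x
    using P.subspace_scale[OF sP u1(1)] P.subspace_scale[OF sP u1(2)] P.subspace_scale[OF sP u1(3)]
    by (auto simp: L_def line_def)
  ultimately have L: "P.subspace (L x)" "L x \<subseteq> P" for x by blast+
  have in_line: "v \<in> line v" for v by (auto simp: line_def intro: range_eqI[of _ _ 1])
  have Lu: "1 \<in> L a" "u \<in> L c" "1 + u \<in> L d" using dist in_line by (auto simp: L_def)
  have Ll: "L a = line 1" "L c = line u" "L d = line (1 + u)" using dist by (auto simp: L_def)
  have nz: "P \<noteq> {0}" using u1(1) by force
  have indY: "indecomposable Q Y"
    unfolding Y_def
  proof (rule branch_rep_indecomposable[OF i A(1) sP L nz])
    fix X Z assume X: "P.subspace X" and Z: "P.subspace Z" and PXZ: "P = {x + y | x y. x \<in> X \<and> y \<in> Z}"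
      and disj: "X \<inter> Z = {0}"
      and split: "\<And>a l. a \<in> A \<Longrightarrow> l \<in> L a \<Longrightarrow> \<exists>x\<in>X \<inter> L a. \<exists>y\<in>Z \<inter> L a. l = x + y"
    \<comment> \<open>a generator of a line that splits lies in one of the two summands\<close>
    have gen: "v \<in> X \<or> v \<in> Z" if x: "x \<in> A" "L x = line v" for v x
    proof -
      obtain y z where yz: "y \<in> X \<inter> line v" "z \<in> Z \<inter> line v" "v = y + z"
        using split[OF x(1), of v] x(2) in_line by auto
      obtain s where s: "y = smult s v" using yz(1) by (auto simp: line_def)
      show ?thesis
      proof (cases "s = 0")
        case True
        then have "y = 0" using s by simp
        then have "v = z" using yz(3) by simp
        then show ?thesis using yz(2) by blast
      next
        case False
        then have "smult (1 / s) y = v" using s by simp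
        moreover have "smult (1 / s) y \<in> X" using P.subspace_scale[OF X] yz(1) by blast
        ultimately show ?thesis by simp
      qed
    qed
    have three: "1 \<in> X \<or> 1 \<in> Z" "u \<in> X \<or> u \<in> Z" "1 + u \<in> X \<or> 1 + u \<in> Z"
      using gen[of a 1] gen[of c u] gen[of d "1 + u"] A(2) Ll by auto
    have two: "P \<subseteq> M" if M: "P.subspace M" and mem: "1 \<in> M \<and> u \<in> M \<or> 1 \<in> M \<and> 1 + u \<in> M \<or> u \<in> M \<and> 1 + u \<in> M" for M
    proof -
      have "1 \<in> M \<and> u \<in> M"
        using mem P.subspace_diff[OF M, of "1 + u" 1] P.subspace_diff[OF M, of "1 + u" u] by auto
      then show ?thesis unfolding P_def using P.span_minimal[OF _ M, of "{1, u}"] by simp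
    qed
    have "0 \<in> X" "0 \<in> Z" using P.subspace_0 X Z by auto
    then have XP: "X \<subseteq> P" "Z \<subseteq> P" unfolding PXZ by force+
    have "P \<subseteq> X \<or> P \<subseteq> Z" using two[OF X] two[OF Z] three by argo
    then have "X \<inter> Z = Z \<or> X \<inter> Z = X" using XP by auto
    then show "X = {0} \<or> Z = {0}" using disj by auto
  qed
  have fdP: "fin_dim smult P" unfolding fin_dim_def P_def by (intro exI[of _ "{1, u}"]) simp
  have fY: "fin_indec Y"
    using indY branch_rep_flei[OF A(1) sP L(1) _ fdP] A(2) by (simp add: fin_indec_def Y_def)
  have it: "i \<in> trunk i A" by (simp add: trunk_def)
  have Ei: "spc (E H) i = ?C" for H unfolding E_def using branch_rep_trunk[OF A(1) it] .
  have Yi: "spc Y i = P" unfolding Y_def using branch_rep_trunk[OF A(1) it] .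
  have C1: "1 \<in> ?C" by (simp add: one_pCons)
  have CP: "?C \<subseteq> P" using P.subspace_scale[OF sP u1(1)] unfolding C_line by (auto simp: line_def)
  have inc: "morphism Q (E {a, b}) Y (\<lambda>q p. p)"
    unfolding E_def Y_def
    by (rule branch_rep_morphism) (use CP P.subspace_0[OF line] C_line in \<open>auto simp: L_def\<close>)
  have "nonzero_morphism Q (E {a, b}) Y (\<lambda>q p. p)"
    unfolding nonzero_morphism_def using inc i Ei C1 by (intro conjI bexI[of _ i] bexI[of _ 1]) auto
  moreover have "\<not> isomorphism Q (E {a, b}) Y (\<lambda>q p. p)"
  proof
    assume "isomorphism Q (E {a, b}) Y (\<lambda>q p. p)"
    then have "?C = P" using i Ei Yi by (auto simp: isomorphism_def bij_betw_def)
    then show False using u1(2) by (auto simp: u_def)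
  qed
  ultimately have 1: "(cls Y, cls (E {a, b})) \<in> LE" using LE_step[OF fE fY] by blast
  let ?f = "\<lambda>p::'k poly. [:coeff p 1:]"
  have quo: "morphism Q Y (E {c, d}) (\<lambda>q. ?f)"
    unfolding E_def Y_def
    by (rule branch_rep_morphism) (use A(2) dist in \<open>auto simp: L_def line_def\<close>)
  have "?f u = 1" by (simp add: u_def one_pCons)
  then have "nonzero_morphism Q Y (E {c, d}) (\<lambda>q. ?f)"
    unfolding nonzero_morphism_def using quo i Yi u1(2) by (intro conjI bexI[of _ i] bexI[of _ u]) auto
  moreover have "\<not> isomorphism Q Y (E {c, d}) (\<lambda>q. ?f)"
  proof
    assume "isomorphism Q Y (E {c, d}) (\<lambda>q. ?f)"
    from isomorphism_eq_zero[OF fin_indec_rep[OF fY] this i, of 1] show False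
      using u1(1) Yi by simp
  qed
  ultimately have 2: "(cls (E {c, d}), cls Y) \<in> LE" using LE_step[OF fY fE] by blast
  show "(cls (E {c, d}), cls (E {a, b})) \<in> LE" using LE_trans[OF 2 1] .
qed

text \<open>
  By symmetry, \<open>four_subspaces\<close> puts the two representations with subspaces at \<open>a\<close>, \<open>b\<close> and at \<open>c\<close>, \<open>d\<close> below
  each other. By antisymmetry they are isomorphic, but the first is nonzero at the tail of \<open>a\<close> and the
  second is zero there.
\<close>

lemma finite_inward:
  assumes i: "i \<in> verts Q"
  shows "finite (inward i)"
proof (rule ccontr)
  assume "infinite (inward i)"
  then obtain A where A: "A \<subseteq> inward i" "card A = 4" "finite A"
    using infinite_arbitrarily_large by blast
  obtain xs where xs: "set xs = A" "distinct xs" using finite_distinct_list[OF A(3)] by blast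
  then have "length xs = 4" using A(2) distinct_card by metis
  then obtain a b c d where abcd: "xs = [a, b, c, d]"
    by (auto simp: numeral_eq_Suc length_Suc_conv)
  let ?E = "\<lambda>H. branch_rep A (range (\<lambda>c::'k. [:c:])) (\<lambda>x. if x \<in> H then range (\<lambda>c. [:c:]) else {0})"
  have A': "A = {a, b, c, d}" "A = {c, d, a, b}" and d: "distinct [a, b, c, d]" "distinct [c, d, a, b]"
    using xs abcd by auto
  note 1 = four_subspaces[OF i A(1) A'(1) d(1)] and 2 = four_subspaces[OF i A(1) A'(2) d(2)]
  have "cls (?E {c, d}) = cls (?E {a, b})" by (rule LE_antisym[OF 1(2) 2(2)])
  then obtain \<phi> where \<phi>: "isomorphism Q (?E {a, b}) (?E {c, d}) \<phi>"
    using cls_eqD[OF 1(1) 1(1)] by (metis isomorphic_def)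
  have a: "a \<in> A" "a \<in> arcs Q" using A'(1) A(1) by (auto simp: inward_def)
  have zC: "(0::'k poly) \<in> range (\<lambda>c. [:c:])" by (metis pCons_0_0 rangeI)
  have ta: "spc (?E H) (tail Q a) = (if a \<in> H then range (\<lambda>c. [:c:]) else {0})" for H
    by (rule branch_rep_tail[OF A(1) a(1)]) (use zC in auto)
  have "(1::'k poly) \<in> spc (?E {a, b}) (tail Q a)" unfolding ta by (simp add: one_pCons)
  moreover from this have "\<phi> (tail Q a) 1 \<in> spc (?E {c, d}) (tail Q a)"
    using \<phi> a(2) morphism_in by (metis isomorphism_def tail_in)
  then have "\<phi> (tail Q a) 1 = 0" unfolding ta using d by auto
  ultimately have "(1::'k poly) = 0"
    using isomorphism_eq_zero[OF fin_indec_rep[OF 1(1)] \<phi> tail_in[OF a(2)]] by blast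
  then show False by simp
qed

section \<open>Resolving vectors in kernels\<close>

text \<open>
  The kernel of \<open>f\<close> need not be FLEI, but the vector \<open>s\<close> in it lies in the image \<open>L\<close> of a free
  representation \<open>path_rep j\<close>, which is FLEI by \<open>finite_inward\<close>. Therefore \<open>f\<close> factors through the FLEI
  quotient \<open>S / L\<close>, in which \<open>s\<close> becomes zero, and hence through a finite sum of indecomposable FLEI
  representations.
\<close>

lemma resolution:
  fixes S :: "('v, 'a, 'k, 'b::ab_group_add) rep" and V :: "('v, 'a, 'k, 'c::ab_group_add) rep"
  assumes S: "quiver_rep Q S" "flei Q S" and V: "quiver_rep Q V" and f: "morphism Q S V f"
    and j: "j \<in> verts Q" "s \<in> spc S j" "f j s = 0"
  obtains D :: "('v \<Rightarrow> 'b set) set" and W :: "('v \<Rightarrow> 'b set) \<Rightarrow> ('v, 'a, 'k, 'b) rep" and \<pi>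
  where "finite D" "\<And>t. t \<in> D \<Longrightarrow> fin_indec (W t)" "\<And>t. t \<in> D \<Longrightarrow> morphism Q S (W t) (\<pi> t)"
    "\<And>t i. t \<in> D \<Longrightarrow> i \<in> verts Q \<Longrightarrow> spc (W t) i \<subseteq> \<pi> t i ` spc S i"
    "\<And>t. t \<in> D \<Longrightarrow> \<pi> t j s = 0"
    "\<And>t. t \<in> D \<Longrightarrow> morphism Q (W t) V f"
    "\<And>i x. i \<in> verts Q \<Longrightarrow> x \<in> spc S i \<Longrightarrow> f i x = (\<Sum>t\<in>D. f i (\<pi> t i x))"
proof -
  let ?K = "\<lambda>i. {x \<in> spc S i. f i x = 0}"
  have K: "subrep Q S ?K" by (rule subrep_kernel[OF S(1) V f])
  obtain \<phi> where \<phi>: "morphism Q (path_rep j) (restr S ?K) \<phi>"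
    "1 \<in> spc (path_rep j :: ('v, 'a, 'k, 'k poly) rep) j" "\<phi> j 1 = s"
    using path_rep_hits[OF quiver_rep_restr[OF S(1) K] j(1), of s] j by auto
  let ?P = "path_rep j :: ('v, 'a, 'k, 'k poly) rep"
  have P: "quiver_rep Q ?P" "flei Q ?P"
    using path_rep_indecomposable[OF j(1)] path_rep_flei[OF finite_inward[OF j(1)]]
    by (auto simp: indecomposable_def)
  have m: "morphism Q ?P S \<phi>" by (rule morphism_into_subrep[OF \<phi>(1) K])
  let ?L = "\<lambda>i. \<phi> i ` spc ?P i"
  have L: "subrep Q S ?L" "flei Q (restr S ?L)"
    using subrep_image[OF P(1) S(1) m] flei_image[OF P(1) S(1) P(2) S(2) m] by auto
  have fL: "f i x = 0" if "i \<in> verts Q" "x \<in> ?L i" for i x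
    using morphism_in[OF \<phi>(1) that(1)] that(2) by auto
  have sL: "s \<in> ?L j" using \<phi>(2,3) by blast
  obtain D :: "('v \<Rightarrow> 'b set) set" and W :: "('v \<Rightarrow> 'b set) \<Rightarrow> ('v, 'a, 'k, 'b) rep" and \<pi>
    where D: "finite D" "\<And>t. t \<in> D \<Longrightarrow> indecomposable Q (W t)" "\<And>t. t \<in> D \<Longrightarrow> flei Q (W t)"
    "\<And>t. t \<in> D \<Longrightarrow> morphism Q S (W t) (\<pi> t)"
    "\<And>t i. t \<in> D \<Longrightarrow> i \<in> verts Q \<Longrightarrow> spc (W t) i \<subseteq> \<pi> t i ` spc S i"
    "\<And>t i x. t \<in> D \<Longrightarrow> i \<in> verts Q \<Longrightarrow> x \<in> ?L i \<Longrightarrow> \<pi> t i x = 0"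
    "\<And>i x. i \<in> verts Q \<Longrightarrow> x \<in> spc S i \<Longrightarrow> x - (\<Sum>t\<in>D. \<pi> t i x) \<in> ?L i"
    "\<And>t. t \<in> D \<Longrightarrow> scal (W t) = scal S" "\<And>t i. t \<in> D \<Longrightarrow> i \<in> verts Q \<Longrightarrow> spc (W t) i \<subseteq> spc S i"
    "\<And>t a x. t \<in> D \<Longrightarrow> a \<in> arcs Q \<Longrightarrow> x \<in> spc (W t) (tail Q a) \<Longrightarrow> mor S a x - mor (W t) a x \<in> ?L (head Q a)"
    by (rule flei_quotient_splits[OF S L]) blast
  have fi: "fin_indec (W t)" if "t \<in> D" for t using D(2,3)[OF that] by (simp add: fin_indec_def)
  show ?thesis
  proof (rule that[of D W \<pi>])
    fix t assume t: "t \<in> D"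
    show "\<pi> t j s = 0" by (rule D(6)[OF t j(1) sL])
    show "morphism Q (W t) V f"
      by (rule quotient_factor[OF S(1) f fL fin_indec_rep[OF fi[OF t]] D(8)[OF t] D(9)[OF t] D(10)[OF t]])
  next
    fix i x assume i: "i \<in> verts Q" and x: "x \<in> spc S i"
    have \<pi>S: "\<pi> t i x \<in> spc S i" if "t \<in> D" for t
      using morphism_in[OF D(4)[OF that] i x] D(9)[OF that i] by blast
    have "f i x - f i (\<Sum>t\<in>D. \<pi> t i x) = f i (x - (\<Sum>t\<in>D. \<pi> t i x))"
      by (rule morphism_diff[OF S(1) f i x, symmetric]) (rule rep_sum[OF S(1) i \<pi>S])
    also have "\<dots> = 0" by (rule fL[OF i D(7)[OF i x]])
    finally show "f i x = (\<Sum>t\<in>D. f i (\<pi> t i x))"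
      using morphism_sum_arg[OF S(1) f i \<pi>S] by simp
  qed (use D fi in auto)
qed

section \<open>The filtration\<close>

definition below :: "('v, 'a, 'k, 'b::ab_group_add) rep \<Rightarrow> ('v, 'a, 'k) rep_class set \<Rightarrow> ('v \<Rightarrow> 'b set) set" where
  "below V \<Gamma> = {X. subrep Q V X \<and> fin_indec (restr V X) \<and> cls (restr V X) \<in> \<Gamma>}"

lemma belowD: "X \<in> below V \<Gamma> \<Longrightarrow> subrep Q V X" "X \<in> below V \<Gamma> \<Longrightarrow> fin_indec (restr V X)"
  "X \<in> below V \<Gamma> \<Longrightarrow> cls (restr V X) \<in> \<Gamma>"
  by (auto simp: below_def)

context
  fixes V :: "('v, 'a, 'k, 'b::ab_group_add) rep"
  assumes V: "quiver_rep Q V"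
begin

interpretation V: vector_space "scal V" by (rule rep_vs[OF V])

lemma F_eq: "F Q V \<beta> i = V.span (\<Union>X\<in>below V {\<alpha>. (\<alpha>, \<beta>) \<in> LE}. X i)"
proof -
  have "{X. subrep Q V X \<and> (\<exists>\<alpha>. (\<alpha>, \<beta>) \<in> indec_le Q \<and> belongs Q (restr V X) \<alpha>)} = below V {\<alpha>. (\<alpha>, \<beta>) \<in> LE}"
    using LE_in belongs_iff[OF quiver_rep_restr[OF V]] unfolding below_def LE by blast
  then show ?thesis by (simp add: F_def)
qed

lemma F_less_eq: "F_less Q V \<beta> i = V.span (\<Union>X\<in>below V {\<alpha>. (\<alpha>, \<beta>) \<in> LE - Id}. X i)"
proof
  have lt: "(\<gamma>, \<beta>) \<in> LE - Id" if "(\<gamma>, \<alpha>) \<in> LE" "(\<alpha>, \<beta>) \<in> LE - Id" for \<gamma> \<alpha>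
    using that LE_trans[of \<gamma> \<alpha> \<beta>] LE_antisym by blast
  have "F Q V \<alpha> i \<subseteq> V.span (\<Union>X\<in>below V {\<alpha>. (\<alpha>, \<beta>) \<in> LE - Id}. X i)" if "(\<alpha>, \<beta>) \<in> LE - Id" for \<alpha>
    unfolding F_eq using lt that by (intro V.span_mono) (auto simp: below_def)
  then show "F_less Q V \<beta> i \<subseteq> V.span (\<Union>X\<in>below V {\<alpha>. (\<alpha>, \<beta>) \<in> LE - Id}. X i)"
    unfolding F_less_def LE[symmetric] by (intro V.span_minimal) auto
  have sub: "X i \<subseteq> F Q V (cls (restr V X)) i" if "X \<in> below V {\<alpha>. (\<alpha>, \<beta>) \<in> LE - Id}" for X
  proof -
    have "X \<in> below V {\<alpha>. (\<alpha>, cls (restr V X)) \<in> LE}"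
      using that LE_refl[OF cls_in[OF belowD(2)[OF that]]] by (simp add: below_def)
    then have "X i \<subseteq> (\<Union>Y\<in>below V {\<alpha>. (\<alpha>, cls (restr V X)) \<in> LE}. Y i)" by blast
    also have "\<dots> \<subseteq> F Q V (cls (restr V X)) i" unfolding F_eq by (rule V.span_superset)
    finally show ?thesis .
  qed
  show "V.span (\<Union>X\<in>below V {\<alpha>. (\<alpha>, \<beta>) \<in> LE - Id}. X i) \<subseteq> F_less Q V \<beta> i"
    unfolding F_less_def LE[symmetric]
  proof (intro V.span_mono UN_least)
    fix X assume X: "X \<in> below V {\<alpha>. (\<alpha>, \<beta>) \<in> LE - Id}"
    have "F Q V (cls (restr V X)) i \<subseteq> (\<Union>\<alpha>\<in>{\<alpha>. (\<alpha>, \<beta>) \<in> LE - Id}. F Q V \<alpha> i)"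
      using belowD(3)[OF X] by (rule UN_upper)
    with sub[OF X] show "X i \<subseteq> (\<Union>\<alpha>\<in>{\<alpha>. (\<alpha>, \<beta>) \<in> LE - Id}. F Q V \<alpha> i)" by (rule order_trans)
  qed
qed

lemma F_subspace: "V.subspace (F Q V \<beta> i)" "V.subspace (F_less Q V \<beta> i)"
  unfolding F_eq F_less_eq by simp_all

lemma F_mono: "(\<alpha>, \<beta>) \<in> LE - Id \<Longrightarrow> F Q V \<alpha> i \<subseteq> F_less Q V \<beta> i"
  unfolding F_less_def LE[symmetric] by (rule order_trans[OF _ V.span_superset]) blast

lemma F_less_subset: "F_less Q V \<beta> i \<subseteq> F Q V \<beta> i"
  unfolding F_eq F_less_eq by (intro V.span_mono UN_mono) (auto simp: below_def)

lemma subrep_in_F: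
  assumes "subrep Q V X" "fin_indec (restr V X)"
  shows "X i \<subseteq> F Q V (cls (restr V X)) i"
proof -
  have "X \<in> below V {\<alpha>. (\<alpha>, cls (restr V X)) \<in> LE}"
    using assms LE_refl[OF cls_in[OF assms(2)]] by (simp add: below_def)
  then have "X i \<subseteq> (\<Union>Y\<in>below V {\<alpha>. (\<alpha>, cls (restr V X)) \<in> LE}. Y i)" by blast
  also have "\<dots> \<subseteq> F Q V (cls (restr V X)) i" unfolding F_eq by (rule V.span_superset)
  finally show ?thesis .
qed

text \<open>
  If \<open>f\<close> is injective, then its image is isomorphic to \<open>X\<close>. Otherwise a kernel vector is resolved: \<open>f\<close>
  factors through representations \<open>W t\<close> onto which \<open>X\<close> maps with a kernel, so that their classes are
  strictly smaller, and well-founded induction applies to the maps \<open>W t \<rightarrow> V\<close>.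
\<close>

lemma image_in_F:
  fixes X :: "('v, 'a, 'k, 'c::ab_group_add) rep"
  assumes "fin_indec X" "morphism Q X V f"
  shows "\<forall>i\<in>verts Q. f i ` spc X i \<subseteq> F Q V (cls X) i"
    and "j \<in> verts Q \<Longrightarrow> x \<in> spc X j \<Longrightarrow> x \<noteq> 0 \<Longrightarrow> f j x = 0 \<Longrightarrow> \<forall>i\<in>verts Q. f i ` spc X i \<subseteq> F_less Q V (cls X) i"
proof -
  have main: "(\<forall>i\<in>verts Q. f i ` spc X i \<subseteq> F Q V (cls X) i) \<and>
      ((\<exists>j\<in>verts Q. \<exists>x\<in>spc X j. x \<noteq> 0 \<and> f j x = 0) \<longrightarrow> (\<forall>i\<in>verts Q. f i ` spc X i \<subseteq> F_less Q V (cls X) i))"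
    if "\<beta> \<in> indec_flei Q" "\<beta> = cls X" "fin_indec X" "morphism Q X V f" for \<beta> X
      and f :: "'v \<Rightarrow> 'c \<Rightarrow> 'b"
    using wfo that(2,3,4)
  proof (induction \<beta> arbitrary: X rule: wf_on_induct)
    case in_set
    show ?case by (rule that(1))
  next
    case (less \<beta>)
    note X = less.prems(2) and f = less.prems(3) and rX = fin_indec_rep[OF less.prems(2)]
    have less': "\<forall>i\<in>verts Q. f i ` spc X i \<subseteq> F_less Q V (cls X) i"
      if j: "j \<in> verts Q" "x \<in> spc X j" "f j x = 0" and nz: "x \<noteq> 0" for j x
    proof -
      obtain D :: "('v \<Rightarrow> 'c set) set" and W :: "('v \<Rightarrow> 'c set) \<Rightarrow> ('v, 'a, 'k, 'c) rep" and \<pi>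
        where D: "finite D" "\<And>t. t \<in> D \<Longrightarrow> fin_indec (W t)" "\<And>t. t \<in> D \<Longrightarrow> morphism Q X (W t) (\<pi> t)"
        "\<And>t i. t \<in> D \<Longrightarrow> i \<in> verts Q \<Longrightarrow> spc (W t) i \<subseteq> \<pi> t i ` spc X i"
        "\<And>t. t \<in> D \<Longrightarrow> \<pi> t j x = 0"
        "\<And>t. t \<in> D \<Longrightarrow> morphism Q (W t) V f"
        "\<And>i x. i \<in> verts Q \<Longrightarrow> x \<in> spc X i \<Longrightarrow> f i x = (\<Sum>t\<in>D. f i (\<pi> t i x))"
        by (rule resolution[OF rX fin_indec_flei[OF X] V f j]) blast
      have lt: "(cls (W t), cls X) \<in> LE - Id" if t: "t \<in> D" for t
      proof (rule strictly_below[OF X D(2)[OF t]])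
        obtain i w where "i \<in> verts Q" "w \<in> spc (W t) i" "w \<noteq> 0" using fin_indec_vector[OF D(2)[OF t]] .
        then show "nonzero_morphism Q X (W t) (\<pi> t)"
          using D(3,4)[OF t] unfolding nonzero_morphism_def by blast
        show "\<not> isomorphism Q X (W t) (\<pi> t)"
          using isomorphism_eq_zero[of X "W t" "\<pi> t" j x] rX j(1,2) D(5)[OF t] nz by blast
      qed
      have "f i w \<in> F_less Q V (cls X) i" if t: "t \<in> D" and i: "i \<in> verts Q" "w \<in> spc (W t) i" for t i w
      proof -
        have "f i w \<in> F Q V (cls (W t)) i"
          using less.IH[OF cls_in[OF D(2)[OF t]] _ refl D(2)[OF t] D(6)[OF t]] lt[OF t] less.prems(1) i by blast
        then show ?thesis using F_mono[OF lt[OF t]] by blast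
      qed
      then have "(\<Sum>t\<in>D. f i (\<pi> t i y)) \<in> F_less Q V (cls X) i" if "i \<in> verts Q" "y \<in> spc X i" for i y
        using morphism_in[OF D(3) that] that by (intro V.subspace_sum[OF F_subspace(2)]) blast
      then show ?thesis using D(7) by auto
    qed
    have "f i ` spc X i \<subseteq> F Q V (cls X) i" if i: "i \<in> verts Q" for i
    proof (cases "\<exists>j\<in>verts Q. \<exists>x\<in>spc X j. x \<noteq> 0 \<and> f j x = 0")
      case True
      then show ?thesis using less' i F_less_subset by blast
    next
      case False
      let ?I = "\<lambda>i. f i ` spc X i"
      have I: "subrep Q V ?I" by (rule subrep_image[OF rX V f])
      have "isomorphism Q X (restr V ?I) f"
      proof (rule isomorphismI[OF rX])
        show "morphism Q X (restr V ?I) f" by (rule morphism_restr_cod[OF f]) simp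
      qed (use False in auto)
      then have iso: "isomorphic Q X (restr V ?I)" by (auto simp: isomorphic_def)
      show ?thesis
        using subrep_in_F[OF I fin_indec_isomorphic[OF quiver_rep_restr[OF V I] iso X], of i] cls_eq[OF X iso] by simp
    qed
    then show ?case using less' by blast
  qed
  show "\<forall>i\<in>verts Q. f i ` spc X i \<subseteq> F Q V (cls X) i" using main[OF cls_in[OF assms(1)] refl assms] by blast
  show "j \<in> verts Q \<Longrightarrow> x \<in> spc X j \<Longrightarrow> x \<noteq> 0 \<Longrightarrow> f j x = 0 \<Longrightarrow> \<forall>i\<in>verts Q. f i ` spc X i \<subseteq> F_less Q V (cls X) i"
    using main[OF cls_in[OF assms(1)] refl assms] by blast
qed

end

end

section \<open>Relations between subrepresentations of maximal class\<close>

lemma sum_fun_apply: "(\<Sum>k\<in>K. g k) y = (\<Sum>k\<in>K. g k y)"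
  by (induction K rule: infinite_finite_induct) (simp_all add: plus_fun_def zero_fun_def)

context rep_quiver
begin

lemma morphism_minus:
  fixes V :: "('v, 'a, 'k::field, 'b::ab_group_add) rep" and W :: "('v, 'a, 'k, 'c::ab_group_add) rep"
  assumes "quiver_rep Q W" "morphism Q V W \<phi>" "morphism Q V W \<psi>"
  shows "morphism Q V W (\<lambda>i x. \<phi> i x - \<psi> i x)"
  using morphism_plus[OF assms(1,2) morphism_uminus[OF assms(1,3)]] by simp

text \<open>
  A homogeneous linear system over a division ring, with morphisms in place of scalars: if a matrix of
  maps \<open>X k \<rightarrow> W t\<close> kills a nonzero vector at some vertex, then it kills a nonzero column of maps
  \<open>X0 \<rightarrow> X k\<close>. The proof is Gaussian elimination. It produces new matrix entries, and so every nonzero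
  morphism \<open>X k \<rightarrow> W t\<close> is required to be an isomorphism. If the column of the unknown \<open>k\<close>
  contains an isomorphism \<open>a s k\<close>, then row \<open>s\<close> expresses \<open>k\<close> through the other unknowns; otherwise \<open>k\<close> is a free
  unknown.
\<close>

lemma homogeneous_system:
  fixes X0 :: "('v, 'a, 'k::field, 'b::ab_group_add) rep" and X :: "'i \<Rightarrow> ('v, 'a, 'k, 'b) rep"
    and W :: "'t \<Rightarrow> ('v, 'a, 'k, 'c::ab_group_add) rep"
  assumes fin: "finite I" and X0: "quiver_rep Q X0"
    and nz: "i0 \<in> verts Q" "z0 \<in> spc X0 i0" "z0 \<noteq> 0"
    and W: "\<And>t. t \<in> T \<Longrightarrow> quiver_rep Q (W t)" and j: "j \<in> verts Q"
    and "\<And>k. k \<in> I \<Longrightarrow> quiver_rep Q (X k)" "\<And>k. k \<in> I \<Longrightarrow> isomorphic Q X0 (X k)"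
    and "\<And>k t f. k \<in> I \<Longrightarrow> t \<in> T \<Longrightarrow> nonzero_morphism Q (X k) (W t) f \<Longrightarrow> isomorphism Q (X k) (W t) f"
    and "\<And>t k. t \<in> T \<Longrightarrow> k \<in> I \<Longrightarrow> morphism Q (X k) (W t) (a t k)"
    and "\<And>k. k \<in> I \<Longrightarrow> x k \<in> spc (X k) j" "\<exists>k\<in>I. x k \<noteq> 0"
    and "\<And>t. t \<in> T \<Longrightarrow> (\<Sum>k\<in>I. a t k j (x k)) = 0"
  shows "\<exists>c. (\<forall>k\<in>I. morphism Q X0 (X k) (c k)) \<and> (\<exists>k\<in>I. nonzero_morphism Q X0 (X k) (c k)) \<and>
    (\<forall>t\<in>T. \<forall>i\<in>verts Q. \<forall>z\<in>spc X0 i. (\<Sum>k\<in>I. a t k i (c k i z)) = 0)"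
  using fin assms(8-14)
proof (induction I arbitrary: a rule: finite_induct)
  case (insert k I)
  note X = insert.prems(1) and iso = insert.prems(2) and simple = insert.prems(3) and a = insert.prems(4)
    and x = insert.prems(5) and xnz = insert.prems(6) and ker = insert.prems(7)
  show ?case
  proof (cases "\<exists>s\<in>T. nonzero_morphism Q (X k) (W s) (a s k)")
    case True
    then obtain s where s: "s \<in> T" "nonzero_morphism Q (X k) (W s) (a s k)" by blast
    have ask: "isomorphism Q (X k) (W s) (a s k)" using simple s by blast
    have Xk: "quiver_rep Q (X k)" using X by simp
    let ?b = "\<lambda>i. inv_into (spc (X k) i) (a s k i)"
    have b: "isomorphism Q (W s) (X k) ?b" by (rule isomorphism_inv[OF Xk ask])
    then have mb: "morphism Q (W s) (X k) ?b" by (simp add: isomorphism_def)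
    have ba: "?b i (a s k i y) = y" if "i \<in> verts Q" "y \<in> spc (X k) i" for i y
      using ask that by (auto simp: isomorphism_def bij_betw_inv_into_left)
    \<comment> \<open>the matrix after elimination of the unknown \<open>k\<close> by row \<open>s\<close>\<close>
    let ?a = "\<lambda>t l i z. a t l i z - a t k i (?b i (a s l i z))"
    have ma: "morphism Q (X l) (W t) (?a t l)" if "t \<in> T" "l \<in> I" for t l
      using morphism_minus[OF W[OF that(1)] a[OF that(1)] morphism_comp[OF morphism_comp[OF a[OF s(1)] mb] a[OF that(1)]]] that by blast
    have eqn: "(\<Sum>l\<in>I. ?a t l i (y l)) = (\<Sum>l\<in>I. a t l i (y l)) - a t k i (?b i (\<Sum>l\<in>I. a s l i (y l)))"
      if t: "t \<in> T" and i: "i \<in> verts Q" and y: "\<And>l. l \<in> I \<Longrightarrow> y l \<in> spc (X l) i" for t i y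
    proof -
      have 1: "a s l i (y l) \<in> spc (W s) i" if "l \<in> I" for l
        using morphism_in[OF a[OF s(1)] i y[OF that]] that by blast
      then have "?b i (\<Sum>l\<in>I. a s l i (y l)) = (\<Sum>l\<in>I. ?b i (a s l i (y l)))"
        by (intro morphism_sum_arg[OF W[OF s(1)] mb i])
      moreover have "a t k i (\<Sum>l\<in>I. ?b i (a s l i (y l))) = (\<Sum>l\<in>I. a t k i (?b i (a s l i (y l))))"
        using morphism_in[OF mb i 1] by (intro morphism_sum_arg[OF Xk a[OF t] i]) auto
      ultimately show ?thesis by (simp add: sum_subtractf)
    qed
    have "\<exists>c. (\<forall>k\<in>I. morphism Q X0 (X k) (c k)) \<and> (\<exists>k\<in>I. nonzero_morphism Q X0 (X k) (c k)) \<and>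
      (\<forall>t\<in>T. \<forall>i\<in>verts Q. \<forall>z\<in>spc X0 i. (\<Sum>k\<in>I. ?a t k i (c k i z)) = 0)"
    proof (rule insert.IH)
      have sumk: "a t k j (x k) + (\<Sum>l\<in>I. a t l j (x l)) = 0" if "t \<in> T" for t
        using ker[OF that] insert.hyps by simp
      show "\<exists>l\<in>I. x l \<noteq> 0"
      proof (rule ccontr)
        assume "\<not> (\<exists>l\<in>I. x l \<noteq> 0)"
        then have xI: "x l = 0" if "l \<in> I" for l using that by blast
        have "a s l j (x l) = 0" if "l \<in> I" for l
          using xI[OF that] morphism_zero[OF X a[OF s(1)] j, of l] that by simp
        then have "a s k j (x k) = 0" using sumk[OF s(1)] by simp
        then have "x k = 0" using isomorphism_eq_zero[OF Xk ask j] x by simp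
        then show False using xnz xI by auto
      qed
      fix t assume t: "t \<in> T"
      have "(\<Sum>l\<in>I. a s l j (x l)) = - a s k j (x k)" using sumk[OF s(1)] by (simp add: eq_neg_iff_add_eq_0 add.commute)
      then have "?b j (\<Sum>l\<in>I. a s l j (x l)) = ?b j (0 - a s k j (x k))" by simp
      also have "\<dots> = ?b j 0 - ?b j (a s k j (x k))"
        by (rule morphism_diff[OF W[OF s(1)] mb j rep_zero[OF W[OF s(1)] j]])
          (use morphism_in[OF a[OF s(1)] j] x in auto)
      also have "\<dots> = 0 - x k" using ba[OF j] x morphism_zero[OF W[OF s(1)] mb j] by simp
      finally have "a t k j (?b j (\<Sum>l\<in>I. a s l j (x l))) = a t k j 0 - a t k j (x k)"
        using morphism_diff[OF Xk a[OF t] j rep_zero[OF Xk j], of "x k"] x by simp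
      also have "\<dots> = - a t k j (x k)" using morphism_zero[OF Xk a[OF t] j] by simp
      finally show "(\<Sum>l\<in>I. ?a t l j (x l)) = 0" using eqn[OF t j, of x] x sumk[OF t] by (simp add: add.commute)
    qed (use X iso simple x ma in auto)
    then obtain c where c: "\<And>l. l \<in> I \<Longrightarrow> morphism Q X0 (X l) (c l)"
      "\<exists>l\<in>I. nonzero_morphism Q X0 (X l) (c l)"
      "\<And>t i z. t \<in> T \<Longrightarrow> i \<in> verts Q \<Longrightarrow> z \<in> spc X0 i \<Longrightarrow> (\<Sum>l\<in>I. ?a t l i (c l i z)) = 0" by blast
    let ?c = "\<lambda>i z. - ?b i (\<Sum>l\<in>I. a s l i (c l i z))"
    have "morphism Q X0 (W s) (\<lambda>i z. \<Sum>l\<in>I. a s l i (c l i z))"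
      using morphism_comp[OF c(1) a[OF s(1)]] by (intro morphism_sum[OF W[OF s(1)]]) blast
    then have mc: "morphism Q X0 (X k) ?c" by (intro morphism_uminus[OF Xk] morphism_comp[OF _ mb])
    define c' where "c' = c(k := ?c)"
    have c'I: "c' l = c l" if "l \<in> I" for l using that insert.hyps by (auto simp: c'_def)
    have "(\<Sum>l\<in>insert k I. a t l i (c' l i z)) = 0" if t: "t \<in> T" and i: "i \<in> verts Q" and z: "z \<in> spc X0 i" for t i z
    proof -
      have cz: "c l i z \<in> spc (X l) i" if "l \<in> I" for l using morphism_in[OF c(1)[OF that] i z] .
      have "(\<Sum>l\<in>I. a s l i (c l i z)) \<in> spc (W s) i"
        using morphism_in[OF a[OF s(1)] i cz] by (intro rep_sum[OF W[OF s(1)] i]) blast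
      then have bz: "?b i (\<Sum>l\<in>I. a s l i (c l i z)) \<in> spc (X k) i" using morphism_in[OF mb i] by blast
      have "a t k i (?c i z) = a t k i (0 - ?b i (\<Sum>l\<in>I. a s l i (c l i z)))" by simp
      also have "\<dots> = - a t k i (?b i (\<Sum>l\<in>I. a s l i (c l i z)))"
        using morphism_diff[OF Xk a[OF t] i rep_zero[OF Xk i] bz] morphism_zero[OF Xk a[OF t] i] by simp
      finally have "(\<Sum>l\<in>insert k I. a t l i (c' l i z)) = (\<Sum>l\<in>I. ?a t l i (c l i z))"
        using insert.hyps eqn[OF t i cz] c'I by (simp add: c'_def)
      then show ?thesis using c(3)[OF t i z] by simp
    qed
    moreover have "morphism Q X0 (X l) (c' l)" if "l \<in> insert k I" for l
      using that mc c(1) by (cases "l = k") (auto simp: c'_def)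
    moreover have "\<exists>l\<in>insert k I. nonzero_morphism Q X0 (X l) (c' l)" using c(2) c'I by auto
    ultimately show ?thesis by blast
  next
    case False
    obtain \<phi> where \<phi>: "isomorphism Q X0 (X k) \<phi>" using iso by (auto simp: isomorphic_def)
    define c where "c = (\<lambda>l. if l = k then \<phi> else (\<lambda>i z. 0))"
    have c: "morphism Q X0 (X l) (c l)" if "l \<in> insert k I" for l
      using \<phi> morphism_zero_map[OF X[OF that]] by (auto simp: c_def isomorphism_def)
    have "nonzero_morphism Q X0 (X k) (c k)"
    proof -
      have "c k = \<phi>" by (simp add: c_def)
      moreover have "\<phi> i0 z0 \<noteq> 0" using isomorphism_eq_zero[OF X0 \<phi> nz(1,2)] nz(3) by blast
      ultimately show ?thesis using c[of k] nz(1,2) unfolding nonzero_morphism_def by auto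
    qed
    moreover have "(\<Sum>l\<in>insert k I. a t l i (c l i z)) = 0" if "t \<in> T" "i \<in> verts Q" "z \<in> spc X0 i" for t i z
    proof (rule sum.neutral, rule ballI)
      fix l assume l: "l \<in> insert k I"
      show "a t l i (c l i z) = 0"
      proof (cases "l = k")
        case True
        have "c k i z \<in> spc (X k) i" using morphism_in[OF c that(2,3)] by simp
        then have "a t k i (c k i z) = 0"
          using False that(1,2) a[OF that(1), of k] unfolding nonzero_morphism_def by blast
        then show ?thesis using True by simp
      next
        case False
        then show ?thesis using morphism_zero[OF X[OF l] a[OF that(1) l] that(2)] by (simp add: c_def)
      qed
    qed
    ultimately show ?thesis using c by (intro exI[of _ c]) auto
  qed
qed simp

end

context posetal
begin

context
  fixes V :: "('v, 'a, 'k, 'b::ab_group_add) rep"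
  assumes V: "quiver_rep Q V"
begin

interpretation V: vector_space "scal V" by (rule rep_vs[OF V])

text \<open>
  A relation between vectors becomes a relation between morphisms, modulo \<open>F_less\<close>. The vector \<open>x\<close> of the
  direct sum \<open>S\<close> of the members of \<open>J\<close> lies in the kernel of the sum map \<open>S \<rightarrow> V\<close>, which by \<open>resolution\<close>
  factors through maps \<open>\<pi> t : S \<rightarrow> W t\<close> killing \<open>x\<close>. Since \<open>\<beta>\<close> is maximal, only members of class \<open>\<beta>\<close> map to
  the \<open>W t\<close> of class \<open>\<beta>\<close>, and they do so by a matrix of maps that are zero or isomorphisms. A column of
  maps \<open>c X\<close> that this matrix kills factors through the remaining \<open>W t\<close>, whose classes are below \<open>\<beta>\<close> as far
  as it reaches them, and their images in \<open>V\<close> lie in \<open>F_less\<close>.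
\<close>

lemma maximal_class_relation:
  assumes fin: "finite J" and J: "\<And>X. X \<in> J \<Longrightarrow> subrep Q V X" "\<And>X. X \<in> J \<Longrightarrow> fin_indec (restr V X)"
    and j: "j \<in> verts Q" and x: "\<And>X. X \<in> J \<Longrightarrow> x X \<in> X j" "\<And>X. X \<in> J \<Longrightarrow> x X \<noteq> 0" "(\<Sum>X\<in>J. x X) = 0"
    and X1: "X1 \<in> J" "\<beta> = cls (restr V X1)" and max: "\<And>X. X \<in> J \<Longrightarrow> (\<beta>, cls (restr V X)) \<notin> LE - Id"
  defines "J\<beta> \<equiv> {X \<in> J. cls (restr V X) = \<beta>}"
  obtains c where "\<forall>X\<in>J\<beta>. morphism Q (restr V X1) (restr V X) (c X)"
    "\<exists>X\<in>J\<beta>. nonzero_morphism Q (restr V X1) (restr V X) (c X)"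
    "\<forall>i\<in>verts Q. \<forall>z\<in>X1 i. (\<Sum>X\<in>J\<beta>. c X i z) \<in> F_less Q V \<beta> i"
proof -
  let ?S = "dsum V J" and ?f = "\<lambda>i g. \<Sum>X\<in>J. g X"
  let ?\<iota> = "\<lambda>X i v Y. if Y = X then v else (0::'b)"
  have rS: "quiver_rep Q ?S" by (rule dsum_quiver_rep[OF V J(1)])
  have fS: "flei Q ?S" by (rule dsum_flei[OF V J(1) fin fin_indec_flei[OF J(2)]])
  have mf: "morphism Q ?S V ?f" by (rule dsum_sum[OF V J(1)])
  have m\<iota>: "morphism Q (restr V X) ?S (?\<iota> X)" if "X \<in> J" for X by (rule dsum_inject[OF V J(1) that])
  have fin\<beta>: "finite J\<beta>" "J\<beta> \<subseteq> J" using fin by (auto simp: J\<beta>_def)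
  define s where "s = (\<lambda>X. if X \<in> J then x X else 0)"
  have s: "s \<in> spc ?S j" using x(1) by (simp add: s_def dsum_def)
  have fs: "?f j s = 0" using x(3) by (simp add: s_def)
  have s_sum: "s = (\<Sum>X\<in>J. ?\<iota> X j (x X))"
  proof
    fix Y
    show "s Y = (\<Sum>X\<in>J. ?\<iota> X j (x X)) Y" using fin by (simp add: sum_fun_apply s_def)
  qed
  obtain D :: "('v \<Rightarrow> (('v \<Rightarrow> 'b set) \<Rightarrow> 'b) set) set"
      and W :: "('v \<Rightarrow> (('v \<Rightarrow> 'b set) \<Rightarrow> 'b) set) \<Rightarrow> ('v, 'a, 'k, ('v \<Rightarrow> 'b set) \<Rightarrow> 'b) rep" and \<pi>
    where D: "finite D" "\<And>t. t \<in> D \<Longrightarrow> fin_indec (W t)" "\<And>t. t \<in> D \<Longrightarrow> morphism Q ?S (W t) (\<pi> t)"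
    "\<And>t i. t \<in> D \<Longrightarrow> i \<in> verts Q \<Longrightarrow> spc (W t) i \<subseteq> \<pi> t i ` spc ?S i"
    "\<And>t. t \<in> D \<Longrightarrow> \<pi> t j s = 0"
    "\<And>t. t \<in> D \<Longrightarrow> morphism Q (W t) V ?f"
    "\<And>i y. i \<in> verts Q \<Longrightarrow> y \<in> spc ?S i \<Longrightarrow> ?f i y = (\<Sum>t\<in>D. ?f i (\<pi> t i y))"
    by (rule resolution[where f = ?f and j = j and s = s, OF rS fS V mf j s fs]) blast
  define T where "T = {t\<in>D. cls (W t) = \<beta>}"
  let ?a = "\<lambda>t X i v. \<pi> t i (?\<iota> X i v)"
  have ma: "morphism Q (restr V X) (W t) (?a t X)" if "t \<in> D" "X \<in> J" for t X
    by (rule morphism_comp[OF m\<iota>[OF that(2)] D(3)[OF that(1)]])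
  \<comment> \<open>a summand whose class is not \<open>\<beta>\<close> has no nonzero map to a quotient of class \<open>\<beta>\<close>, by maximality of \<open>\<beta>\<close>\<close>
  have other: "?a t X j (x X) = 0" if t: "t \<in> T" and X: "X \<in> J" "X \<notin> J\<beta>" for t X
  proof (rule ccontr)
    assume "?a t X j (x X) \<noteq> 0"
    then have "nonzero_morphism Q (restr V X) (W t) (?a t X)"
      using ma[of t X] t X x(1)[OF X(1)] j unfolding nonzero_morphism_def T_def by auto
    then have "(cls (W t), cls (restr V X)) \<in> LE" using hom_le[OF J(2)[OF X(1)] D(2)] t by (auto simp: T_def)
    then show False using max[OF X(1)] X t by (auto simp: T_def J\<beta>_def)
  qed
  have ker: "(\<Sum>X\<in>J\<beta>. ?a t X j (x X)) = 0" if t: "t \<in> T" for t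
  proof -
    have tD: "t \<in> D" using t by (simp add: T_def)
    have "(\<Sum>X\<in>J. ?a t X j (x X)) = \<pi> t j s"
      unfolding s_sum using morphism_in[OF m\<iota> j] x(1)
      by (intro morphism_sum_arg[OF rS D(3)[OF tD] j, symmetric]) auto
    moreover have "(\<Sum>X\<in>J. ?a t X j (x X)) = (\<Sum>X\<in>J\<beta>. ?a t X j (x X))"
      using other[OF t] fin\<beta> fin by (intro sum.mono_neutral_right) auto
    ultimately show ?thesis using D(5)[OF tD] by simp
  qed
  have X1\<beta>: "X1 \<in> J\<beta>" using X1 by (simp add: J\<beta>_def)
  obtain i0 z0 where nz: "i0 \<in> verts Q" "z0 \<in> spc (restr V X1) i0" "z0 \<noteq> 0"
    using fin_indec_vector[OF J(2)[OF X1(1)]] .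
  have "\<exists>c. (\<forall>X\<in>J\<beta>. morphism Q (restr V X1) (restr V X) (c X)) \<and>
      (\<exists>X\<in>J\<beta>. nonzero_morphism Q (restr V X1) (restr V X) (c X)) \<and>
      (\<forall>t\<in>T. \<forall>i\<in>verts Q. \<forall>z\<in>spc (restr V X1) i. (\<Sum>X\<in>J\<beta>. ?a t X i (c X i z)) = 0)"
  proof (rule homogeneous_system[where X = "restr V" and W = W and x = x and j = j,
        OF fin\<beta>(1) fin_indec_rep[OF J(2)[OF X1(1)]] nz _ j])
    show "quiver_rep Q (W t)" if "t \<in> T" for t using fin_indec_rep[OF D(2)] that by (simp add: T_def)
    show "quiver_rep Q (restr V X)" if "X \<in> J\<beta>" for X using fin_indec_rep[OF J(2)] that by (simp add: J\<beta>_def)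
    show "isomorphic Q (restr V X1) (restr V X)" if "X \<in> J\<beta>" for X
      using cls_eqD[OF J(2)[OF X1(1)] J(2)] that X1(2) by (simp add: J\<beta>_def)
    show "isomorphism Q (restr V X) (W t) f" if "X \<in> J\<beta>" "t \<in> T" "nonzero_morphism Q (restr V X) (W t) f" for X t f
      using same_class_iso[OF J(2) D(2) _ that(3)] that(1,2) by (simp add: J\<beta>_def T_def)
    show "morphism Q (restr V X) (W t) (?a t X)" if "t \<in> T" "X \<in> J\<beta>" for t X
      using ma that by (simp add: J\<beta>_def T_def)
    show "x X \<in> spc (restr V X) j" if "X \<in> J\<beta>" for X using x(1) that by (simp add: J\<beta>_def)
    show "\<exists>X\<in>J\<beta>. x X \<noteq> 0" using X1\<beta> x(2)[OF X1(1)] by blast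
  qed (rule ker)
  then obtain c where c': "\<forall>X\<in>J\<beta>. morphism Q (restr V X1) (restr V X) (c X)"
      "\<exists>X\<in>J\<beta>. nonzero_morphism Q (restr V X1) (restr V X) (c X)"
      "\<forall>t\<in>T. \<forall>i\<in>verts Q. \<forall>z\<in>spc (restr V X1) i. (\<Sum>X\<in>J\<beta>. ?a t X i (c X i z)) = 0"
    by (elim exE conjE) (rule that)
  have c3: "(\<Sum>X\<in>J\<beta>. ?a t X i (c X i z)) = 0" if "t \<in> T" "i \<in> verts Q" "z \<in> X1 i" for t i z
    using bspec[OF bspec[OF bspec[OF c'(3) that(1)] that(2)], of z] that(3) by simp
  note c = bspec[OF c'(1)] c'(2) c3
  have "(\<Sum>X\<in>J\<beta>. c X i z) \<in> F_less Q V \<beta> i" if i: "i \<in> verts Q" and z: "z \<in> X1 i" for i z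
  proof -
    have cz: "c X i z \<in> X i" if "X \<in> J\<beta>" for X using morphism_in[OF c(1)[OF that] i] z by simp
    let ?y = "\<Sum>X\<in>J\<beta>. ?\<iota> X i (c X i z)"
    have yS: "?\<iota> X i (c X i z) \<in> spc ?S i" if "X \<in> J\<beta>" for X
      using morphism_in[OF m\<iota> i] that fin\<beta>(2) cz[OF that] by auto
    have y: "?y \<in> spc ?S i" by (rule rep_sum[OF rS i yS])
    have "?f i ?y = (\<Sum>X\<in>J\<beta>. ?f i (?\<iota> X i (c X i z)))" by (rule morphism_sum_arg[OF rS mf i yS])
    also have "\<dots> = (\<Sum>X\<in>J\<beta>. c X i z)"
      by (rule sum.cong[OF refl]) (use fin fin\<beta>(2) in auto)
    finally have e1: "(\<Sum>X\<in>J\<beta>. c X i z) = (\<Sum>t\<in>D. ?f i (\<pi> t i ?y))" using D(7)[OF i y] by simp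
    have tm: "?f i (\<pi> t i ?y) \<in> F_less Q V \<beta> i" if t: "t \<in> D" for t
    proof -
      have py: "\<pi> t i ?y = (\<Sum>X\<in>J\<beta>. ?a t X i (c X i z))" by (rule morphism_sum_arg[OF rS D(3)[OF t] i yS])
      have f0: "?f i 0 = 0" by (simp add: zero_fun_def)
      show ?thesis
      proof (cases "\<pi> t i ?y = 0")
        case True
        then show ?thesis using f0 V.subspace_0[OF F_subspace(2)[OF V]] by simp
      next
        case False
        then have "t \<notin> T" using c(3)[OF _ i z] py by auto
        then have ne: "cls (W t) \<noteq> \<beta>" using t by (simp add: T_def)
        obtain X where X: "X \<in> J\<beta>" "?a t X i (c X i z) \<noteq> 0" using False unfolding py by (meson sum.neutral)
        have XJ: "X \<in> J" using X(1) fin\<beta>(2) by blast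
        have "nonzero_morphism Q (restr V X) (W t) (?a t X)"
          unfolding nonzero_morphism_def using ma[OF t XJ] X(2) i cz[OF X(1)] by auto
        then have "(cls (W t), \<beta>) \<in> LE - Id"
          using hom_le[OF J(2)[OF XJ] D(2)[OF t]] X(1) ne by (simp add: J\<beta>_def)
        moreover have "?f i (\<pi> t i ?y) \<in> F Q V (cls (W t)) i"
          using image_in_F(1)[OF V D(2)[OF t] D(6)[OF t]] i morphism_in[OF D(3)[OF t] i y] by blast
        ultimately show ?thesis using F_mono[OF V] by blast
      qed
    qed
    show ?thesis unfolding e1 by (rule V.subspace_sum[OF F_subspace(2)[OF V] tm])
  qed
  then show ?thesis by (intro that[OF c'(1,2)]) blast
qed

section \<open>Independence and spanning\<close>

definition independent_mod :: "('v, 'a, 'k) rep_class \<Rightarrow> ('v \<Rightarrow> 'b set) set \<Rightarrow> bool" where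
  "independent_mod \<beta> D \<longleftrightarrow> (\<forall>i\<in>verts Q. \<forall>T f. finite T \<longrightarrow> T \<subseteq> D \<longrightarrow> (\<forall>X\<in>T. f X \<in> X i) \<longrightarrow>
     (\<Sum>X\<in>T. f X) \<in> F_less Q V \<beta> i \<longrightarrow> (\<forall>X\<in>T. f X = 0))"

lemma independent_modD:
  "independent_mod \<beta> D \<Longrightarrow> i \<in> verts Q \<Longrightarrow> finite T \<Longrightarrow> T \<subseteq> D \<Longrightarrow> (\<And>X. X \<in> T \<Longrightarrow> f X \<in> X i) \<Longrightarrow>
     (\<Sum>X\<in>T. f X) \<in> F_less Q V \<beta> i \<Longrightarrow> X \<in> T \<Longrightarrow> f X = 0"
  unfolding independent_mod_def by (drule (1) bspec, drule spec[of _ T], drule spec[of _ f]) simp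

text \<open>
  In a nontrivial relation, \<open>maximal_class_relation\<close> for a maximal class \<open>\<beta>\<close> among the members involved
  gives a nontrivial relation modulo \<open>F_less\<close> between members of class \<open>\<beta>\<close>.
\<close>

lemma independent_classes:
  assumes D: "\<And>X. X \<in> D \<Longrightarrow> subrep Q V X" "\<And>X. X \<in> D \<Longrightarrow> fin_indec (restr V X)"
    and ind: "\<And>\<beta>. \<beta> \<in> indec_flei Q \<Longrightarrow> independent_mod \<beta> {X\<in>D. cls (restr V X) = \<beta>}"
    and i: "i \<in> verts Q" and T: "finite T" "T \<subseteq> D" "\<And>X. X \<in> T \<Longrightarrow> f X \<in> X i" "(\<Sum>X\<in>T. f X) = 0" "X \<in> T"
  shows "f X = 0"
proof (rule ccontr)
  assume "f X \<noteq> 0"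
  define J where "J = {X\<in>T. f X \<noteq> 0}"
  have J: "finite J" "J \<subseteq> D" "J \<noteq> {}" using T \<open>f X \<noteq> 0\<close> by (auto simp: J_def)
  let ?C = "(\<lambda>X. cls (restr V X)) ` J"
  have "\<exists>m\<in>?C. \<forall>x\<in>?C. x \<noteq> m \<longrightarrow> \<not> (m, x) \<in> LE - Id"
  proof (rule Finite_Set.bex_max_element)
    show "asymp_on ?C (\<lambda>a b. (a, b) \<in> LE - Id)" using LE_antisym by (auto simp: asymp_on_def)
    have "(a, c) \<in> LE - Id" if "(a, b) \<in> LE - Id" "(b, c) \<in> LE - Id" for a b c
      using that LE_trans[of a b c] LE_antisym[of a b] by auto
    then show "transp_on ?C (\<lambda>a b. (a, b) \<in> LE - Id)" by (intro transp_onI) 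
  qed (use J in auto)
  then obtain X1 where X1: "X1 \<in> J" "\<And>X. X \<in> J \<Longrightarrow> (cls (restr V X1), cls (restr V X)) \<notin> LE - Id" by auto
  let ?\<beta> = "cls (restr V X1)"
  let ?J = "{X \<in> J. cls (restr V X) = ?\<beta>}"
  have "(\<Sum>X\<in>T. f X) = (\<Sum>X\<in>J. f X)" by (rule sum.mono_neutral_right) (use T(1) in \<open>auto simp: J_def\<close>)
  then have sumJ: "(\<Sum>X\<in>J. f X) = 0" using T(4) by simp
  have DJ: "subrep Q V Y" "fin_indec (restr V Y)" "f Y \<in> Y i" "f Y \<noteq> 0" if "Y \<in> J" for Y
    using that D[of Y] J(2) T(3)[of Y] by (auto simp: J_def)
  obtain c where c': "\<forall>X\<in>?J. morphism Q (restr V X1) (restr V X) (c X)"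
    "\<exists>X\<in>?J. nonzero_morphism Q (restr V X1) (restr V X) (c X)"
    "\<forall>i\<in>verts Q. \<forall>z\<in>X1 i. (\<Sum>X\<in>?J. c X i z) \<in> F_less Q V ?\<beta> i"
    by (rule maximal_class_relation[where x = f, OF J(1) DJ(1,2) i DJ(3,4) sumJ X1(1) refl X1(2)])
  note c = bspec[OF c'(1)] c'(2) bspec[OF bspec[OF c'(3)]]
  obtain X k z where X: "X \<in> ?J" "k \<in> verts Q" "z \<in> X1 k" "c X k z \<noteq> 0"
    using c(2) by (auto simp: nonzero_morphism_def)
  have cz: "c Y k z \<in> Y k" if "Y \<in> ?J" for Y using morphism_in[OF c(1)[OF that] X(2), of z] X(3) by simp
  have sub: "?J \<subseteq> {X\<in>D. cls (restr V X) = ?\<beta>}" "finite ?J" using J by auto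
  have "c X k z = 0"
    by (rule independent_modD[OF ind[OF cls_in[OF D(2)]] X(2) sub(2,1), where f = "\<lambda>X. c X k z"])
      (use X1 J cz c(3) X in auto)
  then show False using X(4) by simp
qed

text \<open>
  \<open>D\<close> is a maximal family that is independent modulo \<open>F_less\<close>. A further subrepresentation \<open>X\<close> of class \<open>\<beta>\<close>
  destroys independence. The resulting relation involves \<open>X\<close> through a nonzero map \<open>c X\<close>, which is an
  isomorphism, and can be solved for all of \<open>X\<close>.
\<close>

lemma class_complement:
  assumes \<beta>: "\<beta> \<in> indec_flei Q"
  obtains D where "D \<subseteq> below V {\<beta>}" "independent_mod \<beta> D"
    "\<forall>i\<in>verts Q. F Q V \<beta> i \<subseteq> {x + y | x y. x \<in> F_less Q V \<beta> i \<and> y \<in> V.span (\<Union>X\<in>D. X i)}"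
proof -
  let ?A = "{D. D \<subseteq> below V {\<beta>} \<and> independent_mod \<beta> D}"
  have "\<exists>M\<in>?A. \<forall>X\<in>?A. M \<subseteq> X \<longrightarrow> X = M"
  proof (rule subset_Zorn')
    fix C assume C: "subset.chain ?A C"
    have "independent_mod \<beta> (\<Union>C)"
      unfolding independent_mod_def
    proof (intro ballI allI impI)
      fix i T f X assume i: "i \<in> verts Q" and T: "finite T" "T \<subseteq> \<Union>C" "\<forall>X\<in>T. f X \<in> X i"
        "(\<Sum>X\<in>T. f X) \<in> F_less Q V \<beta> i" "X \<in> T"
      then have "C \<noteq> {}" by auto
      then obtain D where D: "D \<in> C" "T \<subseteq> D" using finite_subset_Union_chain[OF T(1,2) _ C] by blast
      then have "independent_mod \<beta> D" using C by (auto simp: subset.chain_def)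
      then show "f X = 0" using independent_modD[OF _ i T(1) D(2) _ T(4,5)] T(3) by blast
    qed
    then show "\<Union>C \<in> ?A" using C by (auto simp: subset.chain_def)
  qed
  then obtain D where D: "D \<subseteq> below V {\<beta>}" "independent_mod \<beta> D"
    and max: "\<And>E. E \<subseteq> below V {\<beta>} \<Longrightarrow> independent_mod \<beta> E \<Longrightarrow> D \<subseteq> E \<Longrightarrow> E = D" by auto
  let ?H = "\<lambda>i. {x + y | x y. x \<in> F_less Q V \<beta> i \<and> y \<in> V.span (\<Union>X\<in>D. X i)}"
  have H: "V.subspace (?H i)" for i by (intro V.subspace_sums F_subspace(2)[OF V] V.subspace_span)
  have FH: "F_less Q V \<beta> i \<subseteq> ?H i" for i using V.span_zero by force
  have DH: "V.span (\<Union>X\<in>D. X i) \<subseteq> ?H i" for i using V.subspace_0[OF F_subspace(2)[OF V]] by force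
  have main: "X i \<subseteq> ?H i" if X: "X \<in> below V {\<beta>}" and i: "i \<in> verts Q" for X i
  proof (cases "X \<in> D")
    case True
    then have "X i \<subseteq> (\<Union>X\<in>D. X i)" by blast
    also have "\<dots> \<subseteq> V.span (\<Union>X\<in>D. X i)" by (rule V.span_superset)
    also note DH
    finally show ?thesis .
  next
    case False
    then have "insert X D \<noteq> D" by auto
    then have "\<not> independent_mod \<beta> (insert X D)" using max[of "insert X D"] X D(1) by auto
    then obtain j T f where jT: "j \<in> verts Q" "finite T" "T \<subseteq> insert X D" "\<forall>Y\<in>T. f Y \<in> Y j"
      "(\<Sum>Y\<in>T. f Y) \<in> F_less Q V \<beta> j" "\<exists>Y\<in>T. f Y \<noteq> 0"
      unfolding independent_mod_def by blast
    have "\<exists>U g. finite U \<and> U \<subseteq> below V {\<alpha>. (\<alpha>, \<beta>) \<in> LE - Id} \<and> (\<forall>Y\<in>U. g Y \<in> Y j) \<and> (\<Sum>Y\<in>T. f Y) = (\<Sum>Y\<in>U. g Y)"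
      using jT(5) unfolding F_less_eq[OF V]
      by (subst (asm) span_UN_iff_finite_sum[OF rep_vs[OF V]]) (auto dest!: belowD(1) intro: subrep_subspace jT(1))
    then obtain U g where U: "finite U" "U \<subseteq> below V {\<alpha>. (\<alpha>, \<beta>) \<in> LE - Id}" "\<forall>Y\<in>U. g Y \<in> Y j"
      "(\<Sum>Y\<in>T. f Y) = (\<Sum>Y\<in>U. g Y)" by blast
    have TB: "T \<subseteq> below V {\<beta>}" using jT(3) X D(1) by auto
    have disj: "T \<inter> U = {}" using TB U(2) by (fastforce simp: below_def)
    \<comment> \<open>the relation \<open>\<Sum>f = \<Sum>g\<close>, written as one vanishing sum and restricted to its nonzero terms\<close>
    define h where "h = (\<lambda>Y. if Y \<in> T then f Y else - g Y)"
    define J where "J = {Y \<in> T \<union> U. h Y \<noteq> 0}"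
    have hT: "(\<Sum>Y\<in>T. h Y) = (\<Sum>Y\<in>T. f Y)" by (rule sum.cong) (auto simp: h_def)
    have hU: "(\<Sum>Y\<in>U. h Y) = - (\<Sum>Y\<in>U. g Y)"
      unfolding sum_negf[symmetric] by (rule sum.cong) (use disj in \<open>auto simp: h_def\<close>)
    have "(\<Sum>Y\<in>T \<union> U. h Y) = 0" using sum.union_disjoint[OF jT(2) U(1) disj, of h] hT hU U(4) by simp
    moreover have "(\<Sum>Y\<in>T \<union> U. h Y) = (\<Sum>Y\<in>J. h Y)"
      using jT(2) U(1) by (intro sum.mono_neutral_right) (auto simp: J_def)
    ultimately have sumJ: "(\<Sum>Y\<in>J. h Y) = 0" by simp
    obtain X1 where X1: "X1 \<in> T" "f X1 \<noteq> 0" using jT(6) by blast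
    have cX1: "\<beta> = cls (restr V X1)" and X1J: "X1 \<in> J" using X1 TB by (auto simp: below_def J_def h_def)
    have finJ: "finite J" using jT(2) U(1) by (simp add: J_def)
    have Jcases: "subrep Q V Y \<and> fin_indec (restr V Y) \<and> (cls (restr V Y) = \<beta> \<and> Y \<in> T \<or> (cls (restr V Y), \<beta>) \<in> LE - Id)"
      if "Y \<in> J" for Y using that TB U(2) by (auto simp: J_def below_def)
    have hJ: "h Y \<in> Y j" if "Y \<in> J" for Y
      using that jT(4) U(3) V.subspace_neg[OF subrep_subspace[OF _ jT(1), of V Y]] Jcases[OF that] by (auto simp: J_def h_def)
    have maxJ: "(\<beta>, cls (restr V Y)) \<notin> LE - Id" if "Y \<in> J" for Y using Jcases[OF that] LE_antisym by auto
    let ?J = "{Y \<in> J. cls (restr V Y) = \<beta>}"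
    have DJ: "subrep Q V Y" "fin_indec (restr V Y)" "h Y \<noteq> 0" if "Y \<in> J" for Y
      using that Jcases[OF that] by (auto simp: J_def)
    obtain c where c': "\<forall>Y\<in>?J. morphism Q (restr V X1) (restr V Y) (c Y)"
      "\<exists>Y\<in>?J. nonzero_morphism Q (restr V X1) (restr V Y) (c Y)"
      "\<forall>i\<in>verts Q. \<forall>z\<in>X1 i. (\<Sum>Y\<in>?J. c Y i z) \<in> F_less Q V \<beta> i"
      by (rule maximal_class_relation[where x = h, OF finJ DJ(1,2) jT(1) hJ DJ(3) sumJ X1J cX1 maxJ])
    note c = bspec[OF c'(1)] c'(2) bspec[OF bspec[OF c'(3)]]
    have JT: "?J \<subseteq> T" using Jcases by auto
    have czY: "c Y k z \<in> Y k" if "Y \<in> ?J" "k \<in> verts Q" "z \<in> X1 k" for Y k z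
      using morphism_in[OF c(1)[OF that(1)] that(2), of z] that(3) by simp
    have finJ': "finite ?J" using finJ by simp
    \<comment> \<open>the relation involves \<open>X\<close>, since the members of \<open>D\<close> satisfy none\<close>
    have "X \<in> ?J \<and> nonzero_morphism Q (restr V X1) (restr V X) (c X)"
    proof (rule ccontr)
      assume neg: "\<not> (X \<in> ?J \<and> nonzero_morphism Q (restr V X1) (restr V X) (c X))"
      have cX0: "c X k z = 0" if "X \<in> ?J" "k \<in> verts Q" "z \<in> X1 k" for k z
        using neg that c(1)[OF that(1)] unfolding nonzero_morphism_def by auto
      obtain Y k z where Y: "Y \<in> ?J" "k \<in> verts Q" "z \<in> X1 k" "c Y k z \<noteq> 0"
        using c(2) by (auto simp: nonzero_morphism_def)
      have "(\<Sum>Y\<in>?J - {X}. c Y k z) = (\<Sum>Y\<in>?J. c Y k z)"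
        using finJ' cX0[OF _ Y(2,3)] by (intro sum.mono_neutral_left) auto
      then have m: "(\<Sum>Y\<in>?J - {X}. c Y k z) \<in> F_less Q V \<beta> k" using c(3)[OF Y(2,3)] by simp
      have YX: "Y \<in> ?J - {X}" using Y cX0 by auto
      have "c Y k z = 0"
        by (rule independent_modD[OF D(2) Y(2) _ _ _ m YX]) (use finJ' JT jT(3) czY[OF _ Y(2,3)] in auto)
      then show False using Y(4) by simp
    qed
    then have XJ: "X \<in> ?J" and nzX: "nonzero_morphism Q (restr V X1) (restr V X) (c X)" by auto
    have "isomorphism Q (restr V X1) (restr V X) (c X)"
      using same_class_iso[OF _ _ _ nzX] Jcases[OF X1J] Jcases[of X] XJ cX1 by auto
    then have surj: "X i = c X i ` X1 i" using i by (auto simp: isomorphism_def bij_betw_def)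
    show ?thesis
    proof
      fix x assume "x \<in> X i"
      then obtain z where z: "z \<in> X1 i" "x = c X i z" using surj by auto
      have "(\<Sum>Y\<in>?J. c Y i z) = x + (\<Sum>Y\<in>?J - {X}. c Y i z)"
        using sum.remove[OF finJ' XJ, of "\<lambda>Y. c Y i z"] z by simp
      then have xeq: "x = (\<Sum>Y\<in>?J. c Y i z) - (\<Sum>Y\<in>?J - {X}. c Y i z)" by simp
      have rest: "(\<Sum>Y\<in>?J - {X}. c Y i z) \<in> V.span (\<Union>X\<in>D. X i)"
        using czY[OF _ i z(1)] JT jT(3) by (intro V.span_sum V.span_base) auto
      have "(\<Sum>Y\<in>?J. c Y i z) - (\<Sum>Y\<in>?J - {X}. c Y i z) \<in> ?H i"
        by (rule V.subspace_diff[OF H subsetD[OF FH c(3)[OF i z(1)]] subsetD[OF DH rest]])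
      with xeq show "x \<in> ?H i" by (rule ssubst)
    qed
  qed
  have "F Q V \<beta> i \<subseteq> ?H i" if i: "i \<in> verts Q" for i
    unfolding F_eq[OF V]
  proof (rule V.span_minimal[OF UN_least H])
    fix X assume X: "X \<in> below V {\<alpha>. (\<alpha>, \<beta>) \<in> LE}"
    show "X i \<subseteq> ?H i"
    proof (cases "cls (restr V X) = \<beta>")
      case True
      then have "X \<in> below V {\<beta>}" using X by (simp add: below_def)
      then show ?thesis using main i by blast
    next
      case False
      then have "X \<in> below V {\<alpha>. (\<alpha>, \<beta>) \<in> LE - Id}" using X by (simp add: below_def)
      then have "X i \<subseteq> (\<Union>X\<in>below V {\<alpha>. (\<alpha>, \<beta>) \<in> LE - Id}. X i)" by blast
      also have "\<dots> \<subseteq> F_less Q V \<beta> i" unfolding F_less_eq[OF V] by (rule V.span_superset)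
      also note FH
      finally show ?thesis .
    qed
  qed
  then show ?thesis by (intro that[OF D]) blast
qed

text \<open>
  Well-founded induction shows \<open>F Q V \<beta> i \<subseteq> M i\<close> for all \<open>\<beta>\<close>, and a vector \<open>v\<close> at \<open>i\<close> belongs to \<open>F Q V \<beta> i\<close>
  for the class \<open>\<beta>\<close> of \<open>path_rep i\<close>.
\<close>

lemma spanned_by_complements:
  assumes M: "\<And>i. V.subspace (M i)"
    and F: "\<And>\<beta> i. \<beta> \<in> indec_flei Q \<Longrightarrow> i \<in> verts Q \<Longrightarrow> F Q V \<beta> i \<subseteq> {x + y | x y. x \<in> F_less Q V \<beta> i \<and> y \<in> M i}"
    and i: "i \<in> verts Q"
  shows "spc V i \<subseteq> M i"
proof
  have FM: "F Q V \<beta> i \<subseteq> M i" if "\<beta> \<in> indec_flei Q" for \<beta>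
    using wfo that
  proof (induction \<beta> rule: wf_on_induct)
    case in_set
    show ?case by (rule that)
  next
    case (less \<beta>)
    have "F_less Q V \<beta> i \<subseteq> M i"
      unfolding F_less_def LE[symmetric] using less LE_in by (intro V.span_minimal M UN_least) auto
    then have "{x + y | x y. x \<in> F_less Q V \<beta> i \<and> y \<in> M i} \<subseteq> M i" using V.subspace_add[OF M] by blast
    then show ?case using F[OF less.hyps i] by (rule order_trans[rotated])
  qed
  fix v assume v: "v \<in> spc V i"
  let ?P = "path_rep i :: ('v, 'a, 'k, 'k poly) rep"
  have P: "fin_indec ?P"
    using path_rep_indecomposable[OF i] path_rep_flei[OF finite_inward[OF i]] by (auto simp: fin_indec_def)
  obtain \<phi> where \<phi>: "morphism Q ?P V \<phi>" "1 \<in> spc ?P i" "\<phi> i 1 = v" using path_rep_hits[OF V i v] .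
  have "v \<in> F Q V (cls ?P) i" using image_in_F(1)[OF V P \<phi>(1)] i \<phi>(2,3) by blast
  then show "v \<in> M i" using FM[OF cls_in[OF P]] by blast
qed

end

end

lemma times_finite_cancel:
  assumes eq: "A \<times> {..<d} \<approx> B \<times> {..<d::nat}" and d: "0 < d"
  shows "A \<approx> B"
proof -
  have ne: "{..<d} \<noteq> {}" using d by auto
  have fin: "finite A \<longleftrightarrow> finite B"
    using eqpoll_finite_iff[OF eq] ne by (auto simp: finite_cartesian_product_iff)
  show ?thesis
  proof (cases "finite A")
    case True
    then have "finite (A \<times> {..<d})" "finite (B \<times> {..<d})" using fin by auto
    then have "card A * d = card B * d"
      using eq eqpoll_iff_card[of "A \<times> {..<d}" "B \<times> {..<d}"] by (simp add: card_cartesian_product)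
    then show ?thesis using d True fin eqpoll_iff_card[of A B] by simp
  next
    case False
    have "C \<times> {..<d} \<approx> C" if "infinite C" for C :: "'c set"
      using card_of_Times_infinite[OF that ne ordLeq3_finite_infinite[OF _ that]]
      by (simp add: eqpoll_iff_card_of_ordIso)
    then have "A \<times> {..<d} \<approx> A" "B \<times> {..<d} \<approx> B" using False fin by auto
    then show ?thesis using eq eqpoll_sym eqpoll_trans by meson
  qed
qed

context posetal
begin

context
  fixes V :: "('v, 'a, 'k, 'b::ab_group_add) rep"
  assumes V: "quiver_rep Q V"
begin

interpretation V: vector_space "scal V" by (rule rep_vs[OF V])

section \<open>Existence of decompositions\<close>

lemma direct_sumI:
  assumes D: "\<And>X. X \<in> D \<Longrightarrow> subrep Q V X" "\<And>X. X \<in> D \<Longrightarrow> fin_indec (restr V X)"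
    and ind: "\<And>\<beta>. \<beta> \<in> indec_flei Q \<Longrightarrow> independent_mod V \<beta> {X\<in>D. cls (restr V X) = \<beta>}"
    and F: "\<And>\<beta> i. \<beta> \<in> indec_flei Q \<Longrightarrow> i \<in> verts Q \<Longrightarrow>
      F Q V \<beta> i \<subseteq> {x + y | x y. x \<in> F_less Q V \<beta> i \<and> y \<in> V.span (\<Union>X\<in>D. X i)}"
  shows "decomposes V D"
proof -
  have "spc V i = V.span (\<Union>X\<in>D. X i)" if i: "i \<in> verts Q" for i
  proof
    show "spc V i \<subseteq> V.span (\<Union>X\<in>D. X i)"
      by (rule spanned_by_complements[OF V _ F i]) simp
    show "V.span (\<Union>X\<in>D. X i) \<subseteq> spc V i"
      by (rule V.span_minimal[OF UN_least[OF subrep_subset[OF D(1) i]] rep_subspace[OF V i]])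
  qed
  moreover have "\<forall>T f. finite T \<and> T \<subseteq> D \<and> (\<forall>X\<in>T. f X \<in> X i) \<and> (\<Sum>X\<in>T. f X) = 0 \<longrightarrow> (\<forall>X\<in>T. f X = 0)"
    if i: "i \<in> verts Q" for i
  proof (intro allI impI ballI, elim conjE)
    fix T f X assume T: "finite T" "T \<subseteq> D" "\<forall>X\<in>T. f X \<in> X i" "(\<Sum>X\<in>T. f X) = 0" "X \<in> T"
    show "f X = 0"
      by (rule independent_classes[OF V D ind i T(1,2) _ T(4,5)]) (use T(3) in auto)
  qed
  ultimately show ?thesis using D(1) by (simp add: decomposes_def is_direct_sum_def)
qed

lemma decomposition_exists:
  obtains D where "decomposes V D" "\<And>X. X \<in> D \<Longrightarrow> fin_indec (restr V X)"
proof -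
  have "\<forall>\<beta>\<in>indec_flei Q. \<exists>D. D \<subseteq> below V {\<beta>} \<and> independent_mod V \<beta> D \<and>
    (\<forall>i\<in>verts Q. F Q V \<beta> i \<subseteq> {x + y | x y. x \<in> F_less Q V \<beta> i \<and> y \<in> V.span (\<Union>X\<in>D. X i)})"
  proof
    fix \<beta> assume \<beta>: "\<beta> \<in> (indec_flei Q :: ('v, 'a, 'k) rep_class set)"
    obtain D where "D \<subseteq> below V {\<beta>}" "independent_mod V \<beta> D"
      "\<forall>i\<in>verts Q. F Q V \<beta> i \<subseteq> {x + y | x y. x \<in> F_less Q V \<beta> i \<and> y \<in> V.span (\<Union>X\<in>D. X i)}"
      using class_complement[OF V \<beta>] .
    then show "\<exists>D. D \<subseteq> below V {\<beta>} \<and> independent_mod V \<beta> D \<and>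
      (\<forall>i\<in>verts Q. F Q V \<beta> i \<subseteq> {x + y | x y. x \<in> F_less Q V \<beta> i \<and> y \<in> V.span (\<Union>X\<in>D. X i)})"
      by (intro exI[of _ D] conjI)
  qed
  from bchoice[OF this] obtain C where C': "\<forall>\<beta>\<in>indec_flei Q. C \<beta> \<subseteq> below V {\<beta>} \<and>
    independent_mod V \<beta> (C \<beta>) \<and> (\<forall>i\<in>verts Q. F Q V \<beta> i
      \<subseteq> {x + y | x y. x \<in> F_less Q V \<beta> i \<and> y \<in> V.span (\<Union>X\<in>C \<beta>. X i)})"
    by (elim exE)
  note C = bspec[OF C', THEN conjunct1] bspec[OF C', THEN conjunct2, THEN conjunct1]
    bspec[OF bspec[OF C', THEN conjunct2, THEN conjunct2]]
  define D where "D = (\<Union>\<beta>\<in>indec_flei Q. C \<beta>)"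
  have D: "subrep Q V X" "fin_indec (restr V X)" if "X \<in> D" for X
    using that C(1) by (auto simp: D_def below_def)
  have D\<beta>: "{X\<in>D. cls (restr V X) = \<beta>} = C \<beta>" if "\<beta> \<in> indec_flei Q" for \<beta>
    using that C(1) by (auto simp: D_def below_def)
  have "decomposes V D"
  proof (rule direct_sumI[OF D])
    fix \<beta> i assume \<beta>: "\<beta> \<in> (indec_flei Q :: ('v, 'a, 'k) rep_class set)" and i: "i \<in> verts Q"
    have "V.span (\<Union>X\<in>C \<beta>. X i) \<subseteq> V.span (\<Union>X\<in>D. X i)"
      using \<beta> by (intro V.span_mono UN_mono) (auto simp: D_def)
    then have "{x + y | x y. x \<in> F_less Q V \<beta> i \<and> y \<in> V.span (\<Union>X\<in>C \<beta>. X i)}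
        \<subseteq> {x + y | x y. x \<in> F_less Q V \<beta> i \<and> y \<in> V.span (\<Union>X\<in>D. X i)}" by blast
    with C(3)[OF \<beta> i] show "F Q V \<beta> i \<subseteq> {x + y | x y. x \<in> F_less Q V \<beta> i \<and> y \<in> V.span (\<Union>X\<in>D. X i)}"
      by (rule order_trans)
  qed (use C(2) D\<beta> in auto)
  then show ?thesis using that D(2) by blast
qed

lemma complements_direct_sum:
  assumes G: "\<And>\<beta>. \<beta> \<in> indec_flei Q \<Longrightarrow> subrep Q V (G \<beta>)"
    "\<And>\<beta>. \<beta> \<in> indec_flei Q \<Longrightarrow> sum_of_class Q V (G \<beta>) \<beta>"
    "\<And>\<beta>. \<beta> \<in> indec_flei Q \<Longrightarrow> is_direct_sum2 Q V (F Q V \<beta>) (F_less Q V \<beta>) (G \<beta>)"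
  shows "is_direct_sum Q V (spc V) (indec_flei Q) G"
proof -
  let ?I = "indec_flei Q :: ('v, 'a, 'k) rep_class set"
  have "\<forall>\<beta>\<in>?I. \<exists>C. C \<subseteq> below V {\<beta>} \<and> is_direct_sum Q V (G \<beta>) C (\<lambda>X. X)"
  proof
    fix \<beta> assume \<beta>: "\<beta> \<in> ?I"
    obtain C where C: "\<forall>X\<in>C. subrep Q V X \<and> belongs Q (restr V X) \<beta>" "is_direct_sum Q V (G \<beta>) C (\<lambda>X. X)"
      using G(2)[OF \<beta>] unfolding sum_of_class_def by blast
    have "C \<subseteq> below V {\<beta>}"
      using C(1) belongs_iff[OF quiver_rep_restr[OF V] \<beta>] by (auto simp: below_def)
    then show "\<exists>C. C \<subseteq> below V {\<beta>} \<and> is_direct_sum Q V (G \<beta>) C (\<lambda>X. X)" using C(2) by blast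
  qed
  then obtain C where C: "\<And>\<beta>. \<beta> \<in> ?I \<Longrightarrow> C \<beta> \<subseteq> below V {\<beta>}"
    "\<And>\<beta>. \<beta> \<in> ?I \<Longrightarrow> is_direct_sum Q V (G \<beta>) (C \<beta>) (\<lambda>X. X)" by metis
  define D where "D = (\<Union>\<beta>\<in>?I. C \<beta>)"
  have D: "subrep Q V X" "fin_indec (restr V X)" if "X \<in> D" for X
    using that C(1) by (auto simp: D_def below_def)
  have D\<beta>: "{X\<in>D. cls (restr V X) = \<beta>} = C \<beta>" if "\<beta> \<in> ?I" for \<beta>
    using that C(1) by (auto simp: D_def below_def)
  have GC: "G \<beta> i = V.span (\<Union>X\<in>C \<beta>. X i)" if "\<beta> \<in> ?I" "i \<in> verts Q" for \<beta> i
    using C(2)[OF that(1)] that(2) by (simp add: is_direct_sum_def)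
  have ind: "independent_mod V \<beta> (C \<beta>)" if \<beta>: "\<beta> \<in> ?I" for \<beta>
    unfolding independent_mod_def[OF V]
  proof (intro ballI allI impI)
    fix i T f X assume i: "i \<in> verts Q" and T: "finite T" "T \<subseteq> C \<beta>" "\<forall>X\<in>T. f X \<in> X i"
      "(\<Sum>X\<in>T. f X) \<in> F_less Q V \<beta> i" "X \<in> T"
    have "(\<Sum>X\<in>T. f X) \<in> G \<beta> i"
      unfolding GC[OF \<beta> i] using T(2,3) by (intro V.span_sum V.span_base) blast
    then have "(\<Sum>X\<in>T. f X) = 0" using T(4) G(3)[OF \<beta>] i by (auto simp: is_direct_sum2_def)
    then show "f X = 0" using is_direct_sum_zero[OF C(2)[OF \<beta>] i T(1,2) _ _ T(5), of f] T(3) by blast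
  qed
  have span: "spc V i \<subseteq> V.span (\<Union>\<beta>\<in>?I. G \<beta> i)" if i: "i \<in> verts Q" for i
  proof (rule spanned_by_complements[OF V _ _ i])
    fix \<beta> i assume \<beta>: "\<beta> \<in> ?I" and i: "i \<in> verts Q"
    have "G \<beta> i \<subseteq> (\<Union>\<beta>\<in>?I. G \<beta> i)" using \<beta> by blast
    also have "\<dots> \<subseteq> V.span (\<Union>\<beta>\<in>?I. G \<beta> i)" by (rule V.span_superset)
    finally show "F Q V \<beta> i \<subseteq> {x + y | x y. x \<in> F_less Q V \<beta> i \<and> y \<in> V.span (\<Union>\<beta>\<in>?I. G \<beta> i)}"
      using G(3)[OF \<beta>] i by (auto simp: is_direct_sum2_def)
  qed simp
  show ?thesis
    unfolding is_direct_sum_def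
  proof (intro ballI conjI allI impI equalityI span)
    fix i assume i: "i \<in> verts Q"
    show "V.span (\<Union>\<beta>\<in>?I. G \<beta> i) \<subseteq> spc V i"
      by (rule V.span_minimal[OF UN_least[OF subrep_subset[OF G(1) i]] rep_subspace[OF V i]])
    fix T f \<alpha> assume "finite T \<and> T \<subseteq> ?I \<and> (\<forall>\<beta>\<in>T. f \<beta> \<in> G \<beta> i) \<and> (\<Sum>\<beta>\<in>T. f \<beta>) = 0" and \<alpha>: "\<alpha> \<in> T"
    then have T: "finite T" "T \<subseteq> ?I" "\<And>\<beta>. \<beta> \<in> T \<Longrightarrow> f \<beta> \<in> G \<beta> i" "(\<Sum>\<beta>\<in>T. f \<beta>) = 0" by auto
    have "\<forall>\<beta>\<in>T. \<exists>U g. finite U \<and> U \<subseteq> C \<beta> \<and> (\<forall>X\<in>U. g X \<in> X i) \<and> f \<beta> = (\<Sum>X\<in>U. g X)"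
    proof
      fix \<beta> assume \<beta>: "\<beta> \<in> T"
      then have \<beta>I: "\<beta> \<in> ?I" using T(2) by blast
      have sub: "V.subspace (X i)" if "X \<in> C \<beta>" for X
        using C(1)[OF \<beta>I] that i by (auto simp: below_def subrep_subspace)
      have "f \<beta> \<in> V.span (\<Union>X\<in>C \<beta>. X i)" using T(3)[OF \<beta>] GC[OF \<beta>I i] by simp
      then show "\<exists>U g. finite U \<and> U \<subseteq> C \<beta> \<and> (\<forall>X\<in>U. g X \<in> X i) \<and> f \<beta> = (\<Sum>X\<in>U. g X)"
        using span_UN_iff_finite_sum[OF rep_vs[OF V], of "C \<beta>" "\<lambda>X. X i" "f \<beta>"] sub by blast
    qed
    then obtain U g where U: "\<And>\<beta>. \<beta> \<in> T \<Longrightarrow> finite (U \<beta>)" "\<And>\<beta>. \<beta> \<in> T \<Longrightarrow> U \<beta> \<subseteq> C \<beta>"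
      "\<And>\<beta> X. \<beta> \<in> T \<Longrightarrow> X \<in> U \<beta> \<Longrightarrow> g \<beta> X \<in> X i" "\<And>\<beta>. \<beta> \<in> T \<Longrightarrow> f \<beta> = (\<Sum>X\<in>U \<beta>. g \<beta> X)" by metis
    have cU: "cls (restr V X) = \<beta>" if "\<beta> \<in> T" "X \<in> U \<beta>" for \<beta> X
      using that U(2) C(1) T(2) by (fastforce simp: below_def)
    let ?h = "\<lambda>X. g (cls (restr V X)) X"
    have hU: "?h X = g \<beta> X" if "\<beta> \<in> T" "X \<in> U \<beta>" for \<beta> X using cU[OF that] by simp
    have "(\<Sum>X\<in>(\<Union>\<beta>\<in>T. U \<beta>). ?h X) = (\<Sum>\<beta>\<in>T. \<Sum>X\<in>U \<beta>. ?h X)"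
    proof (rule sum.UNION_disjoint)
      show "\<forall>\<beta>\<in>T. \<forall>\<gamma>\<in>T. \<beta> \<noteq> \<gamma> \<longrightarrow> U \<beta> \<inter> U \<gamma> = {}" using cU by blast
    qed (use T(1) U(1) in auto)
    also have "\<dots> = (\<Sum>\<beta>\<in>T. f \<beta>)"
    proof (rule sum.cong[OF refl])
      fix \<beta> assume \<beta>: "\<beta> \<in> T"
      show "(\<Sum>X\<in>U \<beta>. ?h X) = f \<beta>" unfolding U(4)[OF \<beta>] by (rule sum.cong[OF refl]) (rule hU[OF \<beta>])
    qed
    finally have sum0: "(\<Sum>X\<in>(\<Union>\<beta>\<in>T. U \<beta>). ?h X) = 0" using T(4) by simp
    have zero: "?h X = 0" if X: "X \<in> (\<Union>\<beta>\<in>T. U \<beta>)" for X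
    proof (rule independent_classes[where f = ?h, OF V D _ i _ _ _ sum0 X])
      show "independent_mod V \<beta> {X \<in> D. cls (restr V X) = \<beta>}" if "\<beta> \<in> ?I" for \<beta>
        using ind[OF that] D\<beta>[OF that] by simp
      show "finite (\<Union>\<beta>\<in>T. U \<beta>)" using T(1) U(1) by blast
      show "(\<Union>\<beta>\<in>T. U \<beta>) \<subseteq> D" using U(2) T(2) by (auto simp: D_def)
      show "?h Y \<in> Y i" if "Y \<in> (\<Union>\<beta>\<in>T. U \<beta>)" for Y using that U(3) hU by auto
    qed
    have "g \<alpha> X = 0" if "X \<in> U \<alpha>" for X using zero[of X] hU[OF \<alpha> that] \<alpha> that by auto
    then show "f \<alpha> = 0" unfolding U(4)[OF \<alpha>] by (intro sum.neutral) blast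
  qed
qed

section \<open>Uniqueness of decompositions\<close>

text \<open>
  If a vector of \<open>Y \<in> below V \<Gamma>\<close> has a nonzero component in \<open>X \<in> D\<close>, then the projection \<open>Y \<rightarrow> X\<close> is
  nonzero and the class of \<open>X\<close> is at most that of \<open>Y\<close>. So the filtration can be read off from any
  decomposition: \<open>F\<close> and \<open>F_less\<close> are the sums of the members of \<open>D\<close> of the respective classes.
\<close>

lemma filtered_span:
  assumes D: "decomposes V D" "\<And>X. X \<in> D \<Longrightarrow> fin_indec (restr V X)"
    and down: "\<And>\<alpha> \<gamma>. \<gamma> \<in> \<Gamma> \<Longrightarrow> (\<alpha>, \<gamma>) \<in> LE \<Longrightarrow> \<alpha> \<in> \<Gamma>" and i: "i \<in> verts Q"
  shows "V.span (\<Union>X\<in>below V \<Gamma>. X i) = V.span (\<Union>X\<in>{X\<in>D. cls (restr V X) \<in> \<Gamma>}. X i)"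
proof
  show "V.span (\<Union>X\<in>{X\<in>D. cls (restr V X) \<in> \<Gamma>}. X i) \<subseteq> V.span (\<Union>X\<in>below V \<Gamma>. X i)"
    using D(2) decomposes_subrep[OF D(1)] by (intro V.span_mono UN_mono) (auto simp: below_def)
  show "V.span (\<Union>X\<in>below V \<Gamma>. X i) \<subseteq> V.span (\<Union>X\<in>{X\<in>D. cls (restr V X) \<in> \<Gamma>}. X i)"
  proof (rule V.span_minimal[OF UN_least V.subspace_span], rule subsetI)
    fix Y y assume Y: "Y \<in> below V \<Gamma>" and y: "y \<in> Y i"
    have yV: "y \<in> spc V i" using subrep_in[OF belowD(1)[OF Y] i y] .
    obtain T where T: "finite T" "T \<subseteq> D" "y = (\<Sum>X\<in>T. proj D X i y)" "\<And>X. X \<in> D \<Longrightarrow> X \<notin> T \<Longrightarrow> proj D X i y = 0"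
      using proj_sum[OF V D(1) i yV] by blast
    have pX: "proj D X i y \<in> V.span (\<Union>X\<in>{X\<in>D. cls (restr V X) \<in> \<Gamma>}. X i)" if X: "X \<in> T" for X
    proof (cases "proj D X i y = 0")
      case True
      then show ?thesis using V.span_zero by simp
    next
      case False
      have XD: "X \<in> D" using X T(2) by blast
      have "nonzero_morphism Q (restr V Y) (restr V X) (proj D X)"
        using morphism_restr_dom[OF proj_morphism[OF V D(1) XD] belowD(1)[OF Y]] False i y
        by (auto simp: nonzero_morphism_def)
      then have "(cls (restr V X), cls (restr V Y)) \<in> LE" by (rule hom_le[OF belowD(2)[OF Y] D(2)[OF XD]])
      then have "cls (restr V X) \<in> \<Gamma>" using down belowD(3)[OF Y] by blast
      then show ?thesis using proj_in[OF V D(1) XD i yV] XD by (intro V.span_base) blast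
    qed
    show "y \<in> V.span (\<Union>X\<in>{X\<in>D. cls (restr V X) \<in> \<Gamma>}. X i)"
      by (subst T(3)) (rule V.span_sum[OF pX])
  qed
qed

lemma LE_less_trans: "(\<alpha>, \<gamma>) \<in> LE \<Longrightarrow> (\<gamma>, \<beta>) \<in> LE - Id \<Longrightarrow> (\<alpha>, \<beta>) \<in> LE - Id"
  using LE_trans[of \<alpha> \<gamma> \<beta>] LE_antisym[of \<gamma> \<beta>] by auto

lemma decomposition_independent_mod:
  assumes D: "decomposes V D" "\<And>X. X \<in> D \<Longrightarrow> fin_indec (restr V X)"
  shows "independent_mod V \<beta> {X\<in>D. cls (restr V X) = \<beta>}"
  unfolding independent_mod_def[OF V]
proof (intro ballI allI impI)
  fix i T f X assume i: "i \<in> verts Q" and T: "finite T" "T \<subseteq> {X\<in>D. cls (restr V X) = \<beta>}" "\<forall>X\<in>T. f X \<in> X i"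
    "(\<Sum>X\<in>T. f X) \<in> F_less Q V \<beta> i" "X \<in> T"
  let ?L = "{X\<in>D. cls (restr V X) \<in> {\<alpha>. (\<alpha>, \<beta>) \<in> LE - Id}}"
  have sub: "V.subspace (X i)" if "X \<in> D" for X using subrep_subspace[OF decomposes_subrep[OF D(1) that] i] .
  have "F_less Q V \<beta> i = V.span (\<Union>X\<in>?L. X i)"
    unfolding F_less_eq[OF V] by (rule filtered_span[OF D _ i]) (use LE_less_trans in blast)+
  then have "(\<Sum>X\<in>T. f X) \<in> V.span (\<Union>X\<in>?L. X i)" using T(4) by simp
  then obtain U g where U: "finite U" "U \<subseteq> ?L" "\<forall>X\<in>U. g X \<in> X i" "(\<Sum>X\<in>T. f X) = (\<Sum>X\<in>U. g X)"
    using span_UN_iff_finite_sum[OF rep_vs[OF V], of ?L "\<lambda>X. X i" "\<Sum>X\<in>T. f X"] sub by blast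
  have disj: "T \<inter> U = {}" using T(2) U(2) by auto
  define h where "h = (\<lambda>Y. if Y \<in> T then f Y else - g Y)"
  have hT: "(\<Sum>Y\<in>T. h Y) = (\<Sum>Y\<in>T. f Y)" by (rule sum.cong) (auto simp: h_def)
  have hU: "(\<Sum>Y\<in>U. h Y) = - (\<Sum>Y\<in>U. g Y)"
    unfolding sum_negf[symmetric] by (rule sum.cong) (use disj in \<open>auto simp: h_def\<close>)
  have "(\<Sum>Y\<in>T \<union> U. h Y) = 0" using sum.union_disjoint[OF T(1) U(1) disj, of h] hT hU U(4) by simp
  moreover have "h Y \<in> Y i" if "Y \<in> T \<union> U" for Y
    using that T(3) U(2,3) V.subspace_neg[OF sub[of Y], of "g Y"] by (auto simp: h_def)
  moreover have "is_direct_sum Q V (spc V) D (\<lambda>X. X)" using D(1) by (simp add: decomposes_def)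
  ultimately have "h X = 0"
    by (intro is_direct_sum_zero[of V "spc V" D "\<lambda>X. X" i "T \<union> U" h]) (use i T U in auto)
  then show "f X = 0" using T(5) by (simp add: h_def)
qed

text \<open>
  The map \<open>p\<close> divides out \<open>F_less\<close> at \<open>q\<close>. Bases of the spaces \<open>X q\<close> for \<open>X \<in> E\<close> together remain independent,
  and they have \<open>d\<close> elements for each member of \<open>E\<close>.
\<close>

lemma graded_basis:
  assumes E: "E \<subseteq> below V {\<beta>}" "independent_mod V \<beta> E" and q: "q \<in> verts Q"
    and d: "\<And>X. X \<in> E \<Longrightarrow> V.dim (X q) = d"
    and p: "Vector_Spaces.linear (scal V) (scal V) p" "\<And>x. p x = 0 \<longleftrightarrow> x \<in> F_less Q V \<beta> q"
  obtains B where "V.independent B" "V.span B = p ` V.span (\<Union>X\<in>E. X q)" "B \<approx> E \<times> {..<d}"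
proof -
  interpret p: Vector_Spaces.linear "scal V" "scal V" p by fact
  have "\<forall>X\<in>E. \<exists>e. inj_on e {..<d} \<and> V.independent (e ` {..<d}) \<and> V.span (e ` {..<d}) = X q"
  proof
    fix X assume X: "X \<in> E"
    have sub: "subrep Q V X" and fi: "fin_indec (restr V X)" using E(1) X by (auto simp: below_def)
    have fd: "fin_dim (scal V) (X q)" using flei_fin_dim[OF fin_indec_flei[OF fi] q] by simp
    obtain B where B: "finite B" "V.independent B" "V.span B = X q" "card B = V.dim (X q)"
      using fin_dim_basis[OF rep_vs[OF V] fd subrep_subspace[OF sub q] order_refl] .
    obtain e where "bij_betw e {0..<card B} B" using ex_bij_betw_nat_finite[OF B(1)] by blast
    then have "inj_on e {..<d}" "e ` {..<d} = B" using B(4) d[OF X] by (auto simp: bij_betw_def atLeast0LessThan)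
    then show "\<exists>e. inj_on e {..<d} \<and> V.independent (e ` {..<d}) \<and> V.span (e ` {..<d}) = X q"
      using B(2,3) by (intro exI[of _ e]) simp
  qed
  then obtain e where e: "\<And>X. X \<in> E \<Longrightarrow> inj_on (e X) {..<d}" "\<And>X. X \<in> E \<Longrightarrow> V.independent (e X ` {..<d})"
    "\<And>X. X \<in> E \<Longrightarrow> V.span (e X ` {..<d}) = X q" by metis
  have eX: "e X n \<in> X q" if "X \<in> E" "n < d" for X n
    using V.span_base[of "e X n" "e X ` {..<d}"] e(3) that by auto
  let ?g = "\<lambda>(X, n). p (e X n)"
  have key: "u s = 0" if K: "finite K" "K \<subseteq> E \<times> {..<d}" "(\<Sum>s\<in>K. scal V (u s) (?g s)) = 0" "s \<in> K" for K u s
  proof -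
    define T where "T = fst ` K"
    define N where "N = (\<lambda>X. {n. (X, n) \<in> K})"
    have KS: "K = Sigma T N" by (force simp: T_def N_def)
    have fT: "finite T" using K(1) by (simp add: T_def)
    have TE: "T \<subseteq> E" using K(2) by (auto simp: T_def)
    have N: "N X \<subseteq> {..<d}" for X using K(2) by (auto simp: N_def)
    then have fN: "finite (N X)" for X using finite_subset by blast
    define f where "f = (\<lambda>X. \<Sum>n\<in>N X. scal V (u (X, n)) (e X n))"
    have fX: "f X \<in> X q" if "X \<in> T" for X
    proof -
      have XE: "X \<in> E" using that TE by blast
      have sX: "V.subspace (X q)" using E(1) XE q by (auto simp: below_def subrep_subspace)
      show ?thesis unfolding f_def
        using eX[OF XE] N[of X] by (intro V.subspace_sum[OF sX] V.subspace_scale[OF sX]) auto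
    qed
    have "p (\<Sum>X\<in>T. f X) = (\<Sum>X\<in>T. \<Sum>n\<in>N X. scal V (u (X, n)) (p (e X n)))"
      by (simp add: f_def p.sum p.scale)
    also have "\<dots> = (\<Sum>(X, n)\<in>Sigma T N. scal V (u (X, n)) (p (e X n)))"
      using fT fN by (simp add: sum.Sigma)
    also have "\<dots> = (\<Sum>s\<in>K. scal V (u s) (?g s))" unfolding KS by (rule sum.cong) auto
    finally have fF: "(\<Sum>X\<in>T. f X) \<in> F_less Q V \<beta> q" using p(2) K(3) by simp
    have f0: "f X = 0" if "X \<in> T" for X
      by (rule independent_modD[where f = f, OF V E(2) q fT TE fX fF that])
    obtain X n where s: "s = (X, n)" by (cases s)
    have XT: "X \<in> T" and nN: "n \<in> N X" using K(4) s by (force simp: T_def N_def)+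
    have XE: "X \<in> E" using XT TE by blast
    have inj: "inj_on (e X) (N X)" using inj_on_subset[OF e(1)[OF XE] N] .
    have "(\<Sum>v\<in>e X ` N X. scal V (u (X, inv_into (N X) (e X) v)) v) = f X"
      unfolding f_def by (simp add: sum.reindex[OF inj] inv_into_f_f[OF inj] cong: sum.cong)
    then have "u (X, inv_into (N X) (e X) (e X n)) = 0"
      by (intro V.independentD[OF e(2)[OF XE], of "e X ` N X"]) (use fN N nN f0[OF XT] in auto)
    then show ?thesis using s inv_into_f_f[OF inj nN] by simp
  qed
  have inj: "inj_on ?g (E \<times> {..<d})"
  proof (rule inj_onI, rule ccontr)
    fix s t assume st: "s \<in> E \<times> {..<d}" "t \<in> E \<times> {..<d}" "?g s = ?g t" "s \<noteq> t"
    have "(\<Sum>r\<in>{s, t}. scal V ((\<lambda>r. if r = s then 1 else - 1) r) (?g r)) = ?g s - ?g t"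
      using st(4) by simp
    then have "(\<Sum>r\<in>{s, t}. scal V ((\<lambda>r. if r = s then 1 else - 1) r) (?g r)) = 0" using st(3) by simp
    from key[OF _ _ this, of s] show False using st by simp
  qed
  let ?B = "?g ` (E \<times> {..<d})"
  have "V.independent ?B"
    unfolding V.independent_explicit_finite_subsets
  proof (intro allI impI ballI)
    fix S u v assume S: "S \<subseteq> ?B" "finite S" "(\<Sum>v\<in>S. scal V (u v) v) = 0" "v \<in> S"
    obtain K where K: "K \<subseteq> E \<times> {..<d}" "S = ?g ` K" using S(1) by (meson subset_image_iff)
    have injK: "inj_on ?g K" using inj_on_subset[OF inj K(1)] .
    have fK: "finite K" using S(2) K(2) finite_imageD[OF _ injK] by blast
    have "(\<Sum>s\<in>K. scal V (u (?g s)) (?g s)) = 0" using S(3) unfolding K(2) by (simp add: sum.reindex[OF injK])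
    from key[OF fK K(1) this] show "u v = 0" using S(4) K(2) by auto
  qed
  moreover have "V.span ?B = p ` V.span (\<Union>X\<in>E. X q)"
  proof -
    have B: "?B = p ` (\<Union>X\<in>E. e X ` {..<d})" by force
    have "V.span (\<Union>X\<in>E. e X ` {..<d}) = V.span (\<Union>X\<in>E. X q)"
    proof
      show "V.span (\<Union>X\<in>E. e X ` {..<d}) \<subseteq> V.span (\<Union>X\<in>E. X q)"
        using eX by (intro V.span_mono) auto
      have "X q \<subseteq> V.span (\<Union>X\<in>E. e X ` {..<d})" if "X \<in> E" for X
        unfolding e(3)[OF that, symmetric] using that by (intro V.span_mono) auto
      then show "V.span (\<Union>X\<in>E. X q) \<subseteq> V.span (\<Union>X\<in>E. e X ` {..<d})"
        by (intro V.span_minimal[OF UN_least V.subspace_span])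
    qed
    then show ?thesis unfolding B p.span_image by simp
  qed
  moreover have "?B \<approx> E \<times> {..<d}" using inj_on_image_eqpoll_self[OF inj] .
  ultimately show ?thesis using that by blast
qed

text \<open>
  At a vertex \<open>q\<close> where the class \<open>\<beta>\<close> has dimension \<open>d > 0\<close>, the quotient of \<open>F\<close> by \<open>F_less\<close> does not depend
  on the decomposition, and its dimension is \<open>d\<close> times the number of members of class \<open>\<beta>\<close>.
\<close>

lemma multiplicities_unique:
  assumes D: "decomposes V D" "\<And>X. X \<in> D \<Longrightarrow> fin_indec (restr V X)"
    and D': "decomposes V D'" "\<And>X. X \<in> D' \<Longrightarrow> fin_indec (restr V X)"
    and \<beta>: "\<beta> \<in> indec_flei Q"
  shows "{X\<in>D. cls (restr V X) = \<beta>} \<approx> {X\<in>D'. cls (restr V X) = \<beta>}"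
proof -
  obtain W :: "('v, 'a, 'k, 'k poly) rep" where W: "fin_indec W" "\<beta> = cls W" using \<beta> unfolding indec_flei_eq by blast
  obtain q w where q: "q \<in> verts Q" "w \<in> spc W q" "w \<noteq> 0" using fin_indec_vector[OF W(1)] .
  define d where "d = vector_space.dim (scal W) (spc W q)"
  have rW: "quiver_rep Q W" by (rule fin_indec_rep[OF W(1)])
  have "d \<noteq> 0"
  proof
    assume "d = 0"
    interpret W: vector_space "scal W" by (rule rep_vs[OF rW])
    obtain B where B: "finite B" "W.span B = spc W q" "card B = W.dim (spc W q)"
      using fin_dim_basis[OF rep_vs[OF rW] flei_fin_dim[OF fin_indec_flei[OF W(1)] q(1)] rep_subspace[OF rW q(1)] order_refl] .
    then have "B = {}" using \<open>d = 0\<close> by (simp add: d_def)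
    then show False using B(2) q(2,3) by auto
  qed
  obtain p where p0: "linear_on (scal V) (scal V) UNIV p" "p ` UNIV \<subseteq> UNIV"
    "\<And>x. x \<in> UNIV \<Longrightarrow> p x = 0 \<longleftrightarrow> x \<in> F_less Q V \<beta> q" "\<And>x. x \<in> UNIV \<Longrightarrow> x - p x \<in> F_less Q V \<beta> q"
    using exists_projection_along[OF rep_vs[OF V] F_subspace(2)[OF V, of \<beta> q] V.subspace_UNIV subset_UNIV] by blast
  have p: "linear_on (scal V) (scal V) UNIV p" "\<And>x. p x = 0 \<longleftrightarrow> x \<in> F_less Q V \<beta> q"
    using p0(1,3) by auto
  have lp: "Vector_Spaces.linear (scal V) (scal V) p"
    using p(1) rep_vs[OF V] by (simp add: Vector_Spaces.linear_iff linear_on_def)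
  interpret p: Vector_Spaces.linear "scal V" "scal V" p by (rule lp)
  have basis: "\<exists>B. V.independent B \<and> V.span B = p ` F Q V \<beta> q \<and> B \<approx> {X\<in>D. cls (restr V X) = \<beta>} \<times> {..<d}"
    if D: "decomposes V D" "\<And>X. X \<in> D \<Longrightarrow> fin_indec (restr V X)" for D
  proof -
    let ?E = "{X\<in>D. cls (restr V X) = \<beta>}"
    have E: "?E \<subseteq> below V {\<beta>}" using D(2) decomposes_subrep[OF D(1)] by (auto simp: below_def)
    have dE: "V.dim (X q) = d" if "X \<in> ?E" for X
    proof -
      have "isomorphic Q W (restr V X)" using cls_eqD[OF W(1) D(2)] that W(2) by simp
      then show ?thesis
        using isomorphic_dim[OF rW _ fin_indec_flei[OF W(1)] _ q(1), of "restr V X"] fin_indec_rep[OF D(2)] that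
        by (simp add: d_def)
    qed
    have indE: "independent_mod V \<beta> ?E" by (rule decomposition_independent_mod[OF D])
    obtain B where B: "V.independent B" "V.span B = p ` V.span (\<Union>X\<in>?E. X q)" "B \<approx> ?E \<times> {..<d}"
      by (rule graded_basis[where p = p and q = q and d = d, OF E indE q(1) _ lp p(2)]) (erule dE, erule (2) that)
    let ?L = "{X\<in>D. cls (restr V X) \<in> {\<alpha>. (\<alpha>, \<beta>) \<in> LE - Id}}"
    have FL: "F_less Q V \<beta> q = V.span (\<Union>X\<in>?L. X q)"
      unfolding F_less_eq[OF V] by (rule filtered_span[OF D _ q(1)]) (use LE_less_trans in blast)+
    have "F Q V \<beta> q = V.span (\<Union>X\<in>{X\<in>D. cls (restr V X) \<in> {\<alpha>. (\<alpha>, \<beta>) \<in> LE}}. X q)"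
      unfolding F_eq[OF V] by (rule filtered_span[OF D _ q(1)]) (use LE_trans in blast)+
    also have "{X\<in>D. cls (restr V X) \<in> {\<alpha>. (\<alpha>, \<beta>) \<in> LE}} = ?L \<union> ?E" using LE_refl[OF \<beta>] by auto
    finally have Fq: "F Q V \<beta> q = {x + y | x y. x \<in> F_less Q V \<beta> q \<and> y \<in> V.span (\<Union>X\<in>?E. X q)}"
      by (simp only: UN_Un V.span_Un FL)
    have pxy: "p (x + y) = p y" if "x \<in> F_less Q V \<beta> q" for x y using p(2) that by (simp add: p.add)
    have "p ` F Q V \<beta> q = p ` V.span (\<Union>X\<in>?E. X q)"
    proof (intro equalityI image_subsetI)
      fix z assume "z \<in> F Q V \<beta> q"
      then obtain x y where "x \<in> F_less Q V \<beta> q" "y \<in> V.span (\<Union>X\<in>?E. X q)" "z = x + y" unfolding Fq by blast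
      then show "p z \<in> p ` V.span (\<Union>X\<in>?E. X q)" using pxy by blast
    next
      fix y assume y: "y \<in> V.span (\<Union>X\<in>?E. X q)"
      have "0 + y \<in> F Q V \<beta> q" unfolding Fq using V.subspace_0[OF F_subspace(2)[OF V]] y by blast
      then show "p y \<in> p ` F Q V \<beta> q" by simp
    qed
    then show ?thesis using B by (intro exI[of _ B]) simp
  qed
  obtain B where B: "V.independent B" "V.span B = p ` F Q V \<beta> q" "B \<approx> {X\<in>D. cls (restr V X) = \<beta>} \<times> {..<d}"
    using basis[OF D] by blast
  obtain B' where B': "V.independent B'" "V.span B' = p ` F Q V \<beta> q" "B' \<approx> {X\<in>D'. cls (restr V X) = \<beta>} \<times> {..<d}"
    using basis[OF D'] by blast
  have "B \<approx> B'" using V.bij_if_span_eq_span_bases[OF B(1) B'(1)] B(2) B'(2) by (simp add: eqpoll_def)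
  then have "{X\<in>D. cls (restr V X) = \<beta>} \<times> {..<d} \<approx> {X\<in>D'. cls (restr V X) = \<beta>} \<times> {..<d}"
    using B(3) B'(3) by (meson eqpoll_sym eqpoll_trans)
  then show ?thesis using times_finite_cancel \<open>d \<noteq> 0\<close> by blast
qed

lemma decomposition_unique:
  assumes D: "decomposes V D" "\<And>X. X \<in> D \<Longrightarrow> fin_indec (restr V X)"
    and D': "decomposes V D'" "\<And>X. X \<in> D' \<Longrightarrow> fin_indec (restr V X)"
  shows "same_summands Q V D D'"
proof -
  let ?E = "\<lambda>D \<beta>. {X\<in>D. cls (restr V X) = \<beta>}"
  have "\<forall>\<beta>\<in>indec_flei Q. \<exists>h. bij_betw h (?E D \<beta>) (?E D' \<beta>)"
    using multiplicities_unique[OF D D'] by (simp add: eqpoll_def)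
  from bchoice[OF this] obtain h where h': "\<forall>\<beta>\<in>indec_flei Q. bij_betw (h \<beta>) (?E D \<beta>) (?E D' \<beta>)" by (elim exE)
  note h = bspec[OF h']
  let ?h = "\<lambda>X. h (cls (restr V X)) X"
  have hin: "?h X \<in> D' \<and> cls (restr V (?h X)) = cls (restr V X)" if "X \<in> D" for X
    using h[OF cls_in[OF D(2)[OF that]]] that by (auto simp: bij_betw_def)
  have "bij_betw ?h D D'"
    unfolding bij_betw_def
  proof
    show "inj_on ?h D"
    proof (rule inj_onI)
      fix X Y assume XY: "X \<in> D" "Y \<in> D" "?h X = ?h Y"
      then have "cls (restr V X) = cls (restr V Y)" using hin by metis
      then show "X = Y"
        using h[OF cls_in[OF D(2)[OF XY(1)]]] XY by (auto simp: bij_betw_def dest: inj_onD)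
    qed
    show "?h ` D = D'"
    proof
      show "?h ` D \<subseteq> D'" using hin by blast
      show "D' \<subseteq> ?h ` D"
      proof
        fix Y assume Y: "Y \<in> D'"
        have "Y \<in> h (cls (restr V Y)) ` ?E D (cls (restr V Y))"
          using h[OF cls_in[OF D'(2)[OF Y]]] Y by (simp add: bij_betw_def)
        then obtain X where X: "X \<in> D" "cls (restr V X) = cls (restr V Y)" "Y = h (cls (restr V Y)) X" by blast
        then have "Y = ?h X" by simp
        then show "Y \<in> ?h ` D" using X(1) by (rule image_eqI)
      qed
    qed
  qed
  moreover have "isomorphic Q (restr V X) (restr V (?h X))" if "X \<in> D" for X
    using cls_eqD[OF D(2)[OF that] D'(2)] hin[OF that] by simp
  ultimately show ?thesis unfolding same_summands_def by blast
qed

text \<open>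
  One member of a decomposition into FLEI representations is a nonzero direct summand of \<open>V\<close>, hence all
  of \<open>V\<close>.
\<close>

lemma indecomposable_flei:
  assumes ind: "indecomposable Q V"
  shows "flei Q V"
proof -
  obtain D where D: "decomposes V D" "\<And>X. X \<in> D \<Longrightarrow> fin_indec (restr V X)" using decomposition_exists by blast
  have "D \<noteq> {}"
  proof
    assume "D = {}"
    then have "zero_family Q (spc V)" using D(1) by (simp add: decomposes_def is_direct_sum_def zero_family_def)
    then show False using ind by (simp add: indecomposable_def)
  qed
  then obtain Y where Y: "Y \<in> D" by blast
  have sY: "subrep Q V Y" using decomposes_subrep[OF D(1) Y] .
  have mY: "morphism Q V (restr V Y) (proj D Y)" by (rule proj_morphism[OF V D(1) Y])
  let ?Z = "\<lambda>i. {x \<in> spc V i. proj D Y i x = 0}"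
  have sZ: "subrep Q V ?Z" by (rule subrep_kernel[OF V quiver_rep_restr[OF V sY] mY])
  have idem: "proj D Y i y = y" if "i \<in> verts Q" "y \<in> Y i" for i y by (rule proj_member(1)[OF V D(1) Y that])
  have ds: "is_direct_sum2 Q V (spc V) Y ?Z"
    unfolding is_direct_sum2_def
  proof (intro ballI conjI equalityI subsetI)
    fix i x assume i: "i \<in> verts Q" and x: "x \<in> spc V i"
    have px: "proj D Y i x \<in> Y i" by (rule proj_in[OF V D(1) Y i x])
    have pV: "proj D Y i x \<in> spc V i" by (rule subrep_in[OF sY i px])
    have "proj D Y i (x - proj D Y i x) = 0"
      using morphism_diff[OF V mY i x pV] idem[OF i px] by simp
    then have "x - proj D Y i x \<in> ?Z i" using rep_diff[OF V i x pV] by simp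
    then show "x \<in> {x + y | x y. x \<in> Y i \<and> y \<in> ?Z i}"
      using px by (intro CollectI exI[of _ "proj D Y i x"] exI[of _ "x - proj D Y i x"]) simp
  next
    fix i x assume i: "i \<in> verts Q" and "x \<in> {x + y | x y. x \<in> Y i \<and> y \<in> ?Z i}"
    then show "x \<in> spc V i" using rep_add[OF V i] subrep_in[OF sY i] by auto
  next
    fix i x assume "i \<in> verts Q" "x \<in> Y i \<inter> ?Z i"
    then show "x \<in> {0}" using idem by auto
  next
    fix i and x :: 'b assume i: "i \<in> verts Q" and x: "x \<in> {0}"
    then show "x \<in> Y i \<inter> ?Z i"
      using V.subspace_0[OF subrep_subspace[OF sY i]] V.subspace_0[OF subrep_subspace[OF sZ i]] by simp
  qed
  have "\<not> zero_family Q Y" using fin_indec_nonzero[OF D(2)[OF Y]] by simp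
  then have Z0: "zero_family Q ?Z" using ind sY sZ ds by (auto simp: indecomposable_def)
  have "isomorphism Q (restr V Y) V (\<lambda>i x. x)"
  proof (rule isomorphismI[OF quiver_rep_restr[OF V sY] morphism_inclusion[OF sY]])
    fix i assume i: "i \<in> verts Q"
    have "spc V i = {x + y | x y. x \<in> Y i \<and> y \<in> ?Z i}" using ds i by (simp add: is_direct_sum2_def)
    moreover have "?Z i = {0}" using Z0 i by (simp add: zero_family_def)
    ultimately show "spc V i \<subseteq> (\<lambda>x. x) ` spc (restr V Y) i" by auto
  qed simp
  then show ?thesis
    using flei_isomorphic[OF quiver_rep_restr[OF V sY] V _ fin_indec_flei[OF D(2)[OF Y]]] by (auto simp: isomorphic_def)
qed

end

end

theorem theorem1:
  fixes Q :: "('v, 'a) pre_digraph"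
    and V :: "('v, 'a, 'k::field, 'b::ab_group_add) rep"
  assumes tree: "tree_quiver Q"
    and poset: "partial_order_on (indec_flei Q :: ('v, 'a, 'k) rep_class set) (indec_le Q)"
    and well_founded:
      "wf_on (indec_flei Q :: ('v, 'a, 'k) rep_class set) (indec_le Q - Id)"
    and V: "quiver_rep Q V"
  shows "(\<forall>G. (\<forall>\<beta>\<in>indec_flei Q.
              subrep Q V (G \<beta>) \<and> (\<forall>i\<in>verts Q. G \<beta> i \<subseteq> F Q V \<beta> i) \<and>
              sum_of_class Q V (G \<beta>) \<beta> \<and>
              is_direct_sum2 Q V (F Q V \<beta>) (F_less Q V \<beta>) (G \<beta>))
            \<longrightarrow> is_direct_sum Q V (spc V) (indec_flei Q) G) \<and>
         (\<exists>D. indec_decomposition Q V D \<and> (\<forall>X\<in>D. flei Q (restr V X))) \<and>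
         (\<forall>D D'. indec_decomposition Q V D \<and> (\<forall>X\<in>D. flei Q (restr V X)) \<and>
                 indec_decomposition Q V D' \<and> (\<forall>X\<in>D'. flei Q (restr V X)) \<longrightarrow>
                 same_summands Q V D D') \<and>
         infinite_krull_schmidt Q {W :: ('v, 'a, 'k, 'b) rep. quiver_rep Q W}"
proof -
  interpret posetal Q "indec_le Q :: (('v, 'a, 'k) rep_class \<times> ('v, 'a, 'k) rep_class) set"
  proof (intro posetal.intro tree_rep.intro rep_quiver.intro tree_rep_axioms.intro posetal_axioms.intro)
    show "wf_digraph Q" using tree by (simp add: tree_quiver_def)
  qed (rule tree refl poset well_founded)+
  have dec: "indec_decomposition Q W D \<longleftrightarrow> decomposes W D \<and> (\<forall>X\<in>D. fin_indec (restr W X))"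
    if W: "quiver_rep Q W" for W :: "('v, 'a, 'k, 'b) rep" and D
    using indecomposable_flei[OF quiver_rep_restr[OF W]]
    by (auto simp: indec_decomposition_def decomposes_def fin_indec_def)
  have ex: "\<exists>D. indec_decomposition Q W D" if W: "quiver_rep Q W" for W :: "('v, 'a, 'k, 'b) rep"
    using decomposition_exists[OF W] dec[OF W] by metis
  have uniq: "same_summands Q W D D'"
    if W: "quiver_rep Q W" and "indec_decomposition Q W D" "indec_decomposition Q W D'" for W :: "('v, 'a, 'k, 'b) rep" and D D'
    using decomposition_unique[OF W] that(2,3) dec[OF W] by blast
  have fl: "flei Q (restr V X)" if "indec_decomposition Q V D" "X \<in> D" for D X
    using that dec[OF V] fin_indec_flei by blast
  show ?thesis
  proof (intro conjI allI impI)
    fix G assume "\<forall>\<beta>\<in>indec_flei Q. subrep Q V (G \<beta>) \<and> (\<forall>i\<in>verts Q. G \<beta> i \<subseteq> F Q V \<beta> i) \<and>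
              sum_of_class Q V (G \<beta>) \<beta> \<and> is_direct_sum2 Q V (F Q V \<beta>) (F_less Q V \<beta>) (G \<beta>)"
    then show "is_direct_sum Q V (spc V) (indec_flei Q) G" by (intro complements_direct_sum[OF V]) auto
  next
    show "\<exists>D. indec_decomposition Q V D \<and> (\<forall>X\<in>D. flei Q (restr V X))" using ex[OF V] fl by blast
  next
    fix D D' assume "indec_decomposition Q V D \<and> (\<forall>X\<in>D. flei Q (restr V X)) \<and>
      indec_decomposition Q V D' \<and> (\<forall>X\<in>D'. flei Q (restr V X))"
    then show "same_summands Q V D D'" using uniq[OF V] by blast
  next
    show "infinite_krull_schmidt Q {W :: ('v, 'a, 'k, 'b) rep. quiver_rep Q W}"
      unfolding infinite_krull_schmidt_def using ex uniq by blast
  qed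
qed

end
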